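(* Let $m>n\ge 1$ and $1\le k\le m$. The branching algebra $\mathcal{B}_{m,k}^{n}=\mathbb{C}[\mathsf{M}_{m,k}]^{U_n\times U_k}$ for $(GL_m,GL_n)$ is graded by $\Lambda_{k,n}$, $$\mathcal{B}_{m,k}^{n}=\bigoplus_{(F,D)\in\Lambda_{k,n}}\mathcal{B}_{m,k}^{n}(F,D),$$ and for each $(F,D)\in\Lambda_{k,n}$ the standard monomials $\Delta_{\mathsf t}$ with $\mathsf t\in\mathcal{T}_m^n(F,D)$ form a $\mathbb{C}$-basis of the $(F,D)$-graded component $\mathcal{B}_{m,k}^{n}(F,D)$.
   Context: Young diagrams are identified with weakly decreasing sequences $F=(f_1,f_2,\dots)$ of non-negative integers with finitely many nonzero terms; $\ell(F)$ is the number of nonzero terms, $F^t$ is the conjugate diagram, $F\supseteq D$ means $f_r\ge d_r$ for all $r$, and diagrams are added entrywise. $\Lambda_{a,b}=\{(F,D):\ell(F)\le a,\ \ell(D)\le b,\ F\supseteq D\}$, a monoid under addition. The group $GL_m\times GL_k$ acts on the space $\mathsf{M}_{m,k}$ of complex $m\times k$ matrices by $(g_1,g_2)\cdot Q=(g_1^t)^{-1}Qg_2^{-1}$, hence on the polynomial ring $\mathbb{C}[\mathsf{M}_{m,k}]$ by $(g\cdot f)(Q)=f(g^{-1}\cdot Q)$. $U_r\subset GL_r$ is the group of upper triangular matrices with $1$'s on the diagonal and $A_r\subset GL_r$ the diagonal subgroup. $GL_n$ is embedded in $GL_m$ by $X\mapsto\begin{bmatrix}X&0\\0&I\end{bmatrix}$.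 By $GL_m$-$GL_k$ duality, $\mathbb{C}[\mathsf{M}_{m,k}]^{U_k}=\bigoplus_{\ell(F)\le k}\rho_m^F$, where the $F$-summand is the space of $A_k$-eigenvectors of weight $\mathrm{diag}(a_1,\dots,a_k)\mapsto a_1^{f_1}\cdots a_k^{f_k}$ and is isomorphic to the irreducible polynomial representation $\rho_m^F$ of $GL_m$ with highest weight $F$. The component $\mathcal{B}_{m,k}^n(F,D)$ is the subspace of $(\rho_m^F)^{U_n}$ on which $\mathrm{diag}(a_1,\dots,a_n)\in A_n\subset GL_n$ acts by $a_1^{d_1}\cdots a_n^{d_n}$. $\mathcal{L}_m$ is the set of nonempty subsets $I=[i_1,\dots,i_a]$, $i_1<\cdots<i_a$, of $\{1,\dots,m\}$, with $|I|=a$, ordered by the tableau order: $I\preceq J$ iff $|I|\ge|J|$ and the $c$-th smallest element of $I$ is $\le$ the $c$-th smallest element of $J$ for $1\le c\le|J|$. $\mathcal{L}_m^n\subset\mathcal{L}_m$ consists of the sets $[1,2,\dots,r,a_1,\dots,a_s]$, $[1,2,\dots,r]$, $[a_1,\dots,a_s]$ with $r\le n$ and $n+1\le a_1<\cdots<a_s\le m$. A standard tableau for $(GL_m,GL_n)$ is a multiple chain (repetitions allowed) $\mathsf t=(I_1\preceq\cdots\preceq I_s)$ in $\mathcal{L}_m^n$; its shape is $F/D$ where $F=(|I_1|,\dots,|I_s|)^t$ and $D=(d_1,\dots,d_n)$ with $d_r$ the number of $r$'s occurring in $\mathsf t$ (i.e. the number of $c$ with $r\in I_c$). $\mathcal{T}_m^n(F,D)$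 is the set of all standard tableaux for $(GL_m,GL_n)$ of shape $F/D$. For $I=[i_1,\dots,i_r]$ with $r\le k$, $\delta_I(Q)$ is the determinant of the submatrix of $Q$ with rows $i_1,\dots,i_r$ and columns $1,\dots,r$. For a chain $\mathsf t=(I_1\preceq\cdots\preceq I_s)$ with all $|I_c|\le k$, the standard monomial is $\Delta_{\mathsf t}=\delta_{I_1}\cdots\delta_{I_s}$. *)

theory Defs
  imports
    "HOL-Library.Function_Algebras"
    "HOL-Library.Product_Plus"
    "Jordan_Normal_Form.Determinant"
    "Jordan_Normal_Form.Gauss_Jordan_Elimination"
    "Jordan_Normal_Form.DL_Submatrix"
begin

text \<open>
  Rows, columns, entries of tableaux and parts of diagrams are all indexed from 0, so that an
  index or an entry \<open>i\<close> here is the \<open>i + 1\<close> of the usual notation.  In particular the entries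
  of \<open>GL\<^sub>m\<close>-tableaux are \<open>0, \<dots>, m - 1\<close>, and those belonging to \<open>GL\<^sub>n\<close> are \<open>0, \<dots>, n - 1\<close>.
\<close>

section \<open>Young diagrams\<close>

definition young_diagram :: "(nat \<Rightarrow> nat) \<Rightarrow> bool" where
  "young_diagram F \<longleftrightarrow> antimono F \<and> finite {r. F r \<noteq> 0}"

definition diagram_length :: "(nat \<Rightarrow> nat) \<Rightarrow> nat" where
  "diagram_length F = card {r. F r \<noteq> 0}"

definition conjugate_diagram :: "(nat \<Rightarrow> nat) \<Rightarrow> nat \<Rightarrow> nat" where
  "conjugate_diagram F = (\<lambda>r. card {c. r < F c})"

definition diagram_pairs :: "nat \<Rightarrow> nat \<Rightarrow> ((nat \<Rightarrow> nat) \<times> (nat \<Rightarrow> nat)) set" where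
  "diagram_pairs a b =
     {(F, D). young_diagram F \<and> young_diagram D \<and>
              diagram_length F \<le> a \<and> diagram_length D \<le> b \<and> (\<forall>r. D r \<le> F r)}"

section \<open>Polynomial functions on matrices\<close>

text \<open>
  The polynomial ring of the space of complex \<open>m \<times> k\<close> matrices is taken to be its ring of
  polynomial functions, the ground field being infinite.  Functions on that space are represented
  by total functions which vanish on all matrices of other dimensions; the sum, product and zero
  of functions are then the pointwise ones, but the unit of the ring is \<open>mat_one m k\<close>, not \<open>1\<close>.
\<close>

definition on_mats :: "nat \<Rightarrow> nat \<Rightarrow> (complex mat \<Rightarrow> complex) \<Rightarrow> complex mat \<Rightarrow> complex" where
  "on_mats m k f = (\<lambda>Q. if Q \<in> carrier_mat m k then f Q else 0)"

definition mat_one :: "nat \<Rightarrow> nat \<Rightarrow> complex mat \<Rightarrow> complex" where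
  "mat_one m k = on_mats m k (\<lambda>Q. 1)"

inductive_set polynomial_functions :: "nat \<Rightarrow> nat \<Rightarrow> (complex mat \<Rightarrow> complex) set"
  for m k :: nat where
  const: "on_mats m k (\<lambda>Q. c) \<in> polynomial_functions m k"
| coord: "i < m \<Longrightarrow> j < k \<Longrightarrow> on_mats m k (\<lambda>Q. Q $$ (i, j)) \<in> polynomial_functions m k"
| add: "f \<in> polynomial_functions m k \<Longrightarrow> g \<in> polynomial_functions m k \<Longrightarrow>
        f + g \<in> polynomial_functions m k"
| mult: "f \<in> polynomial_functions m k \<Longrightarrow> g \<in> polynomial_functions m k \<Longrightarrow>
         f * g \<in> polynomial_functions m k"

definition fun_scale :: "complex \<Rightarrow> (complex mat \<Rightarrow> complex) \<Rightarrow> complex mat \<Rightarrow> complex" where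
  "fun_scale c f = (\<lambda>Q. c * f Q)"

interpretation mat_fun: vector_space fun_scale
  by standard (auto simp: fun_scale_def fun_eq_iff algebra_simps)

definition is_subalgebra :: "nat \<Rightarrow> nat \<Rightarrow> (complex mat \<Rightarrow> complex) set \<Rightarrow> bool" where
  "is_subalgebra m k B \<longleftrightarrow>
     B \<subseteq> polynomial_functions m k \<and> mat_fun.subspace B \<and> mat_one m k \<in> B \<and>
     (\<forall>f\<in>B. \<forall>g\<in>B. f * g \<in> B)"

definition is_direct_sum ::
  "'i set \<Rightarrow> ('i \<Rightarrow> (complex mat \<Rightarrow> complex) set) \<Rightarrow> (complex mat \<Rightarrow> complex) set \<Rightarrow> bool" where
  "is_direct_sum L C B \<longleftrightarrow>
     mat_fun.subspace B \<and> (\<forall>i\<in>L. mat_fun.subspace (C i) \<and> C i \<subseteq> B) \<and>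
     (\<forall>f\<in>B. \<exists>!x. (\<forall>i\<in>L. x i \<in> C i) \<and> (\<forall>i. i \<notin> L \<longrightarrow> x i = 0) \<and>
                  finite {i. x i \<noteq> 0} \<and> f = (\<Sum>i\<in>{i. x i \<noteq> 0}. x i))"

definition is_graded_algebra ::
  "nat \<Rightarrow> nat \<Rightarrow> 'i::comm_monoid_add set \<Rightarrow> ('i \<Rightarrow> (complex mat \<Rightarrow> complex) set) \<Rightarrow>
   (complex mat \<Rightarrow> complex) set \<Rightarrow> bool" where
  "is_graded_algebra m k L C B \<longleftrightarrow>
     is_subalgebra m k B \<and>
     0 \<in> L \<and> (\<forall>i\<in>L. \<forall>j\<in>L. i + j \<in> L) \<and>
     is_direct_sum L C B \<and>
     mat_one m k \<in> C 0 \<and>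
     (\<forall>i\<in>L. \<forall>j\<in>L. \<forall>f\<in>C i. \<forall>g\<in>C j. f * g \<in> C (i + j))"

definition is_indexed_basis ::
  "('i \<Rightarrow> complex mat \<Rightarrow> complex) \<Rightarrow> 'i set \<Rightarrow> (complex mat \<Rightarrow> complex) set \<Rightarrow> bool" where
  "is_indexed_basis v T V \<longleftrightarrow>
     inj_on v T \<and> mat_fun.independent (v ` T) \<and> mat_fun.span (v ` T) = V"

section \<open>The group action and the branching algebra\<close>

definition GL :: "nat \<Rightarrow> complex mat set" where
  "GL r = {g \<in> carrier_mat r r. invertible_mat g}"

definition GL_inv :: "complex mat \<Rightarrow> complex mat" where
  "GL_inv g = the (mat_inverse g)"

definition unipotent :: "nat \<Rightarrow> complex mat set" where
  "unipotent r = {g \<in> GL r. upper_triangular g \<and> (\<forall>i<r. g $$ (i, i) = 1)}"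

definition torus :: "nat \<Rightarrow> complex mat set" where
  "torus r = {g \<in> GL r. diagonal_mat g}"

definition weight :: "nat \<Rightarrow> (nat \<Rightarrow> nat) \<Rightarrow> complex mat \<Rightarrow> complex" where
  "weight r F a = (\<Prod>i<r. (a $$ (i, i)) ^ F i)"

definition GL_embed :: "nat \<Rightarrow> nat \<Rightarrow> complex mat \<Rightarrow> complex mat" where
  "GL_embed m n X = four_block_mat X (0\<^sub>m n (m - n)) (0\<^sub>m (m - n) n) (1\<^sub>m (m - n))"

definition mat_act :: "complex mat \<Rightarrow> complex mat \<Rightarrow> complex mat \<Rightarrow> complex mat" where
  "mat_act g h Q = GL_inv (transpose_mat g) * Q * GL_inv h"

definition fun_act :: "nat \<Rightarrow> nat \<Rightarrow> complex mat \<Rightarrow> complex mat \<Rightarrow>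
    (complex mat \<Rightarrow> complex) \<Rightarrow> complex mat \<Rightarrow> complex" where
  "fun_act m k g h f = on_mats m k (\<lambda>Q. f (mat_act (GL_inv g) (GL_inv h) Q))"

definition branching_algebra :: "nat \<Rightarrow> nat \<Rightarrow> nat \<Rightarrow> (complex mat \<Rightarrow> complex) set" where
  "branching_algebra m k n =
     {f \<in> polynomial_functions m k.
        \<forall>u\<in>unipotent n. \<forall>v\<in>unipotent k. fun_act m k (GL_embed m n u) v f = f}"

text \<open>The copy of the irreducible \<open>GL\<^sub>m\<close>-representation with highest weight \<open>F\<close> inside the
  \<open>U\<^sub>k\<close>-invariant polynomials.\<close>

definition GL_rep :: "nat \<Rightarrow> nat \<Rightarrow> (nat \<Rightarrow> nat) \<Rightarrow> (complex mat \<Rightarrow> complex) set" where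
  "GL_rep m k F =
     {f \<in> polynomial_functions m k.
        (\<forall>v\<in>unipotent k. fun_act m k (1\<^sub>m m) v f = f) \<and>
        (\<forall>a\<in>torus k. fun_act m k (1\<^sub>m m) a f = fun_scale (weight k F a) f)}"

definition branching_component ::
  "nat \<Rightarrow> nat \<Rightarrow> nat \<Rightarrow> (nat \<Rightarrow> nat) \<times> (nat \<Rightarrow> nat) \<Rightarrow> (complex mat \<Rightarrow> complex) set" where
  "branching_component m k n = (\<lambda>(F, D).
     {f \<in> GL_rep m k F.
        (\<forall>u\<in>unipotent n. fun_act m k (GL_embed m n u) (1\<^sub>m k) f = f) \<and>
        (\<forall>a\<in>torus n. fun_act m k (GL_embed m n a) (1\<^sub>m k) f = fun_scale (weight n D a) f)})"

section \<open>Standard tableaux and standard monomials\<close>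

text \<open>\<open>pick I c\<close> is the element of \<open>I\<close> with exactly \<open>c\<close> smaller elements in \<open>I\<close>.\<close>

definition tableau_le :: "nat set \<Rightarrow> nat set \<Rightarrow> bool" where
  "tableau_le I J \<longleftrightarrow> card J \<le> card I \<and> (\<forall>c<card J. pick I c \<le> pick J c)"

definition column_sets :: "nat \<Rightarrow> nat \<Rightarrow> nat set set" where
  "column_sets m n = {{..<r} \<union> A |r A. r \<le> n \<and> A \<subseteq> {n..<m} \<and> {..<r} \<union> A \<noteq> {}}"

text \<open>The empty chain is a standard tableau; its shape is the pair of empty diagrams.\<close>

definition standard_tableau :: "nat \<Rightarrow> nat \<Rightarrow> nat set list \<Rightarrow> bool" where
  "standard_tableau m n t \<longleftrightarrow> set t \<subseteq> column_sets m n \<and> sorted_wrt tableau_le t"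

definition outer_shape :: "nat set list \<Rightarrow> nat \<Rightarrow> nat" where
  "outer_shape t = conjugate_diagram (\<lambda>c. if c < length t then card (t ! c) else 0)"

definition inner_shape :: "nat \<Rightarrow> nat set list \<Rightarrow> nat \<Rightarrow> nat" where
  "inner_shape n t = (\<lambda>r. if r < n then card {c. c < length t \<and> r \<in> t ! c} else 0)"

definition standard_tableaux ::
  "nat \<Rightarrow> nat \<Rightarrow> (nat \<Rightarrow> nat) \<times> (nat \<Rightarrow> nat) \<Rightarrow> nat set list set" where
  "standard_tableaux m n = (\<lambda>(F, D).
     {t. standard_tableau m n t \<and> outer_shape t = F \<and> inner_shape n t = D})"

text \<open>Only meaningful for \<open>card I \<le> k\<close>, where the submatrix is square.\<close>

definition minor :: "nat set \<Rightarrow> complex mat \<Rightarrow> complex" where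
  "minor I Q = det (submatrix Q I {..<card I})"

definition standard_monomial ::
  "nat \<Rightarrow> nat \<Rightarrow> nat set list \<Rightarrow> complex mat \<Rightarrow> complex" where
  "standard_monomial m k t = on_mats m k (\<lambda>Q. \<Prod>I\<leftarrow>t. minor I Q)"

end

theory Submission
  imports Defs "HOL-Computational_Algebra.Polynomial"
begin

text \<open>
  The argument compares leading monomials.  Order the monomials in the entries of an
  \<open>m \<times> k\<close> matrix lexicographically, reading the exponents from the last row upwards and from
  right to left in each row.  The leading monomial of the minor \<open>\<delta>\<^sub>I\<close> is then the product of
  its diagonal entries, so the leading exponent of the standard monomial of a tableau \<open>t\<close>
  is the matrix whose entry \<open>(r, j)\<close> counts the occurrences of \<open>r\<close> in row \<open>j\<close> of \<open>t\<close>
  (\<open>has_leading_standard_monomial\<close>).  A standard tableau is recovered from these numbers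
  (\<open>tableau_exponent_inj\<close>), so standard monomials have distinct leading monomials and are
  linearly independent.

  They span because, conversely, the leading exponent \<open>A\<close> of every nonzero invariant weight vector
  comes from a standard tableau (\<open>leading_exponent_of_tableau\<close>): subtracting a multiple
  of its standard monomial lowers the leading exponent, and only finitely many exponents have a
  given weight.  Being the exponent of a tableau means two things
  (\<open>tableau_exponent_surj\<close>).

  First, \<open>A\<close> is semistandard: row \<open>j + 1\<close> has at most as many entries \<open>\<le> i\<close> as row
  \<open>j\<close> has entries \<open>< i\<close>.  This follows from invariance under adding multiples of column
  \<open>j\<close> to column \<open>j + 1\<close>.  The coefficient of the leading monomial in the rows from \<open>i\<close> on
  is again invariant; comparing it with the coefficient in which column \<open>j\<close> has absorbed the
  whole exponent of column \<open>j + 1\<close> in row \<open>i\<close> produces a nonzero polynomial whose degree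
  along the column operation is at most that exponent.  A nonzero polynomial of degree \<open>a\<close> in
  column \<open>j\<close> and \<open>b\<close> in column \<open>j + 1\<close> has degree at least \<open>b - a\<close> along it
  (\<open>shear_degree_bound\<close>), and this is the required inequality
  (\<open>leading_semistandard\<close>).

  Secondly, the entries belonging to \<open>GL\<^sub>n\<close> form the canonical tableau: \<open>A r j = 0\<close> for
  \<open>r < n\<close> and \<open>j \<noteq> r\<close>.  The coefficient of the leading monomial in the rows from \<open>n\<close> on is
  a polynomial on \<open>n \<times> k\<close> matrices invariant under both row and column operations.
  Applied to it and to its transpose, the first condition says that its row degrees are dominated by its column degrees and
  conversely; hence they agree, which forces all entries onto the diagonal
  (\<open>leading_diagonal\<close>).

  Since the torus normalises the unipotent groups, weight components of invariants are
  invariant (\<open>weight_part_invariant\<close>).  This gives the grading, and each weight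
  that occurs is the shape of a tableau, hence a pair in \<open>\<Lambda>\<^bsub>k,n\<^esub>\<close>.

  Invariance enters through elementary unipotent matrices and diagonal matrices.  Full invariance of a weight component follows afterwards, because it lies
  in the span of standard monomials.
\<close>

section \<open>Polynomials given by their coefficients\<close>

lemma poly_eq_0_off_zero:
  fixes P :: "complex poly"
  assumes "\<And>t. t \<noteq> 0 \<Longrightarrow> poly P t = 0"
  shows "P = 0"
proof -
  have "UNIV - {0} \<subseteq> {t. poly P t = 0}" using assms by auto
  moreover have "infinite (UNIV - {0::complex})"
    using infinite_UNIV_char_0[where 'a=complex] by simp
  ultimately have "infinite {t. poly P t = 0}" using finite_subset by blast
  then show ?thesis using poly_roots_finite by blast
qed

text \<open>
  A form of linear independence that tolerates repeated exponents: \<open>E\<close> may take the same value at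
  several indices, and the coefficients belonging to one exponent \<open>e\<close> must cancel.  Only points with
  nonzero coordinates are tested, so that it also applies to characters of a torus.
\<close>

lemma monomials_independent:
  fixes b :: "'x \<Rightarrow> complex" and E :: "'x \<Rightarrow> nat \<Rightarrow> nat"
  assumes "finite X"
    and "\<And>z. (\<forall>v<N. z v \<noteq> 0) \<Longrightarrow> (\<Sum>x\<in>X. b x * (\<Prod>v<N. z v ^ E x v)) = 0"
  shows "(\<Sum>x\<in>{x\<in>X. \<forall>v<N. E x v = e v}. b x) = 0"
  using assms
proof (induction N arbitrary: X)
  case 0
  then show ?case by simp
next
  case (Suc N)
  let ?X = "{x\<in>X. E x N = e N}"
  have fin: "finite ?X" using Suc.prems(1) by simp
  have "(\<Sum>x\<in>?X. b x * (\<Prod>v<N. z v ^ E x v)) = 0" if z: "\<forall>v<N. z v \<noteq> 0" for z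
  proof -
    define P where "P = (\<Sum>x\<in>X. monom (b x * (\<Prod>v<N. z v ^ E x v)) (E x N))"
    have *: "poly P t = 0" if "t \<noteq> 0" for t
    proof -
      have "(\<Sum>x\<in>X. b x * (\<Prod>v<Suc N. (z(N := t)) v ^ E x v)) = 0"
        by (rule Suc.prems(2)) (use z that in \<open>auto simp: less_Suc_eq\<close>)
      moreover have "(\<Prod>v<N. (z(N := t)) v ^ E x v) = (\<Prod>v<N. z v ^ E x v)" for x
        by (rule prod.cong) auto
      ultimately show ?thesis
        unfolding P_def poly_sum poly_monom by (simp add: mult.assoc)
    qed
    then have "P = 0" by (rule poly_eq_0_off_zero)
    then have "coeff P (e N) = 0" by simp
    then show ?thesis
      unfolding P_def coeff_sum coeff_monom sum.inter_filter[OF Suc.prems(1)] .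
  qed
  from Suc.IH[OF fin this] have "(\<Sum>x\<in>{x\<in>?X. \<forall>v<N. E x v = e v}. b x) = 0" .
  moreover have "{x\<in>?X. \<forall>v<N. E x v = e v} = {x\<in>X. \<forall>v<Suc N. E x v = e v}"
    by (auto simp: less_Suc_eq)
  ultimately show ?case by simp
qed

definition exponents :: "nat \<Rightarrow> nat \<Rightarrow> (nat \<Rightarrow> nat \<Rightarrow> nat) set" where
  "exponents m k = {A. \<forall>r j. \<not> (r < m \<and> j < k) \<longrightarrow> A r j = 0}"

definition monom_at :: "nat \<Rightarrow> nat \<Rightarrow> (nat \<Rightarrow> nat \<Rightarrow> nat) \<Rightarrow> (nat \<Rightarrow> nat \<Rightarrow> complex) \<Rightarrow> complex" where
  "monom_at m k A q = (\<Prod>r<m. \<Prod>j<k. q r j ^ A r j)"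

text \<open>
  Polynomials are handled through their coefficients, families \<open>c\<close> of finite support indexed by
  exponent matrices, and evaluated on arrays, where no dimensions have to be tracked.
\<close>

definition poly_coeffs :: "nat \<Rightarrow> nat \<Rightarrow> ((nat \<Rightarrow> nat \<Rightarrow> nat) \<Rightarrow> complex) set" where
  "poly_coeffs m k = {c. finite {A. c A \<noteq> 0} \<and> {A. c A \<noteq> 0} \<subseteq> exponents m k}"

definition poly_at ::
  "nat \<Rightarrow> nat \<Rightarrow> ((nat \<Rightarrow> nat \<Rightarrow> nat) \<Rightarrow> complex) \<Rightarrow> (nat \<Rightarrow> nat \<Rightarrow> complex) \<Rightarrow> complex" where
  "poly_at m k c q = (\<Sum>A | c A \<noteq> 0. c A * monom_at m k A q)"

text \<open>
  The coefficient, as a polynomial in the rows \<open>0, \<dots>, i - 1\<close>, of the monomial that \<open>A\<close> determines in the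
  rows \<open>i, i + 1, \<dots>\<close>.  It interpolates between the whole polynomial (\<open>i = m\<close>) and the
  single coefficient \<open>c A\<close> (\<open>i = 0\<close>), one row at a time.
\<close>

definition row_coeff ::
  "nat \<Rightarrow> ((nat \<Rightarrow> nat \<Rightarrow> nat) \<Rightarrow> complex) \<Rightarrow> nat \<Rightarrow> (nat \<Rightarrow> nat \<Rightarrow> nat) \<Rightarrow>
   (nat \<Rightarrow> nat \<Rightarrow> complex) \<Rightarrow> complex" where
  "row_coeff k c i A q =
     (\<Sum>A' | c A' \<noteq> 0 \<and> (\<forall>r\<ge>i. A' r = A r). c A' * monom_at i k A' q)"

text \<open>
  Exponents are compared at the last position where they differ, rows counting before columns.
  The later rows must take precedence: the argument for invariants peels them off first.
\<close>

definition lex_less :: "(nat \<Rightarrow> nat \<Rightarrow> nat) \<Rightarrow> (nat \<Rightarrow> nat \<Rightarrow> nat) \<Rightarrow> bool" where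
  "lex_less A B \<longleftrightarrow>
     (\<exists>r j. A r j < B r j \<and> (\<forall>j'>j. A r j' = B r j') \<and> (\<forall>r'>r. A r' = B r'))"

definition leading :: "((nat \<Rightarrow> nat \<Rightarrow> nat) \<Rightarrow> complex) \<Rightarrow> (nat \<Rightarrow> nat \<Rightarrow> nat) \<Rightarrow> bool" where
  "leading c A \<longleftrightarrow> c A \<noteq> 0 \<and> (\<forall>B. c B \<noteq> 0 \<longrightarrow> B = A \<or> lex_less B A)"

definition col_shear :: "nat \<Rightarrow> complex \<Rightarrow> (nat \<Rightarrow> nat \<Rightarrow> complex) \<Rightarrow> nat \<Rightarrow> nat \<Rightarrow> complex" where
  "col_shear j t q = (\<lambda>r c. if c = Suc j then q r c + t * q r j else q r c)"

definition row_shear :: "nat \<Rightarrow> complex \<Rightarrow> (nat \<Rightarrow> nat \<Rightarrow> complex) \<Rightarrow> nat \<Rightarrow> nat \<Rightarrow> complex" where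
  "row_shear i t q = (\<lambda>r c. if r = Suc i then q r c + t * q i c else q r c)"

lemma lex_less_irrefl: "\<not> lex_less A A"
  by (auto simp: lex_less_def)

lemma lex_less_trans:
  assumes "lex_less A B" "lex_less B C"
  shows "lex_less A C"
proof -
  obtain r j where 1: "A r j < B r j" "\<forall>j'>j. A r j' = B r j'" "\<forall>r'>r. A r' = B r'"
    using assms(1) by (auto simp: lex_less_def)
  obtain s i where 2: "B s i < C s i" "\<forall>j'>i. B s j' = C s j'" "\<forall>r'>s. B r' = C r'"
    using assms(2) by (auto simp: lex_less_def)
  consider "r < s" | "s < r" | "r = s" "j < i" | "r = s" "i \<le> j" by linarith
  then show ?thesis
  proof cases
    case 1 with \<open>\<forall>r'>r. A r' = B r'\<close> 2 show ?thesis
      unfolding lex_less_def by (intro exI[of _ s] exI[of _ i]) auto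
  next
    case 2 with \<open>\<forall>r'>s. B r' = C r'\<close> 1 show ?thesis
      unfolding lex_less_def by (intro exI[of _ r] exI[of _ j]) auto
  next
    case 3 with 1 2 show ?thesis
      unfolding lex_less_def by (intro exI[of _ r] exI[of _ i]) auto
  next
    case 4
    then have "A r j < C r j" using 1 2 by (cases "i = j") auto
    with 4 1 2 show ?thesis
      unfolding lex_less_def by (intro exI[of _ r] exI[of _ j]) auto
  qed
qed

lemma lex_less_total:
  assumes "A \<in> exponents m k" "B \<in> exponents m k" "A \<noteq> B"
  shows "lex_less A B \<or> lex_less B A"
proof -
  let ?R = "{r. A r \<noteq> B r}"
  have "A r = B r" if "r \<ge> m" for r
    using assms(1,2) that by (auto simp: exponents_def fun_eq_iff)
  then have "?R \<subseteq> {..<m}" by (auto simp: not_le[symmetric])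
  then have fR: "finite ?R" using finite_subset by blast
  have "?R \<noteq> {}" using assms(3) by (auto simp: fun_eq_iff)
  define r where "r = Max ?R"
  have r: "A r \<noteq> B r" using Max_in[OF fR \<open>?R \<noteq> {}\<close>] by (simp add: r_def)
  have r': "A r' = B r'" if "r' > r" for r'
    using Max_ge[OF fR, of r'] that by (auto simp: r_def)
  let ?J = "{j. A r j \<noteq> B r j}"
  have "A r j = B r j" if "j \<ge> k" for j
    using assms(1,2) that by (auto simp: exponents_def)
  then have "?J \<subseteq> {..<k}" by (auto simp: not_le[symmetric])
  then have fJ: "finite ?J" using finite_subset by blast
  have "?J \<noteq> {}" using r by (auto simp: fun_eq_iff)
  define j where "j = Max ?J"
  have j: "A r j \<noteq> B r j" using Max_in[OF fJ \<open>?J \<noteq> {}\<close>] by (simp add: j_def)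
  have j': "A r j' = B r j'" if "j' > j" for j'
    using Max_ge[OF fJ, of j'] that by (auto simp: j_def)
  from j consider "A r j < B r j" | "B r j < A r j" by linarith
  then show ?thesis
    using r' j' unfolding lex_less_def by cases metis+
qed

lemma lex_less_add_right: "lex_less A B \<Longrightarrow> lex_less (A + C) (B + C)"
  by (auto simp: lex_less_def plus_fun_def fun_eq_iff)

lemma lex_less_add_left: "lex_less A B \<Longrightarrow> lex_less (C + A) (C + B)"
  by (auto simp: lex_less_def plus_fun_def fun_eq_iff)

lemma exists_lex_max:
  assumes "finite S" "S \<noteq> {}" "S \<subseteq> exponents m k"
  shows "\<exists>A\<in>S. \<forall>B\<in>S. B = A \<or> lex_less B A"
  using assms
proof (induction rule: finite_ne_induct)
  case (singleton x) then show ?case by simp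
next
  case (insert x S)
  then obtain A where A: "A \<in> S" "\<forall>B\<in>S. B = A \<or> lex_less B A" by auto
  have "x \<noteq> A" using A insert by auto
  then consider "lex_less x A" | "lex_less A x"
    using lex_less_total[of x m k A] A insert.prems by auto
  then show ?case
  proof cases
    case 1 then show ?thesis using A by auto
  next
    case 2
    have "B = x \<or> lex_less B x" if "B \<in> insert x S" for B
      using that A 2 lex_less_trans[of B A x] by auto
    then show ?thesis by auto
  qed
qed

lemma leading_exists:
  assumes "c \<in> poly_coeffs m k" "c A \<noteq> 0"
  obtains A where "leading c A"
  using exists_lex_max[of "{A. c A \<noteq> 0}" m k] assms
  by (auto simp: poly_coeffs_def leading_def)

lemma row_coeff_cong:
  assumes "\<And>r. r < i \<Longrightarrow> q r = q' r"
  shows "row_coeff k c i A q = row_coeff k c i A q'"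
  unfolding row_coeff_def monom_at_def using assms by (intro sum.cong) auto

lemma row_coeff_Suc:
  assumes "c \<in> poly_coeffs m k"
  shows "row_coeff k c (Suc i) A q =
    (\<Sum>e\<in>(\<lambda>A'. A' i) ` {A'. c A' \<noteq> 0}.
        row_coeff k c i (A(i := e)) q * (\<Prod>j<k. q i j ^ e j))"
proof -
  let ?T = "{A'. c A' \<noteq> 0 \<and> (\<forall>r\<ge>Suc i. A' r = A r)}"
  let ?E = "(\<lambda>A'. A' i) ` {A'. c A' \<noteq> 0}"
  have fin: "finite {A'. c A' \<noteq> 0}" using assms by (simp add: poly_coeffs_def)
  then have fT: "finite ?T" by (rule rev_finite_subset) auto
  have all_ge: "(\<forall>r\<ge>i. P r) \<longleftrightarrow> P i \<and> (\<forall>r\<ge>Suc i. P r)" for P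
    by (metis le_eq_less_or_eq less_eq_Suc_le)
  have eq: "{x \<in> ?T. x i = e} = {A'. c A' \<noteq> 0 \<and> (\<forall>r\<ge>i. A' r = (A(i := e)) r)}" for e
    unfolding all_ge[of "\<lambda>r. _ r = (A(i := e)) r"] by (auto simp: Suc_le_eq)
  have "row_coeff k c (Suc i) A q =
      (\<Sum>e\<in>?E. \<Sum>A'\<in>{x \<in> ?T. x i = e}. c A' * monom_at (Suc i) k A' q)"
    unfolding row_coeff_def by (rule sum.group[symmetric]) (use fT fin in auto)
  also have "\<dots> = (\<Sum>e\<in>?E. row_coeff k c i (A(i := e)) q * (\<Prod>j<k. q i j ^ e j))"
    unfolding row_coeff_def sum_distrib_right eq
    by (intro sum.cong) (auto simp: monom_at_def)
  finally show ?thesis .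
qed

lemma row_coeff_absent:
  assumes "e \<notin> (\<lambda>A'. A' i) ` {A'. c A' \<noteq> 0}"
  shows "row_coeff k c i (A(i := e)) q = 0"
proof -
  have "{A'. c A' \<noteq> 0 \<and> (\<forall>r\<ge>i. A' r = (A(i := e)) r)} = {}"
    using assms by auto
  then show ?thesis unfolding row_coeff_def by (metis sum.empty)
qed

lemma row_exponent_eqI:
  assumes "c \<in> poly_coeffs m k" "e \<in> (\<lambda>A'. A' i) ` {A'. c A' \<noteq> 0}"
    and "\<forall>v<k. e v = e' v" "\<forall>v\<ge>k. e' v = 0"
  shows "e = e'"
proof
  fix v
  show "e v = e' v"
    using assms by (cases "v < k") (auto simp: poly_coeffs_def exponents_def subset_iff not_less)
qed

text \<open>
  An identity between two polynomials in rows \<open>0, \<dots>, i\<close> may be read off coefficientwise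
  in row \<open>i\<close> if the operation \<open>T\<close> leaves that row alone.
\<close>

lemma row_coeff_compare:
  assumes c: "c \<in> poly_coeffs m k"
    and eq: "\<And>z. row_coeff k c (Suc i) A (T (q(i := z))) = row_coeff k c (Suc i) A (q(i := z))"
    and T: "\<And>z. T (q(i := z)) i = z"
      "\<And>z r. r < i \<Longrightarrow> T (q(i := z)) r = T q r"
    and e: "\<forall>v\<ge>k. e v = 0"
  shows "row_coeff k c i (A(i := e)) (T q) = row_coeff k c i (A(i := e)) q"
proof -
  let ?E = "(\<lambda>A'. A' i) ` {A'. c A' \<noteq> 0}"
  have fin: "finite ?E" using c by (simp add: poly_coeffs_def)
  have "(\<Sum>e\<in>?E. (row_coeff k c i (A(i := e)) (T q) - row_coeff k c i (A(i := e)) q)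
          * (\<Prod>v<k. z v ^ e v)) = 0" for z
  proof -
    have "row_coeff k c i (A(i := e)) (T (q(i := z))) = row_coeff k c i (A(i := e)) (T q)" for e
      by (rule row_coeff_cong) (use T in auto)
    moreover have "row_coeff k c i (A(i := e)) (q(i := z)) = row_coeff k c i (A(i := e)) q" for e
      by (rule row_coeff_cong) auto
    ultimately show ?thesis
      using eq[of z] unfolding row_coeff_Suc[OF c] T(1)
      by (simp add: left_diff_distrib sum_subtractf)
  qed
  then have "(\<Sum>e\<in>{x\<in>?E. \<forall>v<k. x v = e v}.
      row_coeff k c i (A(i := e)) (T q) - row_coeff k c i (A(i := e)) q) = 0"
    by (intro monomials_independent[OF fin])
  moreover have "{x\<in>?E. \<forall>v<k. x v = e v} = (if e \<in> ?E then {e} else {})"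
  proof -
    have "x = e" if "x \<in> ?E" "\<forall>v<k. x v = e v" for x
      using row_exponent_eqI[OF c that e] .
    then show ?thesis by (cases "e \<in> ?E") (force+)
  qed
  ultimately have sum: "(\<Sum>e\<in>(if e \<in> ?E then {e} else {}).
      row_coeff k c i (A(i := e)) (T q) - row_coeff k c i (A(i := e)) q) = 0"
    by (simp only:)
  show ?thesis
  proof (cases "e \<in> ?E")
    case True
    with sum show ?thesis by (simp only: if_True) simp
  next
    case False
    show ?thesis by (simp only: row_coeff_absent[OF False])
  qed
qed

lemma row_coeff_nonzero:
  assumes c: "c \<in> poly_coeffs m k" and A: "c A \<noteq> 0"
  shows "\<exists>q. row_coeff k c i A q \<noteq> 0"
proof (induction i)
  case 0
  have "{A'. c A' \<noteq> 0 \<and> (\<forall>r\<ge>0. A' r = A r)} = {A}" using A by auto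
  then show ?case using A by (auto simp: row_coeff_def monom_at_def)
next
  case (Suc i)
  show ?case
  proof (rule ccontr)
    assume "\<not> ?thesis"
    then have 0: "row_coeff k c (Suc i) A q = 0" for q by auto
    let ?E = "(\<lambda>A'. A' i) ` {A'. c A' \<noteq> 0}"
    have fin: "finite ?E" using c by (simp add: poly_coeffs_def)
    have "row_coeff k c i A q = 0" for q
    proof -
      have "(\<Sum>e\<in>?E. row_coeff k c i (A(i := e)) q * (\<Prod>v<k. z v ^ e v)) = 0" for z
      proof -
        have "row_coeff k c i (A(i := e)) (q(i := z)) = row_coeff k c i (A(i := e)) q" for e
          by (rule row_coeff_cong) auto
        then show ?thesis
          using 0[of "q(i := z)"] unfolding row_coeff_Suc[OF c] by simp
      qed
      then have "(\<Sum>e\<in>{x\<in>?E. \<forall>v<k. x v = A i v}. row_coeff k c i (A(i := e)) q) = 0"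
        by (intro monomials_independent[OF fin])
      moreover have "{x\<in>?E. \<forall>v<k. x v = A i v} = {A i}"
        using row_exponent_eqI[OF c, of _ i "A i"] c A
        by (auto simp: poly_coeffs_def exponents_def subset_iff)
      ultimately show ?thesis by simp
    qed
    with Suc show False by auto
  qed
qed

lemma row_coeff_all:
  assumes "c \<in> poly_coeffs m k" "A \<in> exponents m k"
  shows "row_coeff k c m A q = poly_at m k c q"
proof -
  have "A' r = A r" if "c A' \<noteq> 0" "r \<ge> m" for A' r
  proof -
    have "A' \<in> exponents m k" using assms(1) that(1) by (auto simp: poly_coeffs_def)
    then show ?thesis using assms(2) that(2) by (auto simp: exponents_def)
  qed
  then have "{A'. c A' \<noteq> 0 \<and> (\<forall>r\<ge>m. A' r = A r)} = {A'. c A' \<noteq> 0}"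
    by blast
  then show ?thesis unfolding row_coeff_def poly_at_def by (simp only:)
qed

lemma poly_at_nonzero:
  assumes "c \<in> poly_coeffs m k" "c A \<noteq> 0"
  shows "\<exists>q. poly_at m k c q \<noteq> 0"
proof -
  have A: "A \<in> exponents m k" using assms unfolding poly_coeffs_def by blast
  from row_coeff_nonzero[of c m k A m, OF assms]
  obtain q where "row_coeff k c m A q \<noteq> 0" ..
  then have "poly_at m k c q \<noteq> 0" unfolding row_coeff_all[OF assms(1) A] .
  then show ?thesis by blast
qed

lemma row_coeff_above_leading:
  assumes "leading c A" "A i j < e j" "\<forall>j'>j. e j' = A i j'"
  shows "row_coeff k c i (A(i := e)) q = 0"
proof -
  have "lex_less A A'" if "\<forall>r\<ge>i. A' r = (A(i := e)) r" for A'
    unfolding lex_less_def using assms(2,3) that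
    by (intro exI[of _ i] exI[of _ j]) auto
  then have "{A'. c A' \<noteq> 0 \<and> (\<forall>r\<ge>i. A' r = (A(i := e)) r)} = {}"
    using assms(1) lex_less_trans lex_less_irrefl unfolding leading_def by blast
  then show ?thesis unfolding row_coeff_def by (metis sum.empty)
qed

section \<open>Leading exponents of polynomials invariant under column operations\<close>

text \<open>
  A nonzero \<open>H\<close> of degree at most \<open>a\<close> in \<open>X\<close>, homogeneous of degree \<open>b\<close> in \<open>Y\<close>, has degree at least
  \<open>b - a\<close> along the shear.  The trick is to evaluate at \<open>(Y + s Z, Y)\<close>.  As a polynomial in \<open>s\<close> this
  has degree at most \<open>a\<close>.  On the other hand \<open>Y = s (- Z + s\<^sup>-\<^sup>1 (Y + s Z))\<close>, so expanding along the shear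
  shows that it is divisible by \<open>s ^ (b - D)\<close>.  For \<open>a + D < b\<close> it must vanish.
\<close>

lemma shear_degree_bound:
  fixes H :: "(nat \<Rightarrow> complex) \<Rightarrow> (nat \<Rightarrow> complex) \<Rightarrow> complex"
  assumes degX: "\<And>W Z Y. \<exists>P. degree P \<le> a \<and> (\<forall>s. H (\<lambda>r. W r + s * Z r) Y = poly P s)"
    and homY: "\<And>s X Y. H X (\<lambda>r. s * Y r) = s ^ b * H X Y"
    and expand: "\<And>t X Y. H X (\<lambda>r. Y r + t * X r) = (\<Sum>d\<le>D. t ^ d * G d X Y)"
    and polG: "\<And>d W Z Y. \<exists>P. \<forall>s. G d (\<lambda>r. W r + s * Z r) Y = poly P s"
    and small: "a + D < b"
  shows "H X Y = 0"
proof -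
  define Z where "Z = (\<lambda>r. X r - Y r)"
  define Z' where "Z' = (\<lambda>r. - Z r)"
  obtain P where P: "degree P \<le> a" "\<And>s. H (\<lambda>r. Y r + s * Z r) Y = poly P s"
    using degX[of Y Z Y] by blast
  have "\<forall>d. \<exists>P. \<forall>s. G d (\<lambda>r. Y r + s * Z r) Z' = poly P s"
    using polG by blast
  then obtain R where R: "\<And>d s. G d (\<lambda>r. Y r + s * Z r) Z' = poly (R d) s"
    by metis
  define S where "S = (\<Sum>d\<le>D. monom 1 (b - d) * R d)"
  have "poly P s = poly S s" if "s \<noteq> 0" for s
  proof -
    let ?X = "\<lambda>r. Y r + s * Z r"
    have "poly P s = H ?X (\<lambda>r. s * (Z' r + inverse s * ?X r))"
      unfolding P(2)[symmetric] using that by (simp add: Z'_def field_simps)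
    also have "\<dots> = s ^ b * (\<Sum>d\<le>D. inverse s ^ d * poly (R d) s)"
      unfolding homY expand R by simp
    also have "\<dots> = (\<Sum>d\<le>D. s ^ (b - d) * poly (R d) s)"
      unfolding sum_distrib_left
    proof (intro sum.cong refl)
      fix d assume "d \<in> {..D}"
      then have "d \<le> b" using small by auto
      then have "s ^ b = s ^ (b - d) * s ^ d" by (simp flip: power_add)
      then show "s ^ b * (inverse s ^ d * poly (R d) s) = s ^ (b - d) * poly (R d) s"
        using that by (simp add: field_simps)
    qed
    finally show ?thesis by (simp add: S_def poly_sum poly_monom)
  qed
  then have "P - S = 0" by (intro poly_eq_0_off_zero) simp
  then have PS: "P = S" by simp
  have "monom 1 (b - D) dvd S"
    unfolding S_def
  proof (intro dvd_sum dvd_mult2)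
    fix d assume "d \<in> {..D}"
    then have "monom (1::complex) (b - d) = monom 1 (b - D) * monom 1 (D - d)"
      using small by (simp add: mult_monom)
    then show "monom (1::complex) (b - D) dvd monom 1 (b - d)" by simp
  qed
  moreover have "degree S < degree (monom (1::complex) (b - D))"
    using P(1) PS small by (simp add: degree_monom_eq)
  ultimately have "S = 0" by (meson dvd_imp_degree_le not_le)
  then have "H (\<lambda>r. Y r + 1 * Z r) Y = 0" using P(2)[of 1] PS by simp
  then show ?thesis by (simp add: Z_def)
qed

lemma prod_split_adjacent:
  fixes f :: "nat \<Rightarrow> complex"
  assumes "Suc j < k"
  shows "(\<Prod>v<k. f v) = f j * f (Suc j) * (\<Prod>v\<in>{..<k}-{j, Suc j}. f v)"
proof -
  have "{..<k} = insert j (insert (Suc j) ({..<k}-{j, Suc j}))" using assms by auto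
  then have "prod f {..<k} = prod f (insert j (insert (Suc j) ({..<k}-{j, Suc j})))" by simp
  then show ?thesis by (simp add: mult.assoc)
qed

text \<open>
  The exponents \<open>e s\<close> of row \<open>i\<close> share the total degree of the leading one in the columns \<open>j\<close> and
  \<open>j + 1\<close>.  Setting the entry \<open>(i, j + 1)\<close> to zero turns the column operation into the substitution of \<open>t\<close> times
  the entry \<open>(i, j)\<close>, which merges the two exponents; comparing
  coefficients gives the expansion of the coefficient of \<open>e 0\<close>.  It stops at the
  leading exponent, since nothing beyond it occurs.
\<close>

lemma col_shear_expansion:
  assumes c: "c \<in> poly_coeffs m k" and lead: "leading c A" and j: "Suc j < k"
    and inv: "\<And>t q. row_coeff k c (Suc i) A (col_shear j t q) = row_coeff k c (Suc i) A q"
  defines "e \<equiv> \<lambda>s. (A i)(j := A i j + A i (Suc j) - s, Suc j := s)"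
  shows "row_coeff k c i (A(i := e 0)) (col_shear j t q) =
     (\<Sum>s\<le>A i (Suc j). t ^ s * ((- 1) ^ s * row_coeff k c i (A(i := e s)) q))"
proof -
  let ?E = "(\<lambda>A'. A' i) ` {A'. c A' \<noteq> 0}"
  let ?\<phi> = "\<lambda>e q. row_coeff k c i (A(i := e)) q"
  let ?B = "A i (Suc j)" and ?p = "A i j + A i (Suc j)"
  have fin: "finite ?E" using c by (simp add: poly_coeffs_def)
  have Ak: "A i v = 0" if "v \<ge> k" for v
  proof -
    have "A \<in> exponents m k" using c lead unfolding poly_coeffs_def leading_def by blast
    then show ?thesis using that by (simp add: exponents_def)
  qed
  have main: "(\<Sum>s\<le>?B. t ^ s * ?\<phi> (e s) (col_shear j t q)) = ?\<phi> (e 0) q" for t q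
  proof -
    \<comment> \<open>The exponent of row \<open>i\<close> after entry \<open>(i, j + 1)\<close> is replaced by \<open>t\<close> times entry \<open>(i, j)\<close>.\<close>
    define E' where "E' = (\<lambda>x. x(j := x j + x (Suc j), Suc j := 0) :: nat \<Rightarrow> nat)"
    define b where "b = (\<lambda>x. t ^ x (Suc j) * ?\<phi> x (col_shear j t q)
                           - (if x (Suc j) = 0 then ?\<phi> x q else 0))"
    note split = prod_split_adjacent[OF j]
    have "(\<Sum>x\<in>?E. b x * (\<Prod>v<k. z v ^ E' x v)) = 0" for z
    proof -
      define q1 where "q1 = q(i := z(Suc j := 0))"
      have E': "(\<Prod>v<k. z v ^ E' x v) =
          z j ^ (x j + x (Suc j)) * (\<Prod>v\<in>{..<k}-{j, Suc j}. z v ^ x v)" for x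
        unfolding split by (simp add: E'_def)
      have "?\<phi> x (col_shear j t q1) = ?\<phi> x (col_shear j t q)" for x
        by (rule row_coeff_cong) (auto simp: q1_def col_shear_def)
      moreover have "(\<Prod>v<k. col_shear j t q1 i v ^ x v) =
          t ^ x (Suc j) * (\<Prod>v<k. z v ^ E' x v)" for x
        unfolding E' unfolding split
        by (auto simp: q1_def col_shear_def power_mult_distrib power_add intro!: prod.cong)
      moreover have "?\<phi> x q1 = ?\<phi> x q" for x
        by (rule row_coeff_cong) (auto simp: q1_def)
      moreover have "(\<Prod>v<k. q1 i v ^ x v) =
          (if x (Suc j) = 0 then (\<Prod>v<k. z v ^ E' x v) else 0)" for x
        unfolding E' unfolding split
        by (auto simp: q1_def power_0_left intro!: prod.cong)
      ultimately have "(\<Sum>x\<in>?E. ?\<phi> x (col_shear j t q) * (t ^ x (Suc j) * (\<Prod>v<k. z v ^ E' x v)))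
         = (\<Sum>x\<in>?E. ?\<phi> x q * (if x (Suc j) = 0 then (\<Prod>v<k. z v ^ E' x v) else 0))"
        using inv[of t q1] unfolding row_coeff_Suc[OF c] by simp
      then show ?thesis
        unfolding b_def left_diff_distrib sum_subtractf
        by (simp add: mult_ac if_distrib[of "\<lambda>x. _ * x"] cong: if_cong)
    qed
    then have "(\<Sum>x\<in>{x\<in>?E. \<forall>v<k. E' x v = e 0 v}. b x) = 0"
      by (intro monomials_independent[OF fin])
    moreover have "(\<Sum>x\<in>{x\<in>?E. \<forall>v<k. E' x v = e 0 v}. b x) = (\<Sum>x\<in>e ` {..?p}. b x)"
    proof (rule sum.mono_neutral_left)
      show "{x\<in>?E. \<forall>v<k. E' x v = e 0 v} \<subseteq> e ` {..?p}"
      proof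
        fix x assume x: "x \<in> {x\<in>?E. \<forall>v<k. E' x v = e 0 v}"
        have xk: "x v = 0" if "v \<ge> k" for v
        proof -
          obtain A' where "c A' \<noteq> 0" "x = A' i" using x by auto
          moreover then have "A' \<in> exponents m k" using c unfolding poly_coeffs_def by blast
          ultimately show ?thesis using that by (simp add: exponents_def)
        qed
        have Ev: "E' x v = e 0 v" if "v < k" for v using x that by simp
        have p: "x j + x (Suc j) = ?p" using Ev[of j] j by (simp add: E'_def e_def)
        have "x v = e (x (Suc j)) v" for v
        proof (cases "v < k")
          case True
          then show ?thesis using Ev[of v] p by (auto simp: E'_def e_def split: if_splits)
        next
          case False
          then show ?thesis using xk[of v] Ak[of v] j by (auto simp: e_def)
        qed
        then have "x = e (x (Suc j))" by (rule ext)
        moreover have "x (Suc j) \<in> {..?p}" using p by simp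
        ultimately show "x \<in> e ` {..?p}" by (rule image_eqI)
      qed
      show "\<forall>x\<in>e ` {..?p} - {x\<in>?E. \<forall>v<k. E' x v = e 0 v}. b x = 0"
      proof
        fix x assume x: "x \<in> e ` {..?p} - {x\<in>?E. \<forall>v<k. E' x v = e 0 v}"
        then obtain s where s: "s \<le> ?p" "x = e s" by auto
        then have "\<forall>v<k. E' x v = e 0 v" by (auto simp: E'_def e_def)
        then have "x \<notin> ?E" using x by blast
        then have "?\<phi> x q = 0" for q by (rule row_coeff_absent)
        then show "b x = 0" by (simp add: b_def)
      qed
    qed simp
    moreover have inj: "inj_on e {..?p}"
      by (rule inj_onI) (metis e_def fun_upd_same)
    ultimately have "(\<Sum>s\<le>?p. b (e s)) = 0" by (simp add: sum.reindex)
    moreover have "b (e s) = t ^ s * ?\<phi> (e s) (col_shear j t q) - (if s = 0 then ?\<phi> (e s) q else 0)" for s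
      by (simp add: b_def e_def)
    ultimately have "(\<Sum>s\<le>?p. t ^ s * ?\<phi> (e s) (col_shear j t q)) = ?\<phi> (e 0) q"
      by (simp add: sum_subtractf sum.delta)
    moreover have "(\<Sum>s\<le>?B. t ^ s * ?\<phi> (e s) (col_shear j t q)) =
        (\<Sum>s\<le>?p. t ^ s * ?\<phi> (e s) (col_shear j t q))"
    proof (rule sum.mono_neutral_left)
      show "\<forall>s\<in>{..?p} - {..?B}. t ^ s * ?\<phi> (e s) (col_shear j t q) = 0"
      proof
        fix s assume "s \<in> {..?p} - {..?B}"
        then have "?B < s" by auto
        then have "?\<phi> (e s) (col_shear j t q) = 0"
          by (intro row_coeff_above_leading[OF lead, of i "Suc j"]) (auto simp: e_def)
        then show "t ^ s * ?\<phi> (e s) (col_shear j t q) = 0" by simp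
      qed
    qed auto
    ultimately show ?thesis by simp
  qed
  have "col_shear j (- t) (col_shear j t q) = q"
    by (auto simp: col_shear_def fun_eq_iff)
  then show ?thesis
    using main[of "- t" "col_shear j t q"]
    by (simp add: power_minus[of t] mult_ac)
qed

text \<open>
  The leading coefficient in row \<open>i\<close> is, up to sign, the top coefficient in \<open>t\<close> of the
  expansion above.  Shearing by \<open>u\<close> replaces \<open>t\<close> by \<open>u + t\<close>, and such a translation does not change the
  top coefficient.
\<close>

lemma row_coeff_col_invariant:
  assumes c: "c \<in> poly_coeffs m k" and lead: "leading c A" and j: "Suc j < k"
    and inv: "\<And>t q. row_coeff k c (Suc i) A (col_shear j t q) = row_coeff k c (Suc i) A q"
  shows "row_coeff k c i A (col_shear j u q) = row_coeff k c i A q"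
proof -
  let ?e = "\<lambda>s. (A i)(j := A i j + A i (Suc j) - s, Suc j := s)"
  let ?B = "A i (Suc j)"
  let ?g = "\<lambda>s q. (- 1) ^ s * row_coeff k c i (A(i := ?e s)) q"
  note exp = col_shear_expansion[OF c lead j inv]
  define P where "P = (\<Sum>s\<le>?B. monom (?g s (col_shear j u q)) s)"
  define R where "R = (\<Sum>s\<le>?B. monom (?g s q) s)"
  have P: "poly P t = (\<Sum>s\<le>?B. t ^ s * ?g s (col_shear j u q))" for t
    by (simp add: P_def poly_sum poly_monom mult_ac)
  have R: "poly R t = (\<Sum>s\<le>?B. t ^ s * ?g s q)" for t
    by (simp add: R_def poly_sum poly_monom mult_ac)
  have "poly P t = poly (pcompose R [:u, 1:]) t" for t
  proof -
    have "col_shear j t (col_shear j u q) = col_shear j (u + t) q"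
      by (auto simp: col_shear_def fun_eq_iff algebra_simps)
    then show ?thesis
      unfolding P poly_pcompose R exp[symmetric] by (simp add: R exp[symmetric])
  qed
  then have PR: "P = pcompose R [:u, 1:]" by (simp add: poly_eq_poly_eq_iff[symmetric] fun_eq_iff)
  have cP: "coeff P ?B = ?g ?B (col_shear j u q)"
    by (simp add: P_def coeff_sum sum.delta)
  have cR: "coeff R ?B = ?g ?B q"
    by (simp add: R_def coeff_sum sum.delta)
  have dR: "degree R \<le> ?B"
    unfolding R_def by (intro degree_sum_le) (auto intro: order_trans[OF degree_monom_le])
  have dP: "degree P = degree R" unfolding PR degree_pcompose by simp
  have "coeff P ?B = coeff R ?B"
  proof (cases "degree R = ?B")
    case True
    then show ?thesis using dP PR lead_coeff_comp[of "[:u, 1:]" R] by simp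
  next
    case False
    then show ?thesis using dR dP by (simp add: coeff_eq_0)
  qed
  moreover have "A(i := ?e ?B) = A" by (auto simp: fun_eq_iff)
  ultimately show ?thesis unfolding cP cR by simp
qed

definition set_cols ::
  "nat \<Rightarrow> (nat \<Rightarrow> complex) \<Rightarrow> (nat \<Rightarrow> complex) \<Rightarrow> (nat \<Rightarrow> nat \<Rightarrow> complex) \<Rightarrow> nat \<Rightarrow> nat \<Rightarrow> complex" where
  "set_cols j X Y q = (\<lambda>r v. if v = j then X r else if v = Suc j then Y r else q r v)"

lemma monom_at_set_cols:
  assumes "Suc j < k"
  shows "monom_at i k A (set_cols j X Y q) =
    (\<Prod>r<i. X r ^ A r j) * (\<Prod>r<i. Y r ^ A r (Suc j)) *
    (\<Prod>r<i. \<Prod>v\<in>{..<k}-{j, Suc j}. q r v ^ A r v)"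
proof -
  note split = prod_split_adjacent[OF assms]
  have "(\<Prod>v\<in>{..<k}-{j, Suc j}. set_cols j X Y q r v ^ A r v) =
      (\<Prod>v\<in>{..<k}-{j, Suc j}. q r v ^ A r v)" for r
    by (rule prod.cong) (auto simp: set_cols_def)
  then show ?thesis
    unfolding monom_at_def split by (simp add: prod.distrib set_cols_def)
qed

lemma row_coeff_poly_in_column:
  assumes c: "c \<in> poly_coeffs m k" and j: "Suc j < k"
  shows "\<exists>P. (\<forall>s. row_coeff k c i A (set_cols j (\<lambda>r. W r + s * Z r) Y q) = poly P s) \<and>
    (\<forall>a. (\<forall>A'. c A' \<noteq> 0 \<and> (\<forall>r\<ge>i. A' r = A r) \<longrightarrow> (\<Sum>r<i. A' r j) \<le> a) \<longrightarrow> degree P \<le> a)"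
proof -
  let ?S = "{A'. c A' \<noteq> 0 \<and> (\<forall>r\<ge>i. A' r = A r)}"
  define P where "P = (\<Sum>A'\<in>?S. smult (c A' * (\<Prod>r<i. Y r ^ A' r (Suc j)) *
      (\<Prod>r<i. \<Prod>v\<in>{..<k}-{j, Suc j}. q r v ^ A' r v)) (\<Prod>r<i. [:W r, Z r:] ^ A' r j))"
  have fin: "finite ?S"
    using c by (auto simp: poly_coeffs_def intro: rev_finite_subset)
  have "row_coeff k c i A (set_cols j (\<lambda>r. W r + s * Z r) Y q) = poly P s" for s
    unfolding row_coeff_def P_def poly_sum
    by (intro sum.cong refl) (simp add: monom_at_set_cols[OF j] poly_prod poly_power mult_ac)
  moreover have "degree P \<le> a"
    if a: "\<forall>A'. c A' \<noteq> 0 \<and> (\<forall>r\<ge>i. A' r = A r) \<longrightarrow> (\<Sum>r<i. A' r j) \<le> a" for a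
    unfolding P_def
  proof (rule degree_sum_le[OF fin])
    fix A' assume A': "A' \<in> ?S"
    let ?f = "\<lambda>r. [:W r, Z r:] ^ A' r j"
    have "degree (?f r) \<le> A' r j" for r
      using degree_power_le[of "[:W r, Z r:]" "A' r j"] by (auto intro: order_trans)
    then have "(\<Sum>r<i. degree (?f r)) \<le> (\<Sum>r<i. A' r j)" by (rule sum_mono)
    moreover have "degree (\<Prod>r<i. ?f r) \<le> (\<Sum>r<i. degree (?f r))"
      using degree_prod_sum_le[of "{..<i}" ?f] by simp
    ultimately have "degree (\<Prod>r<i. ?f r) \<le> (\<Sum>r<i. A' r j)" by linarith
    also have "\<dots> \<le> a" using a A' by blast
    finally show "degree (smult (c A' * (\<Prod>r<i. Y r ^ A' r (Suc j)) *
      (\<Prod>r<i. \<Prod>v\<in>{..<k}-{j, Suc j}. q r v ^ A' r v)) (\<Prod>r<i. ?f r)) \<le> a"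
      by (rule order_trans[OF degree_smult_le])
  qed
  ultimately show ?thesis by blast
qed

lemma row_coeff_homogeneous_in_column:
  assumes j: "Suc j < k"
    and b: "\<And>A'. c A' \<noteq> 0 \<Longrightarrow> \<forall>r\<ge>i. A' r = A r \<Longrightarrow> (\<Sum>r<i. A' r (Suc j)) = b"
  shows "row_coeff k c i A (set_cols j X (\<lambda>r. s * Y r) q) = s ^ b * row_coeff k c i A (set_cols j X Y q)"
  unfolding row_coeff_def sum_distrib_left
proof (intro sum.cong refl)
  fix A' assume A': "A' \<in> {A'. c A' \<noteq> 0 \<and> (\<forall>r\<ge>i. A' r = A r)}"
  have "(\<Prod>r<i. (s * Y r) ^ A' r (Suc j)) = s ^ (\<Sum>r<i. A' r (Suc j)) * (\<Prod>r<i. Y r ^ A' r (Suc j))"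
    by (simp add: power_mult_distrib prod.distrib power_sum)
  then show "c A' * monom_at i k A' (set_cols j X (\<lambda>r. s * Y r) q) =
      s ^ b * (c A' * monom_at i k A' (set_cols j X Y q))"
    unfolding monom_at_set_cols[OF j] using b A' by (simp add: mult_ac)
qed

lemma row_coeff_invariant_below:
  assumes c: "c \<in> poly_coeffs m k" and lead: "leading c A" and j: "Suc j < k" and "i \<le> m"
    and inv: "\<And>t q. poly_at m k c (col_shear j t q) = poly_at m k c q"
  shows "row_coeff k c i A (col_shear j t q) = row_coeff k c i A q"
proof -
  have A: "A \<in> exponents m k" using c lead unfolding poly_coeffs_def leading_def by blast
  show ?thesis using \<open>i \<le> m\<close>
  proof (induction i arbitrary: t q rule: inc_induct)
    case base
    then show ?case unfolding row_coeff_all[OF c A] by (rule inv)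
  next
    case (step i)
    show ?case by (rule row_coeff_col_invariant[OF c lead j step.IH])
  qed
qed

text \<open>
  If the inequality failed, the coefficient of \<open>e 0\<close> in row \<open>i\<close> would have degrees too far apart in the
  columns \<open>j\<close> and \<open>j + 1\<close> for the length of its expansion along the column operation.  It would vanish, and with it
  all terms of the expansion, the leading coefficient among them.  Equal column
  degrees of all monomials are what fixes the degrees of that coefficient.
\<close>

lemma leading_semistandard:
  assumes c: "c \<in> poly_coeffs m k" and lead: "leading c A" and j: "Suc j < k" and i: "i < m"
    and cols: "\<And>A' v. c A' \<noteq> 0 \<Longrightarrow> v < k \<Longrightarrow> (\<Sum>r<m. A' r v) = F v"
    and inv: "\<And>t q. poly_at m k c (col_shear j t q) = poly_at m k c q"
  shows "(\<Sum>r\<le>i. A r (Suc j)) \<le> (\<Sum>r<i. A r j)"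
proof (rule ccontr)
  assume neg: "\<not> ?thesis"
  define e where "e = (\<lambda>s. (A i)(j := A i j + A i (Suc j) - s, Suc j := s))"
  define B where "B = A i (Suc j)"
  \<comment> \<open>Degrees of the coefficient of \<open>e 0\<close> in columns \<open>j\<close> and \<open>j + 1\<close>: moving \<open>B\<close> units of row \<open>i\<close>
    to column \<open>j\<close> is compensated in the earlier rows.\<close>
  define a where "a = (\<Sum>r<i. A r j) - B"
  define b where "b = (\<Sum>r<i. A r (Suc j)) + B"
  let ?H = "\<lambda>d q. row_coeff k c i (A(i := e d)) q"
  have inv_i: "row_coeff k c (Suc i) A (col_shear j t q) = row_coeff k c (Suc i) A q" for t q
    by (rule row_coeff_invariant_below[OF c lead j _ inv]) (use i in simp)
  have exp: "?H 0 (col_shear j t q) = (\<Sum>s\<le>B. t ^ s * ((- 1) ^ s * ?H s q))" for t q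
    unfolding B_def e_def by (rule col_shear_expansion[OF c lead j inv_i])
  have cA: "c A \<noteq> 0" using lead by (simp add: leading_def)
  have low: "(\<Sum>r<i. A' r v) + e 0 v = (\<Sum>r<i. A r v) + A i v"
    if A': "c A' \<noteq> 0" "\<forall>r\<ge>i. A' r = (A(i := e 0)) r" and v: "v < k" for A' v
  proof -
    have split: "(\<Sum>r<m. f r) = (\<Sum>r<i. f r) + (f i + (\<Sum>r\<in>{Suc i..<m}. f r))" for f :: "nat \<Rightarrow> nat"
    proof -
      have "(\<Sum>r<m. f r) = (\<Sum>r<i. f r) + (\<Sum>r\<in>{i..<m}. f r)"
        using sum.atLeastLessThan_concat[of 0 i m f] i by (simp add: atLeast0LessThan)
      then show ?thesis unfolding sum.atLeast_Suc_lessThan[OF i] .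
    qed
    have "(\<Sum>r\<in>{Suc i..<m}. A' r v) = (\<Sum>r\<in>{Suc i..<m}. A r v)"
      using A'(2) by (intro sum.cong) auto
    moreover have "A' i v = e 0 v" using A'(2) by simp
    moreover have "(\<Sum>r<m. A' r v) = (\<Sum>r<m. A r v)"
      unfolding cols[of A', OF A'(1) v] cols[of A, OF cA v] ..
    ultimately show ?thesis
      unfolding split[of "\<lambda>r. A' r v"] split[of "\<lambda>r. A r v"] by linarith
  qed
  have zero: "?H 0 q = 0" for q
  proof (cases "\<exists>A'. c A' \<noteq> 0 \<and> (\<forall>r\<ge>i. A' r = (A(i := e 0)) r)")
    case False
    then have "{A'. c A' \<noteq> 0 \<and> (\<forall>r\<ge>i. A' r = (A(i := e 0)) r)} = {}" by blast
    then show ?thesis unfolding row_coeff_def by (metis sum.empty)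
  next
    case True
    have X: "(\<Sum>r<i. A' r j) + B = (\<Sum>r<i. A r j)"
      and Y: "(\<Sum>r<i. A' r (Suc j)) = b"
      if "c A' \<noteq> 0" "\<forall>r\<ge>i. A' r = (A(i := e 0)) r" for A'
      using low[OF that, of j] low[OF that, of "Suc j"] j
      by (auto simp: e_def B_def b_def)
    have aB: "a + B = (\<Sum>r<i. A r j)" using True X unfolding a_def by force
    have "?H 0 (set_cols j (\<lambda>r. q r j) (\<lambda>r. q r (Suc j)) q) = 0"
    proof (rule shear_degree_bound[where H = "\<lambda>X Y. ?H 0 (set_cols j X Y q)" and a = a and b = b
          and D = B and G = "\<lambda>d X Y. (- 1) ^ d * ?H d (set_cols j X Y q)"])
      show "\<exists>P. degree P \<le> a \<and> (\<forall>s. ?H 0 (set_cols j (\<lambda>r. W r + s * Z r) Y q) = poly P s)" for W Z Y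
      proof -
        have "\<forall>A'. c A' \<noteq> 0 \<and> (\<forall>r\<ge>i. A' r = (A(i := e 0)) r) \<longrightarrow> (\<Sum>r<i. A' r j) \<le> a"
          using X aB by (metis add_le_cancel_right order_refl)
        then show ?thesis using row_coeff_poly_in_column[OF c j, of i "A(i := e 0)" W Z Y q] by blast
      qed
      show "?H 0 (set_cols j X (\<lambda>r. s * Y r) q) = s ^ b * ?H 0 (set_cols j X Y q)" for s X Y
        by (rule row_coeff_homogeneous_in_column[OF j]) (rule Y)
      show "?H 0 (set_cols j X (\<lambda>r. Y r + t * X r) q) =
          (\<Sum>d\<le>B. t ^ d * ((- 1) ^ d * ?H d (set_cols j X Y q)))" for t X Y
      proof -
        have "set_cols j X (\<lambda>r. Y r + t * X r) q = col_shear j t (set_cols j X Y q)"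
          by (auto simp: set_cols_def col_shear_def fun_eq_iff)
        then show ?thesis by (simp only: exp)
      qed
      show "\<exists>P. \<forall>s. (- 1) ^ d * ?H d (set_cols j (\<lambda>r. W r + s * Z r) Y q) = poly P s" for d W Z Y
      proof -
        obtain P where "\<forall>s. ?H d (set_cols j (\<lambda>r. W r + s * Z r) Y q) = poly P s"
          using row_coeff_poly_in_column[OF c j, of i "A(i := e d)" W Z Y q] by blast
        then show ?thesis by (intro exI[of _ "smult ((- 1) ^ d) P"]) simp
      qed
      have "(\<Sum>r\<le>i. A r (Suc j)) = b" by (simp add: b_def B_def lessThan_Suc_atMost[symmetric])
      then show "a + B < b" using neg aB by simp
    qed
    moreover have "set_cols j (\<lambda>r. q r j) (\<lambda>r. q r (Suc j)) q = q"
      by (auto simp: set_cols_def fun_eq_iff)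
    ultimately show ?thesis by simp
  qed
  obtain q where q: "row_coeff k c i A q \<noteq> 0" using row_coeff_nonzero[of c m k A i, OF c cA] ..
  define P where "P = (\<Sum>s\<le>B. monom ((- 1) ^ s * ?H s q) s)"
  have "poly P t = 0" for t
    using exp[of t q] zero by (simp add: P_def poly_sum poly_monom mult_ac)
  then have "P = 0" using poly_all_0_iff_0 by blast
  then have "coeff P B = 0" by simp
  then have "?H B q = 0" by (simp add: P_def coeff_sum sum.delta)
  moreover have "A(i := e B) = A" by (auto simp: e_def B_def fun_eq_iff)
  ultimately show False using q by simp
qed

section \<open>Invariance under row operations\<close>

text \<open>
  Row \<open>0\<close> of the inequalities leaves nothing outside column \<open>0\<close>, and each further row can
  reach only one column further.
\<close>

lemma semistandard_triangular:
  fixes A :: "nat \<Rightarrow> nat \<Rightarrow> nat"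
  assumes ss: "\<And>i j. i < m \<Longrightarrow> Suc j < k \<Longrightarrow> (\<Sum>r\<le>i. A r (Suc j)) \<le> (\<Sum>r<i. A r j)"
  shows "r < m \<Longrightarrow> r < j \<Longrightarrow> j < k \<Longrightarrow> A r j = 0"
proof (induction r arbitrary: j rule: less_induct)
  case (less r)
  obtain j' where j': "j = Suc j'" using less.prems by (cases j) auto
  have "A r j \<le> (\<Sum>r'\<le>r. A r' (Suc j'))" unfolding j' by (rule member_le_sum) auto
  also have "\<dots> \<le> (\<Sum>r'<r. A r' j')" using ss less.prems j' by auto
  also have "\<dots> = 0" using less j' by (intro sum.neutral) auto
  finally show ?case by simp
qed

lemma row_coeff_row_invariant:
  assumes c: "c \<in> poly_coeffs m k" and A: "A \<in> exponents m k" and r: "Suc r < n" and "n \<le> m"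
    and inv: "\<And>q. poly_at m k c (row_shear r t q) = poly_at m k c q"
  shows "row_coeff k c n A (row_shear r t q) = row_coeff k c n A q"
  using \<open>n \<le> m\<close>
proof (induction n arbitrary: q rule: inc_induct)
  case base
  then show ?case unfolding row_coeff_all[OF c A] by (rule inv)
next
  case (step i)
  have "row_coeff k c i (A(i := A i)) (row_shear r t q) = row_coeff k c i (A(i := A i)) q"
  proof (rule row_coeff_compare[OF c])
    show "\<forall>v\<ge>k. A i v = 0" using A by (auto simp: exponents_def)
    show "row_coeff k c (Suc i) A (row_shear r t (q(i := z))) = row_coeff k c (Suc i) A (q(i := z))" for z
      by (rule step.IH)
  qed (use r step.hyps in \<open>auto simp: row_shear_def fun_eq_iff\<close>)
  then show ?case by simp
qed

text \<open>
  The coefficient of the leading monomial in the rows from \<open>n\<close> on is transposed (through \<open>glue\<close> and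
  \<open>cut\<close>) into a polynomial on \<open>k \<times> n\<close> matrices, whose leading exponent \<open>B\<close> is again triangular
  and has the row degrees of \<open>A\<close> as column degrees and vice versa.  Triangularity of
  \<open>A\<close> and of \<open>B\<close> bounds, for each \<open>s\<close>, the sum of the first \<open>s\<close> row degrees and of the first
  \<open>s\<close> column degrees by one another, so nothing of \<open>A\<close> lies below the diagonal either.
\<close>

lemma leading_diagonal:
  assumes c: "c \<in> poly_coeffs m k" and lead: "leading c A" and n: "n \<le> m"
    and cols: "\<And>A' v. c A' \<noteq> 0 \<Longrightarrow> v < k \<Longrightarrow> (\<Sum>r<m. A' r v) = F v"
    and rows: "\<And>A' r. c A' \<noteq> 0 \<Longrightarrow> r < n \<Longrightarrow> (\<Sum>v<k. A' r v) = D r"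
    and cinv: "\<And>j t q. Suc j < k \<Longrightarrow> poly_at m k c (col_shear j t q) = poly_at m k c q"
    and rinv: "\<And>r t q. Suc r < n \<Longrightarrow> poly_at m k c (row_shear r t q) = poly_at m k c q"
    and rj: "r < n" "j < k" "r \<noteq> j"
  shows "A r j = 0"
proof -
  have cA: "c A \<noteq> 0" using lead by (simp add: leading_def)
  then have A: "A \<in> exponents m k" using c unfolding poly_coeffs_def by blast
  have ss: "(\<Sum>r\<le>i. A r (Suc j)) \<le> (\<Sum>r<i. A r j)" if "i < m" "Suc j < k" for i j
  proof (rule leading_semistandard[OF c lead that(2,1)])
    show "(\<Sum>r<m. A' r v) = F v" if "c A' \<noteq> 0" "v < k" for A' v by (rule cols[OF that])
    show "poly_at m k c (col_shear j t q) = poly_at m k c q" for t q by (rule cinv[OF that(2)])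
  qed
  have triA: "A r v = 0" if "r < n" "r < v" "v < k" for r v
    by (rule semistandard_triangular[of m k A, OF ss]) (use that n in auto)
  define glue where "glue = (\<lambda>B r (v::nat). if r < n then B v r else A r v :: nat)"
  define cut where "cut = (\<lambda>A' (v::nat) r. if r < n then A' r v else (0::nat))"
  define c' where "c' = (\<lambda>B. if B \<in> exponents k n then c (glue B) else 0)"
  have cut_glue: "cut (glue B) = B" if "B \<in> exponents k n" for B
    using that by (auto simp: cut_def glue_def exponents_def fun_eq_iff)
  have glue_cut: "glue (cut A') = A'" if "\<forall>r\<ge>n. A' r = A r" for A'
    using that by (auto simp: cut_def glue_def fun_eq_iff)
  have cut_exp: "cut A' \<in> exponents k n" if "c A' \<noteq> 0" for A'
  proof -
    have "A' \<in> exponents m k" using c that unfolding poly_coeffs_def by blast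
    then show ?thesis by (auto simp: cut_def exponents_def)
  qed
  have supp: "B \<in> exponents k n" "c (glue B) \<noteq> 0" if "c' B \<noteq> 0" for B
    using that by (auto simp: c'_def split: if_splits)
  have c': "c' \<in> poly_coeffs k n"
  proof -
    have "glue ` {B. c' B \<noteq> 0} \<subseteq> {A'. c A' \<noteq> 0}"
      by (intro image_subsetI) (simp add: supp(2))
    moreover have "finite {A'. c A' \<noteq> 0}" using c by (simp add: poly_coeffs_def)
    ultimately have "finite (glue ` {B. c' B \<noteq> 0})" by (rule finite_subset)
    moreover have "inj_on glue {B. c' B \<noteq> 0}"
    proof (rule inj_onI)
      fix B B' assume *: "B \<in> {B. c' B \<noteq> 0}" "B' \<in> {B. c' B \<noteq> 0}" "glue B = glue B'"
      have "B \<in> exponents k n" "B' \<in> exponents k n" using *(1,2) by (simp_all add: supp(1))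
      from this[THEN cut_glue] show "B = B'" unfolding *(3) by (rule trans[OF sym])
    qed
    ultimately have "finite {B. c' B \<noteq> 0}" by (rule finite_imageD)
    moreover have "{B. c' B \<noteq> 0} \<subseteq> exponents k n" by (intro subsetI) (simp add: supp(1))
    ultimately show ?thesis by (simp add: poly_coeffs_def)
  qed
  have eval: "poly_at k n c' q = row_coeff k c n A (\<lambda>r v. q v r)" for q
    unfolding poly_at_def row_coeff_def
  proof (rule sum.reindex_bij_witness[of _ cut glue])
    fix B assume "B \<in> {B. c' B \<noteq> 0}"
    then have B: "B \<in> exponents k n" "c (glue B) \<noteq> 0" using supp by auto
    show "cut (glue B) = B" by (rule cut_glue[OF B(1)])
    show "glue B \<in> {A'. c A' \<noteq> 0 \<and> (\<forall>r\<ge>n. A' r = A r)}"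
      using B(2) by (auto simp: glue_def)
    have "monom_at n k (glue B) (\<lambda>r v. q v r) = monom_at k n B q"
      unfolding monom_at_def by (subst prod.swap) (auto simp: glue_def intro!: prod.cong)
    then show "c (glue B) * monom_at n k (glue B) (\<lambda>r v. q v r) = c' B * monom_at k n B q"
      using B by (simp add: c'_def)
  next
    fix A' assume A': "A' \<in> {A'. c A' \<noteq> 0 \<and> (\<forall>r\<ge>n. A' r = A r)}"
    then show gc: "glue (cut A') = A'" by (intro glue_cut) auto
    show "cut A' \<in> {B. c' B \<noteq> 0}"
      using A' cut_exp[of A'] gc by (simp add: c'_def)
  qed
  have "c' (cut A) \<noteq> 0" using cut_exp[OF cA] glue_cut[of A] cA by (simp add: c'_def)
  then obtain B where lead': "leading c' B" using leading_exists[of c' k n "cut A"] c' by blast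
  then have c'B: "c' B \<noteq> 0" by (simp add: leading_def)
  have colsB: "(\<Sum>v<k. B' v r) = D r" if "c' B' \<noteq> 0" "r < n" for B' r
  proof -
    have "(\<Sum>v<k. B' v r) = (\<Sum>v<k. glue B' r v)" using that by (simp add: glue_def)
    then show ?thesis using rows[of "glue B'" r] supp(2)[OF that(1)] that(2) by simp
  qed
  have rowsB: "(\<Sum>r<n. B v r) = (\<Sum>r<n. A r v)" if v: "v < k" for v
  proof -
    have split: "(\<Sum>r<m. f r) = (\<Sum>r<n. f r) + (\<Sum>r\<in>{n..<m}. f r)" for f :: "nat \<Rightarrow> nat"
      using sum.atLeastLessThan_concat[of 0 n m f] n by (simp add: atLeast0LessThan)
    have "(\<Sum>r<m. glue B r v) = (\<Sum>r<m. A r v)"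
      unfolding cols[of "glue B", OF supp(2)[OF c'B] v] cols[of A, OF cA v] ..
    moreover have "(\<Sum>r\<in>{n..<m}. glue B r v) = (\<Sum>r\<in>{n..<m}. A r v)"
      by (intro sum.cong) (auto simp: glue_def)
    ultimately have "(\<Sum>r<n. glue B r v) = (\<Sum>r<n. A r v)"
      unfolding split[of "\<lambda>r. glue B r v"] split[of "\<lambda>r. A r v"] by linarith
    then show ?thesis by (simp add: glue_def)
  qed
  have ssB: "(\<Sum>v\<le>i. B v (Suc r)) \<le> (\<Sum>v<i. B v r)" if "i < k" "Suc r < n" for i r
  proof (rule leading_semistandard[OF c' lead' that(2,1)])
    show "(\<Sum>v<k. B' v r) = D r" if "c' B' \<noteq> 0" "r < n" for B' r by (rule colsB[OF that])
    show "poly_at k n c' (col_shear r t q) = poly_at k n c' q" for t q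
    proof -
      have "(\<lambda>i v. col_shear r t q v i) = row_shear r t (\<lambda>i v. q v i)"
        by (auto simp: col_shear_def row_shear_def fun_eq_iff)
      then show ?thesis
        unfolding eval by (simp only: row_coeff_row_invariant[OF c A that(2) n rinv[OF that(2)]])
    qed
  qed
  have triB: "B v r = 0" if "v < k" "v < r" "r < n" for r v
    by (rule semistandard_triangular[of k n B, OF ssB]) (use that in auto)
  show ?thesis
  proof (cases "r < j")
    case True
    then show ?thesis using triA rj by blast
  next
    case False
    then have "j < r" using rj by simp
    \<comment> \<open>The critical position is the last of the first \<open>s\<close> columns, and row \<open>r\<close> is beyond the first \<open>s\<close> rows.\<close>
    define s where "s = Suc j"
    have s: "s \<le> r" "s \<le> n" "s \<le> k" using \<open>j < r\<close> rj by (auto simp: s_def)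
    have "(\<Sum>v<s. \<Sum>r<n. A r v) = (\<Sum>v<s. \<Sum>r<n. B v r)"
      by (rule sum.cong) (use rowsB s in auto)
    also have "\<dots> = (\<Sum>v<s. \<Sum>r<s. B v r)"
      by (rule sum.cong[OF refl], rule sum.mono_neutral_right) (use s triB in auto)
    also have "\<dots> \<le> (\<Sum>v<k. \<Sum>r<s. B v r)" using s by (intro sum_mono2) auto
    also have "\<dots> = (\<Sum>r<s. \<Sum>v<k. B v r)" by (rule sum.swap)
    also have "\<dots> = (\<Sum>r<s. D r)"
      by (rule sum.cong) (use s colsB[OF c'B] in auto)
    also have "\<dots> = (\<Sum>r<s. \<Sum>v<k. A r v)"
      by (rule sum.cong) (use s rows[OF cA] in auto)
    also have "\<dots> = (\<Sum>r<s. \<Sum>v<s. A r v)"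
      by (rule sum.cong[OF refl], rule sum.mono_neutral_right) (use s triA in auto)
    also have "\<dots> = (\<Sum>v<s. \<Sum>r<s. A r v)" by (rule sum.swap)
    finally have le: "(\<Sum>v<s. \<Sum>r<n. A r v) \<le> (\<Sum>v<s. \<Sum>r<s. A r v)" .
    have "(\<Sum>r<n. A r v) = (\<Sum>r<s. A r v) + (\<Sum>r\<in>{s..<n}. A r v)" for v
      using sum.atLeastLessThan_concat[of 0 s n "\<lambda>r. A r v"] s by (simp add: atLeast0LessThan)
    then have "(\<Sum>v<s. \<Sum>r\<in>{s..<n}. A r v) = 0"
      using le by (simp add: sum.distrib)
    then have "\<forall>v\<in>{..<s}. (\<Sum>r\<in>{s..<n}. A r v) = 0" by (subst (asm) sum_eq_0_iff) auto
    then have "(\<Sum>r\<in>{s..<n}. A r j) = 0" by (auto simp: s_def)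
    then show ?thesis using s rj by (subst (asm) sum_eq_0_iff) auto
  qed
qed

section \<open>Standard tableaux and their exponents\<close>

definition column_exponent :: "nat set \<Rightarrow> nat \<Rightarrow> nat \<Rightarrow> nat" where
  "column_exponent I = (\<lambda>r j. if j < card I \<and> pick I j = r then 1 else 0)"

definition tableau_exponent :: "nat set list \<Rightarrow> nat \<Rightarrow> nat \<Rightarrow> nat" where
  "tableau_exponent t = (\<lambda>r j. \<Sum>I\<leftarrow>t. column_exponent I r j)"

lemma tableau_exponent_simps:
  "tableau_exponent [] = 0"
  "tableau_exponent (I # t) = column_exponent I + tableau_exponent t"
  by (auto simp: tableau_exponent_def fun_eq_iff)

lemma down_closed_nat_set:
  fixes S :: "nat set"
  assumes "finite S" "\<And>c c'. c \<in> S \<Longrightarrow> c' < c \<Longrightarrow> c' \<in> S"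
  shows "S = {..<card S}"
proof -
  obtain n0 where "n0 \<notin> S" using assms(1) ex_new_if_finite[of S] by auto
  define n where "n = (LEAST n. n \<notin> S)"
  have n: "n \<notin> S" unfolding n_def using \<open>n0 \<notin> S\<close> by (rule LeastI)
  have "S = {..<n}"
  proof (intro Set.set_eqI iffI)
    fix c assume "c \<in> S"
    then show "c \<in> {..<n}" using n assms(2)[of c n] by (metis lessThan_iff linorder_neqE_nat)
  next
    fix c assume "c \<in> {..<n}"
    then show "c \<in> S" using not_less_Least[of c "\<lambda>n. n \<notin> S"] by (auto simp: n_def)
  qed
  then show ?thesis by simp
qed

lemma pick_image_strict_mono:
  assumes "\<And>i j. i < j \<Longrightarrow> j < h \<Longrightarrow> f i < f j" "j < h"
  shows "pick (f ` {..<h}) j = f j"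
proof -
  have "{a \<in> f ` {..<h}. a < f j} = f ` {..<j}"
  proof (intro Set.set_eqI iffI)
    fix a assume "a \<in> {a \<in> f ` {..<h}. a < f j}"
    then obtain i where i: "i < h" "a = f i" "f i < f j" by auto
    then have "i < j" using assms(1)[of j i] assms(2) by (metis less_asym linorder_neqE_nat)
    then show "a \<in> f ` {..<j}" using i by auto
  next
    fix a assume "a \<in> f ` {..<j}"
    then show "a \<in> {a \<in> f ` {..<h}. a < f j}" using assms by auto
  qed
  moreover have "card (f ` {..<j}) = j"
  proof -
    have "inj_on f {..<j}"
      by (rule linorder_inj_onI') (use assms in \<open>force\<close>)
    then show ?thesis by (simp add: card_image)
  qed
  ultimately have "card {a \<in> f ` {..<h}. a < f j} = j" by simp
  then show ?thesis using pick_card_in_set[of "f j" "f ` {..<h}"] assms(2) by simp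
qed

lemma pick_image:
  assumes "finite I"
  shows "pick I ` {..<card I} = I"
proof (intro Set.set_eqI iffI)
  fix i assume "i \<in> pick I ` {..<card I}"
  then show "i \<in> I" using pick_in_set_le by auto
next
  fix i assume i: "i \<in> I"
  have "{a \<in> I. a < i} \<subset> I" using i by auto
  then have "card {a \<in> I. a < i} < card I" using assms by (rule psubset_card_mono[rotated])
  then show "i \<in> pick I ` {..<card I}"
    by (intro image_eqI[of _ _ "card {a \<in> I. a < i}"] pick_card_in_set[OF i, symmetric]) simp
qed

lemma column_setsD:
  assumes "I \<in> column_sets m n" "n \<le> m"
  shows "I \<subseteq> {..<m}" "finite I" "0 < card I"
proof -
  obtain r A where I: "I = {..<r} \<union> A" "r \<le> n" "A \<subseteq> {n..<m}" "I \<noteq> {}"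
    using assms(1) unfolding column_sets_def by blast
  show "I \<subseteq> {..<m}" using I assms(2) by auto
  then show "finite I" using finite_subset by blast
  then show "0 < card I" using I(4) by (simp add: card_gt_0_iff)
qed

lemma sum_column_exponent_rows:
  assumes "finite I" "I \<subseteq> {..<m}"
  shows "(\<Sum>r<m. column_exponent I r j) = (if j < card I then 1 else 0)"
proof (cases "j < card I")
  case True
  then have "pick I j < m" using assms(2) pick_in_set_le by blast
  then show ?thesis using True by (simp add: column_exponent_def)
qed (simp add: column_exponent_def)

lemma sum_column_exponent_cols:
  assumes "finite I" "card I \<le> k"
  shows "(\<Sum>j<k. column_exponent I r j) = (if r \<in> I then 1 else 0)"
proof -
  have inj: "i = j" if "i < card I" "j < card I" "pick I i = pick I j" for i j
    using pick_mono_le[of j I i] pick_mono_le[of i I j] that by (metis less_irrefl linorder_neqE_nat)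
  show ?thesis
  proof (cases "r \<in> I")
    case True
    then have "r \<in> pick I ` {..<card I}" unfolding pick_image[OF assms(1)] .
    then obtain j0 where "r = pick I j0" "j0 \<in> {..<card I}" by (rule imageE)
    then have j0: "j0 < card I" "pick I j0 = r" by simp_all
    have "column_exponent I r j = (if j = j0 then 1 else 0)" for j
    proof -
      have "j < card I \<and> pick I j = r \<longleftrightarrow> j = j0" 
      proof (intro iffI conjI)
        assume "j < card I \<and> pick I j = r"
        then show "j = j0" using j0 by (metis inj)
      next
        assume "j = j0"
        then show "j < card I" "pick I j = r" using j0 by simp_all
      qed
      then show ?thesis by (simp only: column_exponent_def)
    qed
    then show ?thesis using True j0 assms(2) by simp
  next
    case False
    then have "column_exponent I r j = 0" for j
      using pick_in_set_le by (auto simp: column_exponent_def)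
    then show ?thesis using False by simp
  qed
qed

lemma outer_shape_conv: "outer_shape t j = length (filter (\<lambda>I. j < card I) t)"
proof -
  have "{c. j < (if c < length t then card (t ! c) else 0)} = {c. c < length t \<and> j < card (t ! c)}"
    by auto
  then show ?thesis
    unfolding outer_shape_def conjugate_diagram_def length_filter_conv_card by simp
qed

lemma inner_shape_conv: "r < n \<Longrightarrow> inner_shape n t r = length (filter (\<lambda>I. r \<in> I) t)"
  unfolding inner_shape_def length_filter_conv_card by simp

lemma tableau_exponent_col_sum:
  assumes "set t \<subseteq> column_sets m n" "n \<le> m"
  shows "(\<Sum>r<m. tableau_exponent t r j) = outer_shape t j"
  unfolding outer_shape_conv using assms(1)
proof (induction t)
  case (Cons I t)
  then show ?case
    using sum_column_exponent_rows[of I m j] column_setsD[OF _ assms(2), of I]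
    by (simp add: tableau_exponent_simps sum.distrib)
qed (simp add: tableau_exponent_simps)

lemma tableau_exponent_row_sum:
  assumes "set t \<subseteq> column_sets m n" "n \<le> m" "\<forall>I\<in>set t. card I \<le> k" "r < n"
  shows "(\<Sum>j<k. tableau_exponent t r j) = inner_shape n t r"
  unfolding inner_shape_conv[OF assms(4)] using assms(1,3)
proof (induction t)
  case (Cons I t)
  then show ?case
    using sum_column_exponent_cols[of I k r] column_setsD[OF _ assms(2), of I]
    by (simp add: tableau_exponent_simps sum.distrib)
qed (simp add: tableau_exponent_simps)

lemma tableau_exponent_in_exponents:
  assumes "set t \<subseteq> column_sets m n" "n \<le> m" "\<forall>I\<in>set t. card I \<le> k"
  shows "tableau_exponent t \<in> exponents m k"
proof -
  have "column_exponent I r j = 0" if I: "I \<in> set t" and "\<not> (r < m \<and> j < k)" for I r j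
  proof -
    have "I \<subseteq> {..<m}" "card I \<le> k"
      using column_setsD(1)[OF subsetD[OF assms(1) I] assms(2)] assms(3) I by auto
    then show ?thesis using that(2) pick_in_set_le[of j I] by (auto simp: column_exponent_def)
  qed
  then show ?thesis by (auto simp: exponents_def tableau_exponent_def)
qed

text \<open>
  The columns whose entry in row \<open>j\<close> exists and is at most \<open>r\<close> form an initial segment
  of a standard tableau, so their number tells which columns they are.  This is how the tableau is
  recovered from its exponent.
\<close>

lemma less_tableau_exponent_sum:
  assumes "standard_tableau m n t"
  shows "c < (\<Sum>r'\<le>r. tableau_exponent t r' j) \<longleftrightarrow>
    c < length t \<and> j < card (t ! c) \<and> pick (t ! c) j \<le> r"
proof -
  have sorted: "sorted_wrt tableau_le t" using assms by (simp add: standard_tableau_def)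
  let ?p = "\<lambda>I. j < card I \<and> pick I j \<le> r"
  let ?S = "{c. c < length t \<and> ?p (t ! c)}"
  have "(\<Sum>r'\<le>r. column_exponent I r' j) = (if ?p I then 1 else 0)" for I
    by (auto simp: column_exponent_def sum.delta)
  then have "(\<Sum>r'\<le>r. tableau_exponent t r' j) = length (filter ?p t)"
    by (induction t) (auto simp: tableau_exponent_simps sum.distrib)
  also have "\<dots> = card ?S" by (rule length_filter_conv_card)
  finally have card: "(\<Sum>r'\<le>r. tableau_exponent t r' j) = card ?S" .
  have "?S = {..<card ?S}"
  proof (rule down_closed_nat_set)
    fix c c' assume c: "c \<in> ?S" and "c' < c"
    then have "tableau_le (t ! c') (t ! c)" using sorted by (auto simp: sorted_wrt_iff_nth_less)
    then show "c' \<in> ?S" using c \<open>c' < c\<close> unfolding tableau_le_def by force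
  qed simp
  then show ?thesis unfolding card by blast
qed

lemma tableau_exponent_inj:
  assumes t: "standard_tableau m n t" and t': "standard_tableau m n t'" and "n \<le> m"
    and eq: "tableau_exponent t = tableau_exponent t'"
  shows "t = t'"
proof -
  have P: "(c < length t \<and> j < card (t ! c) \<and> pick (t ! c) j \<le> r) \<longleftrightarrow>
      (c < length t' \<and> j < card (t' ! c) \<and> pick (t' ! c) j \<le> r)" for c j r
    using less_tableau_exponent_sum[OF t, of c j r] less_tableau_exponent_sum[OF t', of c j r] eq
    by simp
  have cols: "finite (s ! c)" "0 < card (s ! c)"
    if "standard_tableau m n s" "c < length s" for s c
    using column_setsD(2,3)[OF _ \<open>n \<le> m\<close>, of "s ! c"] that
    unfolding standard_tableau_def by (meson nth_mem subsetD)+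
  have len: "c < length t \<longleftrightarrow> c < length t'" for c
    using P[of c 0] cols[OF t] cols[OF t'] by (metis order_refl)
  have "t ! c = t' ! c" if c: "c < length t" for c
  proof -
    have c': "c < length t'" using len c by simp
    have "j < card (t ! c) \<longleftrightarrow> j < card (t' ! c)" for j
      using P[of c j] c c' by (metis order_refl)
    then have card: "card (t ! c) = card (t' ! c)" by (metis linorder_neqE_nat less_irrefl)
    have "pick (t ! c) j = pick (t' ! c) j" if "j < card (t ! c)" for j
      using P[of c j] c c' card that by (metis order_refl order_antisym)
    then have "pick (t ! c) ` {..<card (t ! c)} = pick (t' ! c) ` {..<card (t' ! c)}"
      using card by auto
    then show ?thesis using pick_image cols(1)[OF t c] cols(1)[OF t' c'] by simp
  qed
  moreover have "length t = length t'" using len by (metis linorder_neqE_nat less_irrefl)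
  ultimately show ?thesis by (simp add: nth_equalityI)
qed

text \<open>
  Row \<open>j\<close> of the tableau must contain each \<open>r\<close> exactly \<open>A r j\<close> times in weakly increasing order,
  which determines it.  The inequalities make the columns strictly increasing.  The condition
  on the entries below \<open>n\<close> places each of them in the row of the same number, so that in
  every column they form an initial segment.
\<close>

lemma tableau_exponent_surj:
  assumes A: "A \<in> exponents m k"
    and ss: "\<And>i j. i < m \<Longrightarrow> Suc j < k \<Longrightarrow> (\<Sum>r\<le>i. A r (Suc j)) \<le> (\<Sum>r<i. A r j)"
    and diag: "\<And>r j. r < n \<Longrightarrow> j < k \<Longrightarrow> r \<noteq> j \<Longrightarrow> A r j = 0"
    and "n \<le> m"
  shows "\<exists>t. standard_tableau m n t \<and> tableau_exponent t = A \<and> (\<forall>I\<in>set t. card I \<le> k)"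
proof -
  \<comment> \<open>\<open>N r j\<close> counts the entries \<open>\<le> r\<close> of row \<open>j\<close>, \<open>F j\<close> is the length of that row, and \<open>h c\<close> the
    height of column \<open>c\<close>.\<close>
  define N where "N = (\<lambda>r j. \<Sum>r'\<le>r. A r' j)"
  define F where "F = (\<lambda>j. \<Sum>r<m. A r j)"
  define h where "h = (\<lambda>c. card {j. c < F j})"
  define entry where "entry = (\<lambda>c j. LEAST r. c < N r j)"
  have Ak: "A r j = 0" if "r \<ge> m \<or> j \<ge> k" for r j using A that by (auto simp: exponents_def)
  have N_mono: "N r j \<le> N r' j" if "r \<le> r'" for r r' j
    unfolding N_def using that by (intro sum_mono2) auto
  have N_le_F: "N r j \<le> F j" for r j
  proof -
    have "N r j = (\<Sum>r'\<in>{..r} \<inter> {..<m}. A r' j)"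
      unfolding N_def
    proof (rule sum.mono_neutral_right)
      show "\<forall>r'\<in>{..r} - {..r} \<inter> {..<m}. A r' j = 0"
        by (auto intro!: Ak)
    qed auto
    also have "\<dots> \<le> F j" unfolding F_def by (rule sum_mono2) auto
    finally show ?thesis .
  qed
  have F_k: "F j = 0" if "j \<ge> k" for j using that by (simp add: F_def Ak)
  have F_N: "F j = N (m - 1) j" if "0 < m" for j
    using that by (cases m) (auto simp: F_def N_def lessThan_Suc_atMost)
  have m_pos: "0 < m" if "c < F j" for c j using that by (cases m) (auto simp: F_def)
  have F_Suc: "F (Suc j) \<le> F j" for j
  proof (cases "Suc j < k \<and> 0 < m")
    case True
    then have "F (Suc j) \<le> (\<Sum>r<m-1. A r j)" using ss[of "m - 1" j] F_N by (simp add: N_def)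
    also have "\<dots> \<le> F j" unfolding F_def by (intro sum_mono2) auto
    finally show ?thesis .
  next
    case False
    then show ?thesis using F_k by (auto simp: F_def)
  qed
  then have F_anti: "F j \<le> F i" if "i \<le> j" for i j using that by (rule lift_Suc_antimono_le)
  have down: "{j. c < F j} = {..<h c}" for c
    unfolding h_def
  proof (rule down_closed_nat_set)
    have "{j. c < F j} \<subseteq> {..<k}" using F_k by (force simp: not_le[symmetric])
    then show "finite {j. c < F j}" using finite_subset by blast
  qed (use F_anti in \<open>force dest: less_imp_le_nat\<close>)
  then have less_h: "j < h c \<longleftrightarrow> c < F j" for c j by blast
  have h_le: "h c \<le> k" for c
    using less_h[of k c] F_k[of k] by (simp add: not_less)
  have entry_le: "entry c j \<le> r \<longleftrightarrow> c < N r j" if "c < F j" for c j r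
  proof
    have "c < N (m - 1) j" using that m_pos F_N by simp
    then have "c < N (entry c j) j" unfolding entry_def by (rule LeastI)
    moreover assume "entry c j \<le> r"
    ultimately show "c < N r j" using N_mono[of "entry c j" r j] by linarith
  next
    assume "c < N r j"
    then show "entry c j \<le> r" unfolding entry_def by (rule Least_le)
  qed
  have entry_N: "c < N (entry c j) j" if "c < F j" for c j
    using entry_le[OF that, of "entry c j"] by simp
  have entry_m: "entry c j < m" if "c < F j" for c j
    using entry_le[OF that, of "m - 1"] F_N[of j] m_pos[OF that] that by simp
  have entry_step: "entry c j < entry c (Suc j)" if "Suc j < h c" for c j
  proof -
    have c1: "c < F (Suc j)" using less_h that by simp
    then have c: "c < F (Suc j)" "c < F j" using F_Suc[of j] by linarith+
    let ?r = "entry c (Suc j)"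
    have "c < N ?r (Suc j)" by (rule entry_N[OF c(1)])
    also have "\<dots> \<le> (\<Sum>r<?r. A r j)"
      unfolding N_def using ss entry_m[OF c(1)] that h_le[of c] by simp
    finally have *: "c < (\<Sum>r<?r. A r j)" .
    then obtain r where r: "?r = Suc r" by (cases ?r) auto
    then have "c < N r j" using * by (simp add: N_def lessThan_Suc_atMost)
    then show ?thesis using entry_le[OF c(2), of r] r by simp
  qed
  have entry_mono: "entry c i < entry c j" if "i < j" "j < h c" for c i j
    using that
  proof (induction j)
    case (Suc j)
    then show ?case using entry_step[of j c] by (cases "i = j") auto
  qed simp
  define col where "col = (\<lambda>c. entry c ` {..<h c})"
  define t where "t = map col [0..<F 0]"
  have pick_col: "pick (col c) j = entry c j" if "j < h c" for c j
    unfolding col_def using pick_image_strict_mono[of "h c" "entry c" j] entry_mono that by blast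
  have card_col: "card (col c) = h c" for c
  proof -
    have "inj_on (entry c) {..<h c}" by (rule linorder_inj_onI') (use entry_mono in force)
    then show ?thesis by (simp add: col_def card_image)
  qed
  have entry_diag: "entry c j = j" if "j < h c" "entry c j < n" for c j
  proof (rule ccontr)
    assume "entry c j \<noteq> j"
    have c: "c < F j" using less_h that by simp
    have "j < k" using that(1) h_le[of c] by linarith
    let ?r = "entry c j"
    have "A ?r j = 0" using diag that(2) \<open>j < k\<close> \<open>?r \<noteq> j\<close> by blast
    moreover have "c < N ?r j" by (rule entry_N[OF c])
    ultimately have "c < (\<Sum>r<?r. A r j)" by (simp add: N_def flip: lessThan_Suc_atMost)
    moreover then obtain r where r: "?r = Suc r" by (cases ?r) auto
    ultimately have "c < N r j" by (simp add: N_def lessThan_Suc_atMost)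
    then show False using entry_le[OF c, of r] r by simp
  qed
  have col_set: "col c \<in> column_sets m n" if "c < F 0" for c
  proof -
    let ?J = "{j. j < h c \<and> entry c j < n}"
    have J: "?J = {..<card ?J}"
      by (rule down_closed_nat_set) (use entry_mono in \<open>force+\<close>)
    have "?J \<subseteq> {..<n}" using entry_diag by force
    then have "card ?J \<le> n" using card_mono[of "{..<n}" ?J] by simp
    moreover have "col c = {..<card ?J} \<union> (col c \<inter> {n..<m})"
    proof (intro Set.set_eqI iffI)
      fix x assume "x \<in> col c"
      then obtain j where j: "j < h c" "x = entry c j" by (auto simp: col_def)
      show "x \<in> {..<card ?J} \<union> (col c \<inter> {n..<m})"
      proof (cases "x < n")
        case True
        then have "x = j" using entry_diag j by auto
        moreover have "j \<in> ?J" using j True by simp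
        ultimately show ?thesis using J by blast
      next
        case False
        moreover have "x < m" using j entry_m less_h by auto
        ultimately show ?thesis using \<open>x \<in> col c\<close> by simp
      qed
    next
      fix x assume "x \<in> {..<card ?J} \<union> (col c \<inter> {n..<m})"
      then consider "x \<in> ?J" | "x \<in> col c" using J by blast
      then show "x \<in> col c"
      proof cases
        case 1 then have "entry c x = x" using entry_diag by auto
        then show ?thesis using 1 unfolding col_def by (metis (lifting) image_eqI lessThan_iff mem_Collect_eq)
      qed
    qed
    moreover have "col c \<noteq> {}" using that less_h[of 0 c] by (auto simp: col_def)
    ultimately show ?thesis unfolding column_sets_def
      by (intro CollectI exI[of _ "card ?J"] exI[of _ "col c \<inter> {n..<m}"]) auto
  qed
  have "sorted_wrt tableau_le t"
    unfolding sorted_wrt_iff_nth_less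
  proof (intro allI impI)
    fix c c' assume cc: "c < c'" "c' < length t"
    have h: "h c' \<le> h c"
    proof (rule ccontr)
      assume "\<not> ?thesis"
      then have "c' < F (h c)" using less_h[of "h c" c'] by simp
      then have "h c < h c" using less_h[of "h c" c] cc(1) by simp
      then show False by simp
    qed
    have "pick (col c) j \<le> pick (col c') j" if "j < h c'" for j
    proof -
      have "c' < F j" using that less_h by simp
      then have j: "c' < F j" "c < F j" "j < h c" using that cc(1) h by linarith+
      have "c' < N (entry c' j) j" by (rule entry_N[OF j(1)])
      then have "entry c j \<le> entry c' j" using entry_le[OF j(2), of "entry c' j"] cc(1) by simp
      then show ?thesis using pick_col that j by simp
    qed
    then have "tableau_le (col c) (col c')" using h by (simp add: tableau_le_def card_col)
    then show "tableau_le (t ! c) (t ! c')" using cc by (simp add: t_def)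
  qed
  moreover have "set t \<subseteq> column_sets m n" using col_set by (auto simp: t_def)
  ultimately have st: "standard_tableau m n t" by (simp add: standard_tableau_def)
  have sums: "(\<Sum>r'\<le>r. tableau_exponent t r' j) = (\<Sum>r'\<le>r. A r' j)" for r j
  proof -
    have "c < (\<Sum>r'\<le>r. tableau_exponent t r' j) \<longleftrightarrow> c < N r j" for c
    proof -
      have "c < (\<Sum>r'\<le>r. tableau_exponent t r' j) \<longleftrightarrow> c < F 0 \<and> j < h c \<and> entry c j \<le> r"
        unfolding less_tableau_exponent_sum[OF st] by (auto simp: t_def card_col pick_col)
      also have "\<dots> \<longleftrightarrow> c < F j \<and> c < N r j"
        using less_h[of j c] entry_le[of c j r] F_anti[of 0 j] by auto
      also have "\<dots> \<longleftrightarrow> c < N r j" using N_le_F[of r j] by auto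
      finally show ?thesis .
    qed
    then have "(\<Sum>r'\<le>r. tableau_exponent t r' j) = N r j"
      by (metis linorder_neqE_nat less_irrefl)
    then show ?thesis by (simp only: N_def)
  qed
  have "tableau_exponent t r j = A r j" for r j
  proof (cases r)
    case 0 then show ?thesis using sums[where r = 0 and j = j] by simp
  next
    case (Suc r')
    then show ?thesis using sums[where r = r and j = j] sums[where r = r' and j = j] by simp
  qed
  then have "tableau_exponent t = A" by (intro ext)
  moreover have "\<forall>I\<in>set t. card I \<le> k" using h_le by (auto simp: t_def card_col)
  ultimately show ?thesis using st by blast
qed

section \<open>Polynomial functions and their leading exponents\<close>

lemma monom_at_add: "monom_at m k (A + B) q = monom_at m k A q * monom_at m k B q"
  by (simp add: monom_at_def power_add prod.distrib)

lemma monom_at_zero: "monom_at m k 0 q = 1"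
  by (simp add: monom_at_def)

lemma exponents_add: "A \<in> exponents m k \<Longrightarrow> B \<in> exponents m k \<Longrightarrow> A + B \<in> exponents m k"
  by (simp add: exponents_def)

lemma exponents_zero: "0 \<in> exponents m k"
  by (simp add: exponents_def)

definition unit_exponent :: "nat \<Rightarrow> nat \<Rightarrow> nat \<Rightarrow> nat \<Rightarrow> nat" where
  "unit_exponent i l = (\<lambda>r j. if r = i \<and> j = l then 1 else 0)"

lemma monom_at_unit:
  assumes "i < m" "l < k"
  shows "monom_at m k (unit_exponent i l) q = q i l"
proof -
  have "(\<Prod>j<k. q r j ^ unit_exponent i l r j) = (if r = i then q i l else 1)" for r
  proof -
    have "(\<Prod>j<k. q r j ^ unit_exponent i l r j) = (\<Prod>j<k. if j = l then (if r = i then q i l else 1) else 1)"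
      by (rule prod.cong) (auto simp: unit_exponent_def)
    then show ?thesis using assms(2) by (simp add: prod.delta)
  qed
  then show ?thesis using assms(1) by (simp add: monom_at_def prod.delta)
qed

definition poly_fun :: "nat \<Rightarrow> nat \<Rightarrow> ((nat \<Rightarrow> nat \<Rightarrow> nat) \<Rightarrow> complex) \<Rightarrow> complex mat \<Rightarrow> complex" where
  "poly_fun m k c = on_mats m k (\<lambda>Q. poly_at m k c (\<lambda>r j. Q $$ (r, j)))"

text \<open>
  The coefficients of a sum of monomials in which exponents may repeat, as they do in
  products and in the Leibniz formula.
\<close>

definition collect_coeffs ::
  "'x set \<Rightarrow> ('x \<Rightarrow> complex) \<Rightarrow> ('x \<Rightarrow> nat \<Rightarrow> nat \<Rightarrow> nat) \<Rightarrow> (nat \<Rightarrow> nat \<Rightarrow> nat) \<Rightarrow> complex" where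
  "collect_coeffs X b E = (\<lambda>A. \<Sum>x\<in>{x \<in> X. E x = A}. b x)"

lemma collect_coeffs_support:
  assumes "collect_coeffs X b E A \<noteq> 0"
  shows "A \<in> E ` X"
proof (rule ccontr)
  assume "A \<notin> E ` X"
  then have "{x \<in> X. E x = A} = {}" by blast
  then have "collect_coeffs X b E A = 0" unfolding collect_coeffs_def by (simp only: sum.empty)
  then show False using assms by simp
qed

lemma collect_coeffs:
  assumes X: "finite X" and E: "E ` X \<subseteq> exponents m k"
  shows "collect_coeffs X b E \<in> poly_coeffs m k"
    and "poly_at m k (collect_coeffs X b E) q = (\<Sum>x\<in>X. b x * monom_at m k (E x) q)"
proof -
  let ?c = "collect_coeffs X b E"
  have sub: "{A. ?c A \<noteq> 0} \<subseteq> E ` X"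
    by (intro subsetI, drule CollectD) (rule collect_coeffs_support)
  then have "finite {A. ?c A \<noteq> 0}" using X finite_subset by blast
  then show "?c \<in> poly_coeffs m k" unfolding poly_coeffs_def using sub E by simp
  have "poly_at m k ?c q = (\<Sum>A\<in>E ` X. ?c A * monom_at m k A q)"
    unfolding poly_at_def using X sub by (intro sum.mono_neutral_left) auto
  also have "\<dots> = (\<Sum>A\<in>E ` X. \<Sum>x\<in>{x \<in> X. E x = A}. b x * monom_at m k (E x) q)"
  proof (rule sum.cong[OF refl])
    fix A
    show "?c A * monom_at m k A q = (\<Sum>x\<in>{x \<in> X. E x = A}. b x * monom_at m k (E x) q)"
      unfolding collect_coeffs_def sum_distrib_right by (rule sum.cong) auto
  qed
  also have "\<dots> = (\<Sum>x\<in>X. b x * monom_at m k (E x) q)"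
    by (rule sum.group) (use X in auto)
  finally show "poly_at m k ?c q = (\<Sum>x\<in>X. b x * monom_at m k (E x) q)" .
qed

lemma on_mats_plus: "on_mats m k f + on_mats m k g = on_mats m k (\<lambda>Q. f Q + g Q)"
  by (simp add: on_mats_def fun_eq_iff)

lemma on_mats_times: "on_mats m k f * on_mats m k g = on_mats m k (\<lambda>Q. f Q * g Q)"
  by (simp add: on_mats_def fun_eq_iff)

lemma on_mats_cong:
  "(\<And>Q. Q \<in> carrier_mat m k \<Longrightarrow> f Q = g Q) \<Longrightarrow> on_mats m k f = on_mats m k g"
  by (simp add: on_mats_def fun_eq_iff)

lemma poly_fun_eq_sum:
  assumes "finite X" "E ` X \<subseteq> exponents m k"
  shows "poly_fun m k (collect_coeffs X b E) =
    on_mats m k (\<lambda>Q. \<Sum>x\<in>X. b x * monom_at m k (E x) (\<lambda>r j. Q $$ (r, j)))"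
  unfolding poly_fun_def collect_coeffs(2)[OF assms] ..

lemma poly_at_superset:
  assumes "finite S" "{A. c A \<noteq> 0} \<subseteq> S"
  shows "poly_at m k c q = (\<Sum>A\<in>S. c A * monom_at m k A q)"
  unfolding poly_at_def using assms by (intro sum.mono_neutral_left) auto

lemma coeffs_subset:
  assumes "d \<in> poly_coeffs m k" "{A. c A \<noteq> 0} \<subseteq> {A. d A \<noteq> 0}"
  shows "c \<in> poly_coeffs m k"
proof -
  have "finite {A. d A \<noteq> 0}" "{A. d A \<noteq> 0} \<subseteq> exponents m k" using assms(1) by (simp_all add: poly_coeffs_def)
  then show ?thesis unfolding poly_coeffs_def using assms(2) finite_subset by blast
qed

lemma poly_fun_add:
  assumes c: "c \<in> poly_coeffs m k" and d: "d \<in> poly_coeffs m k"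
  shows "c + d \<in> poly_coeffs m k" "poly_fun m k (c + d) = poly_fun m k c + poly_fun m k d"
proof -
  let ?S = "{A. c A \<noteq> 0} \<union> {A. d A \<noteq> 0}"
  have fin: "finite ?S" and sub: "{A. (c + d) A \<noteq> 0} \<subseteq> ?S"
    using c d by (auto simp: poly_coeffs_def)
  have "?S \<subseteq> exponents m k" using c d by (simp add: poly_coeffs_def)
  then show "c + d \<in> poly_coeffs m k"
    using finite_subset[OF sub fin] sub unfolding poly_coeffs_def by blast
  note superset = poly_at_superset[OF fin]
  have "poly_at m k (c + d) q = poly_at m k c q + poly_at m k d q" for q
    unfolding superset[OF sub] superset[OF Un_upper1] superset[OF Un_upper2]
    by (simp add: distrib_right sum.distrib)
  then show "poly_fun m k (c + d) = poly_fun m k c + poly_fun m k d"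
    unfolding poly_fun_def on_mats_plus by simp
qed

lemma poly_fun_mult:
  assumes c: "c \<in> poly_coeffs m k" and d: "d \<in> poly_coeffs m k"
  defines "X \<equiv> {A. c A \<noteq> 0} \<times> {A. d A \<noteq> 0}"
  defines "e \<equiv> collect_coeffs X (\<lambda>(A, B). c A * d B) (\<lambda>(A, B). A + B)"
  shows "e \<in> poly_coeffs m k" "poly_fun m k e = poly_fun m k c * poly_fun m k d"
proof -
  have fin: "finite X" using c d by (simp add: X_def poly_coeffs_def)
  have exp: "(\<lambda>(A, B). A + B) ` X \<subseteq> exponents m k"
    using c d by (auto simp: X_def poly_coeffs_def subset_iff intro!: exponents_add)
  show "e \<in> poly_coeffs m k" unfolding e_def by (rule collect_coeffs(1)[OF fin exp])
  have "(\<Sum>x\<in>X. (case x of (A, B) \<Rightarrow> c A * d B) * monom_at m k (case x of (A, B) \<Rightarrow> A + B) q)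
     = poly_at m k c q * poly_at m k d q" for q
    unfolding poly_at_def sum_product X_def sum.cartesian_product
    by (rule sum.cong) (auto simp: monom_at_add)
  then show "poly_fun m k e = poly_fun m k c * poly_fun m k d"
    unfolding e_def poly_fun_eq_sum[OF fin exp] unfolding poly_fun_def on_mats_times by simp
qed

lemma poly_fun_single:
  assumes "A \<in> exponents m k"
  shows "\<exists>c\<in>poly_coeffs m k. on_mats m k (\<lambda>Q. b * monom_at m k A (\<lambda>r j. Q $$ (r, j))) = poly_fun m k c"
  using poly_fun_eq_sum[of "{()}" "\<lambda>_. A" m k "\<lambda>_. b"] collect_coeffs(1)[of "{()}" "\<lambda>_. A" m k "\<lambda>_. b"]
    assms by (intro bexI[of _ "collect_coeffs {()} (\<lambda>_. b) (\<lambda>_. A)"]) auto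

lemma polynomial_functions_poly_fun:
  assumes "f \<in> polynomial_functions m k"
  shows "\<exists>c\<in>poly_coeffs m k. f = poly_fun m k c"
  using assms
proof (induction rule: polynomial_functions.induct)
  case (const b)
  then show ?case using poly_fun_single[OF exponents_zero, of m k b] by (simp add: monom_at_zero)
next
  case (coord i j)
  have "unit_exponent i j \<in> exponents m k" using coord by (auto simp: exponents_def unit_exponent_def)
  then show ?case using poly_fun_single[of "unit_exponent i j" m k 1] by (simp add: monom_at_unit coord)
next
  case (add f g)
  then obtain c d where "c \<in> poly_coeffs m k" "f = poly_fun m k c" "d \<in> poly_coeffs m k" "g = poly_fun m k d"
    by blast
  then show ?case using poly_fun_add[of c m k d] by metis
next
  case (mult f g)
  then obtain c d where "c \<in> poly_coeffs m k" "f = poly_fun m k c" "d \<in> poly_coeffs m k" "g = poly_fun m k d"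
    by blast
  then show ?case using poly_fun_mult[of c m k d] by metis
qed

lemma polynomial_functions_sum:
  assumes "\<And>x. x \<in> X \<Longrightarrow> on_mats m k (f x) \<in> polynomial_functions m k"
  shows "on_mats m k (\<lambda>Q. \<Sum>x\<in>X. f x Q) \<in> polynomial_functions m k"
  using assms
proof (induction X rule: infinite_finite_induct)
  case (insert x X)
  then show ?case
    using polynomial_functions.add[of "on_mats m k (f x)" m k "on_mats m k (\<lambda>Q. \<Sum>x\<in>X. f x Q)"]
    by (simp add: on_mats_plus)
qed (auto intro: polynomial_functions.const)

lemma polynomial_functions_prod:
  assumes "\<And>x. x \<in> X \<Longrightarrow> on_mats m k (f x) \<in> polynomial_functions m k"
  shows "on_mats m k (\<lambda>Q. \<Prod>x\<in>X. f x Q) \<in> polynomial_functions m k"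
  using assms
proof (induction X rule: infinite_finite_induct)
  case (insert x X)
  then show ?case
    using polynomial_functions.mult[of "on_mats m k (f x)" m k "on_mats m k (\<lambda>Q. \<Prod>x\<in>X. f x Q)"]
    by (simp add: on_mats_times)
qed (auto intro: polynomial_functions.const)

lemma poly_fun_polynomial: "poly_fun m k c \<in> polynomial_functions m k"
proof -
  have power: "on_mats m k (\<lambda>Q. Q $$ (r, j) ^ a) \<in> polynomial_functions m k"
    if "r < m" "j < k" for r j a
    using polynomial_functions_prod[of "{..<a}" m k "\<lambda>_ Q. Q $$ (r, j)"]
      polynomial_functions.coord[OF that] by simp
  have "on_mats m k (\<lambda>Q. c A * monom_at m k A (\<lambda>r j. Q $$ (r, j))) \<in> polynomial_functions m k" for A
  proof -
    have "on_mats m k (\<lambda>Q. monom_at m k A (\<lambda>r j. Q $$ (r, j))) \<in> polynomial_functions m k"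
      unfolding monom_at_def by (intro polynomial_functions_prod power) auto
    from polynomial_functions.mult[OF polynomial_functions.const this] show ?thesis
      unfolding on_mats_times .
  qed
  then show ?thesis
    unfolding poly_fun_def poly_at_def by (intro polynomial_functions_sum)
qed

lemma poly_fun_mat: "poly_fun m k c (mat m k (\<lambda>(r, j). q r j)) = poly_at m k c q"
  unfolding poly_fun_def on_mats_def poly_at_def monom_at_def
  by (auto intro!: sum.cong prod.cong)

lemma poly_fun_nonzero:
  assumes "c \<in> poly_coeffs m k" "c A \<noteq> 0"
  shows "poly_fun m k c \<noteq> 0"
proof -
  obtain q where "poly_at m k c q \<noteq> 0" using poly_at_nonzero[of c m k A, OF assms] ..
  then have "poly_fun m k c (mat m k (\<lambda>(r, j). q r j)) \<noteq> 0" by (simp add: poly_fun_mat)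
  then show ?thesis by auto
qed

text \<open>
  The leading coefficient is required to be one, which products preserve.
\<close>

definition has_leading :: "nat \<Rightarrow> nat \<Rightarrow> (complex mat \<Rightarrow> complex) \<Rightarrow> (nat \<Rightarrow> nat \<Rightarrow> nat) \<Rightarrow> bool" where
  "has_leading m k f A \<longleftrightarrow> (\<exists>c\<in>poly_coeffs m k. f = poly_fun m k c \<and> leading c A \<and> c A = 1)"

lemma has_leading_sumI:
  assumes X: "finite X" "E ` X \<subseteq> exponents m k" and x0: "x0 \<in> X" "b x0 = 1"
    and less: "\<And>x. x \<in> X \<Longrightarrow> x \<noteq> x0 \<Longrightarrow> lex_less (E x) (E x0)"
    and f: "f = on_mats m k (\<lambda>Q. \<Sum>x\<in>X. b x * monom_at m k (E x) (\<lambda>r j. Q $$ (r, j)))"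
  shows "has_leading m k f (E x0)"
proof -
  let ?c = "collect_coeffs X b E"
  have "x = x0" if "x \<in> X" "E x = E x0" for x
  proof (rule ccontr)
    assume "x \<noteq> x0"
    from less[OF that(1) this] show False unfolding that(2) using lex_less_irrefl by simp
  qed
  then have "{x \<in> X. E x = E x0} = {x0}" using x0(1) by auto
  then have c1: "?c (E x0) = 1" unfolding collect_coeffs_def using x0(2) by simp
  have "A = E x0 \<or> lex_less A (E x0)" if "?c A \<noteq> 0" for A
  proof -
    from collect_coeffs_support[OF that] obtain x where "A = E x" "x \<in> X" by (rule imageE)
    then show ?thesis using less by (cases "x = x0") simp_all
  qed
  then have "leading ?c (E x0)" unfolding leading_def using c1 by simp
  then show ?thesis
    unfolding has_leading_def f poly_fun_eq_sum[OF X, symmetric]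
    by (intro bexI[of _ ?c] conjI refl c1 collect_coeffs(1)[OF X])
qed

lemma has_leading_mult:
  assumes "has_leading m k f A" "has_leading m k g B"
  shows "has_leading m k (f * g) (A + B)"
proof -
  obtain c where c: "c \<in> poly_coeffs m k" "f = poly_fun m k c" "leading c A" "c A = 1"
    using assms(1) by (auto simp: has_leading_def)
  obtain d where d: "d \<in> poly_coeffs m k" "g = poly_fun m k d" "leading d B" "d B = 1"
    using assms(2) by (auto simp: has_leading_def)
  let ?X = "{A. c A \<noteq> 0} \<times> {B. d B \<noteq> 0}"
  have "has_leading m k (f * g) ((\<lambda>(A, B). A + B) (A, B))"
  proof (rule has_leading_sumI)
    show "finite ?X" using c d by (simp add: poly_coeffs_def)
    show "(\<lambda>(A, B). A + B) ` ?X \<subseteq> exponents m k"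
      using c d by (auto simp: poly_coeffs_def subset_iff intro!: exponents_add)
    show "(A, B) \<in> ?X" using c d by simp
    show "(\<lambda>(A, B). c A * d B) (A, B) = 1" using c d by simp
    show "f * g = on_mats m k (\<lambda>Q. \<Sum>x\<in>?X. (case x of (A, B) \<Rightarrow> c A * d B) *
        monom_at m k (case x of (A, B) \<Rightarrow> A + B) (\<lambda>r j. Q $$ (r, j)))"
      unfolding c(2) d(2) poly_fun_def on_mats_times poly_at_def sum_product sum.cartesian_product
      by (intro on_mats_cong sum.cong) (auto simp: monom_at_add)
    show "lex_less (case x of (A, B) \<Rightarrow> A + B) (case (A, B) of (A, B) \<Rightarrow> A + B)"
      if "x \<in> ?X" "x \<noteq> (A, B)" for x
    proof -
      obtain A' B' where x: "x = (A', B')" by (cases x)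
      have A': "A' = A \<or> lex_less A' A" and B': "B' = B \<or> lex_less B' B"
        using that(1) c(3) d(3) by (auto simp: x leading_def)
      show ?thesis
      proof (cases "A' = A")
        case True
        then have "lex_less B' B" using B' that(2) x by auto
        then show ?thesis using True by (simp add: x lex_less_add_left)
      next
        case False
        then have "lex_less (A' + B') (A + B')" using A' lex_less_add_right by blast
        moreover have "A + B' = A + B \<or> lex_less (A + B') (A + B)" using B' lex_less_add_left by blast
        ultimately show ?thesis using lex_less_trans by (auto simp: x)
      qed
    qed
  qed
  then show ?thesis by simp
qed

lemma has_leading_one: "has_leading m k (mat_one m k) 0"
proof -
  have "has_leading m k (mat_one m k) ((\<lambda>_. 0) ())"
    by (rule has_leading_sumI[where X = "{()}" and b = "\<lambda>_. 1"])
      (auto simp: mat_one_def monom_at_def exponents_def)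
  then show ?thesis by simp
qed

section \<open>Leading exponents of standard monomials\<close>

lemma minor_conv:
  assumes Q: "Q \<in> carrier_mat m k" and I: "I \<subseteq> {..<m}" "card I \<le> k"
  shows "minor I Q = det (mat (card I) (card I) (\<lambda>(a, b). Q $$ (pick I a, b)))"
proof -
  have "{i. i < m \<and> i \<in> I} = I" "{j. j < k \<and> j \<in> {..<card I}} = {..<card I}" using I by auto
  moreover have "pick {..<card I} b = b" if "b < card I" for b
    using pick_image_strict_mono[of "card I" "\<lambda>x. x" b] that by simp
  ultimately have "submatrix Q I {..<card I} = mat (card I) (card I) (\<lambda>(a, b). Q $$ (pick I a, b))"
    using Q unfolding submatrix_def by (intro eq_matI) auto
  then show ?thesis by (simp add: minor_def)
qed

definition permutation_exponent :: "nat set \<Rightarrow> (nat \<Rightarrow> nat) \<Rightarrow> nat \<Rightarrow> nat \<Rightarrow> nat" where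
  "permutation_exponent I p = (\<lambda>r j. \<Sum>a<card I. unit_exponent (pick I a) (p a) r j)"

lemma monom_at_sum:
  fixes h :: nat
  shows "monom_at m k (\<lambda>r j. \<Sum>a<h. E a r j) q = (\<Prod>a<h. monom_at m k (E a) q)"
  by (induction h) (simp_all add: monom_at_def power_add prod.distrib)

lemma minor_leibniz:
  assumes Q: "Q \<in> carrier_mat m k" and I: "I \<subseteq> {..<m}" "card I \<le> k"
  shows "minor I Q = (\<Sum>p\<in>{p. p permutes {0..<card I}}.
     signof p * monom_at m k (permutation_exponent I p) (\<lambda>r j. Q $$ (r, j)))"
proof -
  let ?M = "mat (card I) (card I) (\<lambda>(a, b). Q $$ (pick I a, b))"
  have "det ?M = (\<Sum>p\<in>{p. p permutes {0..<card I}}. signof p * (\<Prod>a = 0..<card I. ?M $$ (a, p a)))"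
    by (rule det_def') simp
  also have "\<dots> = (\<Sum>p\<in>{p. p permutes {0..<card I}}.
     signof p * monom_at m k (permutation_exponent I p) (\<lambda>r j. Q $$ (r, j)))"
  proof (rule sum.cong[OF refl])
    fix p assume "p \<in> {p. p permutes {0..<card I}}"
    then have p: "p a < card I" if "a < card I" for a
      using that permutes_in_image[of p "{0..<card I}" a] by simp
    have "monom_at m k (permutation_exponent I p) (\<lambda>r j. Q $$ (r, j)) =
        (\<Prod>a<card I. monom_at m k (unit_exponent (pick I a) (p a)) (\<lambda>r j. Q $$ (r, j)))"
      unfolding permutation_exponent_def by (rule monom_at_sum)
    also have "\<dots> = (\<Prod>a = 0..<card I. ?M $$ (a, p a))"
    proof (rule prod.cong)
      fix a assume "a \<in> {0..<card I}"
      then have a: "a < card I" by simp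
      have "pick I a < m" using pick_in_set_le[OF a] I by auto
      moreover have "p a < k" using p[OF a] I by simp
      ultimately show "monom_at m k (unit_exponent (pick I a) (p a)) (\<lambda>r j. Q $$ (r, j)) = ?M $$ (a, p a)"
        using a p[OF a] by (simp add: monom_at_unit)
    qed auto
    finally show "signof p * (\<Prod>a = 0..<card I. ?M $$ (a, p a)) =
      signof p * monom_at m k (permutation_exponent I p) (\<lambda>r j. Q $$ (r, j))" by simp
  qed
  finally show ?thesis using minor_conv[OF assms] by simp
qed

lemma permutation_exponent_id: "permutation_exponent I id = column_exponent I"
proof (intro ext)
  fix r j
  have "permutation_exponent I id r j = (\<Sum>a<card I. if a = j then (if pick I a = r then 1 else 0) else 0)"
    unfolding permutation_exponent_def unit_exponent_def by (rule sum.cong) auto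
  also have "\<dots> = column_exponent I r j" by (simp add: sum.delta column_exponent_def)
  finally show "permutation_exponent I id r j = column_exponent I r j" .
qed

text \<open>
  The comparison is decided by the largest index \<open>a\<close> that \<open>p\<close> moves: \<open>p a < a\<close>, so in the row
  \<open>pick I a\<close> the diagonal term has its variable further to the right, and in all later rows both
  terms agree.
\<close>

lemma permutation_exponent_less:
  assumes p: "p permutes {0..<card I}" and "p \<noteq> id"
  shows "lex_less (permutation_exponent I p) (permutation_exponent I id)"
proof -
  let ?h = "card I"
  let ?S = "{a. a < ?h \<and> p a \<noteq> a}"
  have inj: "p a = p b \<Longrightarrow> a = b" for a b using permutes_inj[OF p] by (auto dest: injD)
  have fin: "finite ?S" by simp
  have "?S \<noteq> {}"
  proof
    assume "?S = {}"
    then have "p a = a" for a using permutes_not_in[OF p, of a] by (cases "a < ?h") auto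
    then show False using \<open>p \<noteq> id\<close> by auto
  qed
  define a where "a = Max ?S"
  have a: "a < ?h" "p a \<noteq> a" using Max_in[OF fin \<open>?S \<noteq> {}\<close>] by (auto simp: a_def)
  have above: "p b = b" if "a < b" for b
  proof (cases "b < ?h")
    case True
    show ?thesis
    proof (rule ccontr)
      assume "p b \<noteq> b"
      then have "b \<le> Max ?S" using True by (intro Max_ge fin) simp
      then show False using that by (simp add: a_def)
    qed
  next
    case False
    then show ?thesis using permutes_not_in[OF p] by simp
  qed
  have pa: "p a < a"
  proof (rule ccontr)
    assume "\<not> p a < a"
    then have "a < p a" using a by simp
    then have "p (p a) = p a" by (rule above)
    then show False using inj a by blast
  qed
  have pick_less: "pick I b < pick I c" if "b < c" "c < ?h" for b c
    using pick_mono_le that by blast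
  have pick_inj: "b = c" if "pick I b = pick I c" "b < ?h" "c < ?h" for b c
    using pick_less[of b c] pick_less[of c b] that by (metis less_irrefl linorder_neqE_nat)
  have at: "permutation_exponent I s (pick I a) j = (if s a = j then 1 else 0)" for s j
  proof -
    have "permutation_exponent I s (pick I a) j = (\<Sum>b<?h. if b = a then (if s b = j then 1 else 0) else 0)"
      unfolding permutation_exponent_def
    proof (rule sum.cong[OF refl])
      fix b assume "b \<in> {..<?h}"
      then have "pick I a = pick I b \<longleftrightarrow> b = a" using pick_inj[of b a] a(1) by auto
      then show "unit_exponent (pick I b) (s b) (pick I a) j = (if b = a then (if s b = j then 1 else 0) else 0)"
        by (auto simp: unit_exponent_def)
    qed
    then show ?thesis using a(1) by (simp add: sum.delta)
  qed
  show ?thesis unfolding lex_less_def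
  proof (rule exI[of _ "pick I a"], rule exI[of _ a], intro conjI allI impI)
    show "permutation_exponent I p (pick I a) a < permutation_exponent I id (pick I a) a"
      unfolding at using a by simp
    show "permutation_exponent I p (pick I a) j = permutation_exponent I id (pick I a) j" if "a < j" for j
      unfolding at using pa that by simp
    show "permutation_exponent I p r = permutation_exponent I id r" if "pick I a < r" for r
    proof
      fix j
      show "permutation_exponent I p r j = permutation_exponent I id r j"
        unfolding permutation_exponent_def
      proof (rule sum.cong[OF refl])
        fix b assume "b \<in> {..<?h}"
        then have b: "b < ?h" by simp
        show "unit_exponent (pick I b) (p b) r j = unit_exponent (pick I b) (id b) r j"
        proof (cases "pick I b = r")
          case True
          then have "a < b" using pick_less[of b a] a(1) that by (metis less_asym' linorder_neqE_nat)
          then show ?thesis using above by simp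
        next
          case False
          then show ?thesis by (simp add: unit_exponent_def)
        qed
      qed
    qed
  qed
qed

lemma has_leading_minor:
  assumes I: "I \<subseteq> {..<m}" "card I \<le> k"
  shows "has_leading m k (on_mats m k (minor I)) (column_exponent I)"
proof -
  have "has_leading m k (on_mats m k (minor I)) (permutation_exponent I id)"
  proof (rule has_leading_sumI[where X = "{p. p permutes {0..<card I}}" and b = signof and
        E = "permutation_exponent I" and ?x0.0 = id])
    show "finite {p. p permutes {0..<card I}}" by (simp add: finite_permutations)
    show "permutation_exponent I ` {p. p permutes {0..<card I}} \<subseteq> exponents m k"
    proof (intro image_subsetI)
      fix p assume "p \<in> {p. p permutes {0..<card I}}"
      then have p: "p a < card I" if "a < card I" for a
        using that permutes_in_image[of p "{0..<card I}" a] by simp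
      have "unit_exponent (pick I a) (p a) r j = 0"
        if a: "a < card I" and rj: "\<not> (r < m \<and> j < k)" for a r j
      proof -
        have "pick I a < m" "p a < k" using pick_in_set_le[OF a] p[OF a] I by auto
        then show ?thesis using rj by (auto simp: unit_exponent_def)
      qed
      then show "permutation_exponent I p \<in> exponents m k"
        by (simp add: exponents_def permutation_exponent_def)
    qed
    show "id \<in> {p. p permutes {0..<card I}}" by (simp add: permutes_id)
    show "signof id = (1::complex)" by (simp add: sign_id)
    show "lex_less (permutation_exponent I p) (permutation_exponent I id)"
      if "p \<in> {p. p permutes {0..<card I}}" "p \<noteq> id" for p
      using permutation_exponent_less[of p I] that by simp
    show "on_mats m k (minor I) = on_mats m k (\<lambda>Q. \<Sum>p\<in>{p. p permutes {0..<card I}}.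
        signof p * monom_at m k (permutation_exponent I p) (\<lambda>r j. Q $$ (r, j)))"
      by (rule on_mats_cong) (rule minor_leibniz[OF _ I])
  qed
  then show ?thesis unfolding permutation_exponent_id .
qed

lemma standard_monomial_simps:
  "standard_monomial m k [] = mat_one m k"
  "standard_monomial m k (I # t) = on_mats m k (minor I) * standard_monomial m k t"
  by (simp_all add: standard_monomial_def mat_one_def on_mats_times)

lemma has_leading_standard_monomial:
  assumes "\<forall>I\<in>set t. I \<subseteq> {..<m} \<and> card I \<le> k"
  shows "has_leading m k (standard_monomial m k t) (tableau_exponent t)"
  using assms
proof (induction t)
  case Nil
  show ?case unfolding standard_monomial_simps tableau_exponent_simps by (rule has_leading_one)
next
  case (Cons I t)
  then show ?case
    unfolding standard_monomial_simps tableau_exponent_simps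
    by (intro has_leading_mult has_leading_minor) auto
qed

section \<open>The group action in coordinates\<close>

text \<open>
  Inverses are given by Gauss-Jordan elimination, which succeeds for units of the matrix
  ring.
\<close>

lemma GL_inverse:
  assumes "g \<in> GL r"
  shows "GL_inv g \<in> carrier_mat r r" "g * GL_inv g = 1\<^sub>m r" "GL_inv g * g = 1\<^sub>m r"
proof -
  have g: "g \<in> carrier_mat r r" and inv: "invertible_mat g" using assms by (auto simp: GL_def)
  obtain B where B: "inverts_mat g B" "inverts_mat B g"
    using inv by (auto simp: invertible_mat_def)
  have gB: "g * B = 1\<^sub>m r" using B(1) g by (simp add: inverts_mat_def)
  have "dim_col (g * B) = r" using gB by simp
  then have dc: "dim_col B = r" by simp
  have "dim_col (B * g) = r" using g by simp
  then have dr: "dim_row B = r" using B(2) g by (metis carrier_matD(2) index_one_mat(3) inverts_mat_def)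
  have Bc: "B \<in> carrier_mat r r" using dc dr by auto
  have Bg: "B * g = 1\<^sub>m r" using B(2) dr by (simp add: inverts_mat_def)
  have "g \<in> Units (ring_mat TYPE(complex) r undefined)"
    using g Bc gB Bg by (auto simp: Units_def ring_mat_def)
  then obtain C where C: "mat_inverse g = Some C"
    using mat_inverse(1)[OF g, of undefined] by (cases "mat_inverse g") auto
  then show "GL_inv g \<in> carrier_mat r r" "g * GL_inv g = 1\<^sub>m r" "GL_inv g * g = 1\<^sub>m r"
    using mat_inverse(2)[OF g C] by (simp_all add: GL_inv_def)
qed

lemma GL_I:
  assumes "g \<in> carrier_mat r r" "B \<in> carrier_mat r r" "g * B = 1\<^sub>m r" "B * g = 1\<^sub>m r"
  shows "g \<in> GL r"
  using assms unfolding GL_def invertible_mat_def inverts_mat_def by auto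

lemma GL_inv_eqI:
  assumes g: "g \<in> carrier_mat r r" and B: "B \<in> carrier_mat r r" and "g * B = 1\<^sub>m r" "B * g = 1\<^sub>m r"
  shows "GL_inv g = B"
proof -
  note inv = GL_inverse[OF GL_I[OF assms]]
  have "GL_inv g = (B * g) * GL_inv g" using assms inv by simp
  also have "\<dots> = B * (g * GL_inv g)" by (rule assoc_mult_mat[OF B g inv(1)])
  also have "\<dots> = B" using B inv by simp
  finally show ?thesis .
qed

lemma fun_act_eq:
  assumes g: "g \<in> GL m" and h: "h \<in> GL k"
  shows "fun_act m k g h f = on_mats m k (\<lambda>Q. f (transpose_mat g * Q * h))"
proof -
  note gi = GL_inverse[OF g] and hi = GL_inverse[OF h]
  have gc: "g \<in> carrier_mat m m" and hc: "h \<in> carrier_mat k k" using g h by (auto simp: GL_def)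
  have "GL_inv (GL_inv h) = h" by (rule GL_inv_eqI[OF hi(1) hc hi(3,2)])
  moreover have "GL_inv (transpose_mat (GL_inv g)) = transpose_mat g"
  proof (rule GL_inv_eqI)
    show "transpose_mat (GL_inv g) * transpose_mat g = 1\<^sub>m m"
      using transpose_mult[OF gc gi(1)] gi(2) by simp
    show "transpose_mat g * transpose_mat (GL_inv g) = 1\<^sub>m m"
      using transpose_mult[OF gi(1) gc] gi(3) by simp
  qed (use gi gc in auto)
  ultimately show ?thesis by (simp add: fun_act_def mat_act_def)
qed

lemma GL_one: "1\<^sub>m r \<in> GL r"
  by (rule GL_I[of _ _ "1\<^sub>m r"]) auto

lemma GL_embed_carrier: "n \<le> m \<Longrightarrow> X \<in> carrier_mat n n \<Longrightarrow> GL_embed m n X \<in> carrier_mat m m"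
  unfolding GL_embed_def
  using four_block_carrier_mat[of X n n "1\<^sub>m (m - n)" "m - n" "m - n"] by simp

lemma GL_embed_index:
  assumes "n \<le> m" "X \<in> carrier_mat n n" "i < m" "j < m"
  shows "GL_embed m n X $$ (i, j) =
    (if i < n \<and> j < n then X $$ (i, j) else if i = j then 1 else 0)"
proof -
  have "dim_row X = n" "dim_col X = n" using assms(2) by auto
  then show ?thesis unfolding GL_embed_def using assms(1,3,4) by (simp add: index_mat_four_block) linarith
qed

lemma GL_embed_one: "n \<le> m \<Longrightarrow> GL_embed m n (1\<^sub>m n) = 1\<^sub>m m"
  by (rule eq_matI) (auto simp: GL_embed_index GL_embed_carrier[THEN carrier_matD(1)]
      GL_embed_carrier[THEN carrier_matD(2)])

lemma GL_embed_mult: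
  assumes "n \<le> m" "X \<in> carrier_mat n n" "Y \<in> carrier_mat n n"
  shows "GL_embed m n X * GL_embed m n Y = GL_embed m n (X * Y)"
  unfolding GL_embed_def
  by (subst mult_four_block_mat[OF assms(2) _ _ _ assms(3)]) (use assms in auto)

lemma GL_embed_GL:
  assumes "n \<le> m" "g \<in> GL n"
  shows "GL_embed m n g \<in> GL m"
proof -
  note gi = GL_inverse[OF assms(2)]
  have g: "g \<in> carrier_mat n n" using assms(2) by (simp add: GL_def)
  show ?thesis
    by (rule GL_I[of _ _ "GL_embed m n (GL_inv g)"])
      (simp_all add: GL_embed_mult[OF assms(1)] GL_embed_carrier[OF assms(1)] GL_embed_one[OF assms(1)] gi g)
qed

lemma GL_upper_triangularI:
  assumes "g \<in> carrier_mat r r" "upper_triangular g" "\<And>i. i < r \<Longrightarrow> g $$ (i, i) \<noteq> 0"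
  shows "g \<in> GL r"
proof -
  have "0 \<notin> set (diag_mat g)" using assms by (auto simp: diag_mat_def)
  then have "det g \<noteq> 0" using upper_triangular_imp_det_eq_0_iff[OF assms(1,2)] by simp
  then have "g \<in> Units (ring_mat TYPE(complex) r undefined)" by (rule det_non_zero_imp_unit[OF assms(1)])
  then obtain B where "B \<in> carrier_mat r r" "g * B = 1\<^sub>m r" "B * g = 1\<^sub>m r"
    by (auto simp: Units_def ring_mat_def)
  then show ?thesis using assms(1) by (blast intro: GL_I)
qed

lemma act_mat:
  assumes "G \<in> carrier_mat m m" "H \<in> carrier_mat k k"
  shows "transpose_mat G * mat m k (\<lambda>(r, j). q r j) * H =
    mat m k (\<lambda>(r, j). \<Sum>y<k. (\<Sum>x<m. G $$ (x, r) * q x y) * H $$ (y, j))"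
  using assms
  by (intro eq_matI) (auto simp: scalar_prod_def atLeast0LessThan intro!: sum.cong)

definition of_array :: "nat \<Rightarrow> nat \<Rightarrow> (nat \<Rightarrow> nat \<Rightarrow> complex) \<Rightarrow> complex mat" where
  "of_array m k q = mat m k (\<lambda>(r, j). q r j)"

lemma of_array_carrier: "of_array m k q \<in> carrier_mat m k"
  by (simp add: of_array_def)

lemma of_array_cong:
  "(\<And>r j. r < m \<Longrightarrow> j < k \<Longrightarrow> q r j = q' r j) \<Longrightarrow> of_array m k q = of_array m k q'"
  unfolding of_array_def by (rule eq_matI) auto

lemma of_array_entries: "Q \<in> carrier_mat m k \<Longrightarrow> of_array m k (\<lambda>r j. Q $$ (r, j)) = Q"
  by (rule eq_matI) (auto simp: of_array_def)

lemma fun_act_of_array: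
  assumes g: "g \<in> GL n" and h: "h \<in> GL k" and "n \<le> m"
  shows "fun_act m k (GL_embed m n g) h f (of_array m k q) =
    f (of_array m k (\<lambda>r j. \<Sum>y<k. (\<Sum>x<m. GL_embed m n g $$ (x, r) * q x y) * h $$ (y, j)))"
proof -
  have "GL_embed m n g \<in> carrier_mat m m" "h \<in> carrier_mat k k"
    using GL_embed_GL[OF \<open>n \<le> m\<close> g] h by (auto simp: GL_def)
  from act_mat[OF this] show ?thesis
    by (simp add: fun_act_eq[OF GL_embed_GL[OF \<open>n \<le> m\<close> g] h] on_mats_def of_array_def)
qed

text \<open>
  Right multiplication by this matrix adds \<open>t\<close> times column \<open>j\<close> to the next one; embedded in the
  left factor and transposed, it acts on rows in the same way.
\<close>

definition elementary :: "nat \<Rightarrow> nat \<Rightarrow> complex \<Rightarrow> complex mat" where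
  "elementary r j t = mat r r (\<lambda>(a, b). if a = b then 1 else if a = j \<and> b = Suc j then t else 0)"

lemma elementary_unipotent: "elementary r j t \<in> unipotent r"
proof -
  have ut: "upper_triangular (elementary r j t)" by (auto simp: elementary_def upper_triangular_def)
  have "elementary r j t \<in> GL r"
    by (rule GL_upper_triangularI[OF _ ut]) (auto simp: elementary_def)
  then show ?thesis unfolding unipotent_def using ut by (simp add: elementary_def)
qed

definition diagonal :: "nat \<Rightarrow> (nat \<Rightarrow> complex) \<Rightarrow> complex mat" where
  "diagonal r z = mat r r (\<lambda>(a, b). if a = b then z a else 0)"

lemma diagonal_torus: "(\<And>i. i < r \<Longrightarrow> z i \<noteq> 0) \<Longrightarrow> diagonal r z \<in> torus r"
proof -
  assume z: "\<And>i. i < r \<Longrightarrow> z i \<noteq> 0"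
  have "upper_triangular (diagonal r z)" by (auto simp: diagonal_def upper_triangular_def)
  then have "diagonal r z \<in> GL r"
    by (rule GL_upper_triangularI[rotated]) (use z in \<open>auto simp: diagonal_def\<close>)
  then show ?thesis by (auto simp: torus_def diagonal_mat_def diagonal_def)
qed

lemma weight_diagonal: "weight r F (diagonal r z) = (\<Prod>i<r. z i ^ F i)"
  unfolding weight_def by (rule prod.cong) (auto simp: diagonal_def)

lemma fun_act_col_shear:
  assumes j: "Suc j < k"
  shows "fun_act m k (1\<^sub>m m) (elementary k j t) f (of_array m k q) = f (of_array m k (col_shear j t q))"
proof -
  have E: "elementary k j t \<in> GL k" using elementary_unipotent by (auto simp: unipotent_def)
  have Ec: "elementary k j t \<in> carrier_mat k k" by (simp add: elementary_def)
  have "(\<Sum>y<k. (\<Sum>x<m. 1\<^sub>m m $$ (x, r) * q x y) * elementary k j t $$ (y, c)) = col_shear j t q r c"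
    if rc: "r < m" "c < k" for r c
  proof -
    have "(\<Sum>x<m. 1\<^sub>m m $$ (x, r) * q x y) = q r y" for y
    proof -
      have "(\<Sum>x<m. 1\<^sub>m m $$ (x, r) * q x y) = (\<Sum>x<m. if x = r then q r y else 0)"
        by (rule sum.cong) (use rc in auto)
      then show ?thesis using rc by (simp add: sum.delta)
    qed
    then have "(\<Sum>y<k. (\<Sum>x<m. 1\<^sub>m m $$ (x, r) * q x y) * elementary k j t $$ (y, c)) =
        (\<Sum>y<k. (if y = c then q r c else 0) + (if y = j then (if c = Suc j then t * q r j else 0) else 0))"
      by (intro sum.cong) (use rc in \<open>auto simp: elementary_def\<close>)
    then show ?thesis using rc j by (simp add: sum.distrib sum.delta col_shear_def)
  qed
  then have "of_array m k (\<lambda>r c. \<Sum>y<k. (\<Sum>x<m. 1\<^sub>m m $$ (x, r) * q x y) * elementary k j t $$ (y, c)) =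
      of_array m k (col_shear j t q)" by (rule of_array_cong)
  then show ?thesis
    unfolding fun_act_eq[OF GL_one E] on_mats_def
    using act_mat[OF one_carrier_mat Ec, of m q] of_array_carrier[of m k q]
    by (simp only: of_array_def if_True)
qed

lemma fun_act_row_shear:
  assumes i: "Suc i < n" and "n \<le> m"
  shows "fun_act m k (GL_embed m n (elementary n i t)) (1\<^sub>m k) f (of_array m k q) =
    f (of_array m k (row_shear i t q))"
proof -
  let ?G = "GL_embed m n (elementary n i t)"
  have E: "elementary n i t \<in> GL n" using elementary_unipotent by (auto simp: unipotent_def)
  have Ec: "elementary n i t \<in> carrier_mat n n" by (simp add: elementary_def)
  have G: "?G $$ (x, r) = (if x = r then 1 else if x = i \<and> r = Suc i then t else 0)"
    if "x < m" "r < m" for x r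
    unfolding GL_embed_index[OF \<open>n \<le> m\<close> Ec that] using i by (auto simp: elementary_def)
  have "(\<Sum>y<k. (\<Sum>x<m. ?G $$ (x, r) * q x y) * 1\<^sub>m k $$ (y, c)) = row_shear i t q r c"
    if rc: "r < m" "c < k" for r c
  proof -
    have "(\<Sum>y<k. (\<Sum>x<m. ?G $$ (x, r) * q x y) * 1\<^sub>m k $$ (y, c)) =
        (\<Sum>y<k. if y = c then (\<Sum>x<m. ?G $$ (x, r) * q x c) else 0)"
      by (rule sum.cong) (use rc in auto)
    also have "\<dots> = (\<Sum>x<m. ?G $$ (x, r) * q x c)" using rc by (simp add: sum.delta)
    also have "\<dots> = (\<Sum>x<m. (if x = r then q r c else 0) +
        (if x = i then (if r = Suc i then t * q i c else 0) else 0))"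
      by (rule sum.cong) (use rc G in auto)
    finally show ?thesis using rc i \<open>n \<le> m\<close> by (simp add: sum.distrib sum.delta row_shear_def)
  qed
  then show ?thesis
    unfolding fun_act_of_array[OF E GL_one \<open>n \<le> m\<close>]
    by (intro arg_cong[of _ _ f] of_array_cong)
qed

definition scale_array ::
  "nat \<Rightarrow> (nat \<Rightarrow> complex) \<Rightarrow> (nat \<Rightarrow> complex) \<Rightarrow> (nat \<Rightarrow> nat \<Rightarrow> complex) \<Rightarrow> nat \<Rightarrow> nat \<Rightarrow> complex" where
  "scale_array n w z q = (\<lambda>r j. (if r < n then w r else 1) * q r j * z j)"

lemma fun_act_scale:
  assumes w: "\<And>i. i < n \<Longrightarrow> w i \<noteq> 0" and z: "\<And>j. j < k \<Longrightarrow> z j \<noteq> 0" and "n \<le> m"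
  shows "fun_act m k (GL_embed m n (diagonal n w)) (diagonal k z) f (of_array m k q) =
    f (of_array m k (scale_array n w z q))"
proof -
  let ?G = "GL_embed m n (diagonal n w)"
  have D: "diagonal n w \<in> GL n" "diagonal k z \<in> GL k"
    using diagonal_torus[of n w] diagonal_torus[of k z] w z by (auto simp: torus_def)
  have Dc: "diagonal n w \<in> carrier_mat n n" by (simp add: diagonal_def)
  have G: "?G $$ (x, r) = (if x = r then if r < n then w r else 1 else 0)"
    if "x < m" "r < m" for x r
    unfolding GL_embed_index[OF \<open>n \<le> m\<close> Dc that] by (auto simp: diagonal_def)
  have "(\<Sum>y<k. (\<Sum>x<m. ?G $$ (x, r) * q x y) * diagonal k z $$ (y, c)) = scale_array n w z q r c"
    if rc: "r < m" "c < k" for r c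
  proof -
    have "(\<Sum>y<k. (\<Sum>x<m. ?G $$ (x, r) * q x y) * diagonal k z $$ (y, c)) =
        (\<Sum>y<k. if y = c then (\<Sum>x<m. ?G $$ (x, r) * q x c) * z c else 0)"
      by (rule sum.cong) (use rc in \<open>auto simp: diagonal_def\<close>)
    also have "\<dots> = (\<Sum>x<m. ?G $$ (x, r) * q x c) * z c" using rc by (simp add: sum.delta)
    also have "(\<Sum>x<m. ?G $$ (x, r) * q x c) = (\<Sum>x<m. if x = r then (if r < n then w r else 1) * q r c else 0)"
      by (rule sum.cong) (use rc G in auto)
    finally show ?thesis using rc by (simp add: sum.delta scale_array_def)
  qed
  then show ?thesis
    unfolding fun_act_of_array[OF D \<open>n \<le> m\<close>]
    by (intro arg_cong[of _ _ f] of_array_cong)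
qed

section \<open>Standard monomials are weight vectors\<close>

lemma column_sets_initial:
  assumes "I \<in> column_sets m n" "i \<in> I" "i < n" "x < i"
  shows "x \<in> I"
  using assms unfolding column_sets_def by auto

lemma det_lower_triangular_prod:
  assumes "A \<in> carrier_mat r r" "\<And>i j. i < j \<Longrightarrow> j < r \<Longrightarrow> A $$ (i, j) = 0"
  shows "det A = (\<Prod>i<r. A $$ (i, i))"
  using det_lower_triangular[OF assms(2,1)] assms(1)
  by (simp add: diag_mat_def prod.list_conv_set_nth atLeast0LessThan)

lemma det_upper_triangular_prod:
  assumes "A \<in> carrier_mat r r" "upper_triangular A"
  shows "det A = (\<Prod>i<r. A $$ (i, i))"
  using det_upper_triangular[OF assms(2,1)] assms(1)
  by (simp add: diag_mat_def prod.list_conv_set_nth atLeast0LessThan)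

lemma bij_betw_pick:
  assumes "finite I"
  shows "bij_betw (pick I) {..<card I} I"
proof -
  have "inj_on (pick I) {..<card I}"
    by (rule linorder_inj_onI') (use pick_mono_le in force)
  then show ?thesis using pick_image[OF assms] by (simp add: bij_betw_def)
qed

text \<open>
  The rows of the transposed left factor that belong to \<open>I\<close> are supported on columns in \<open>I\<close>, because the
  entries of \<open>I\<close> below \<open>n\<close> form an initial segment; the first \<open>r\<close> columns of an upper triangular right
  factor are supported on the first \<open>r\<close> rows.  So the submatrix of the product is a product of submatrices, the
  outer ones triangular.
\<close>

lemma minor_semi_invariant:
  assumes "n \<le> m" and I: "I \<in> column_sets m n" "card I \<le> k"
    and g: "g \<in> carrier_mat n n" "upper_triangular g"
    and h: "h \<in> carrier_mat k k" "upper_triangular h"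
    and Q: "Q \<in> carrier_mat m k"
  shows "minor I (transpose_mat (GL_embed m n g) * Q * h) =
    (\<Prod>i<n. if i \<in> I then g $$ (i, i) else 1) * (\<Prod>j<k. if j < card I then h $$ (j, j) else 1) *
    minor I Q"
proof -
  let ?G = "GL_embed m n g" and ?r = "card I"
  let ?GI = "mat ?r ?r (\<lambda>(a, c). ?G $$ (pick I c, pick I a))"
  let ?QI = "mat ?r ?r (\<lambda>(a, b). Q $$ (pick I a, b))"
  let ?HI = "mat ?r ?r (\<lambda>(y, b). h $$ (y, b))"
  note Im = column_setsD[OF I(1) \<open>n \<le> m\<close>]
  have G: "?G \<in> carrier_mat m m" using GL_embed_carrier[OF \<open>n \<le> m\<close> g(1)] .
  note Gi = GL_embed_index[OF \<open>n \<le> m\<close> g(1)]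
  have hz: "h $$ (y, b) = 0" if "b < y" "y < k" for y b
    using upper_triangularD[OF h(2) that(1)] that(2) h(1) by simp
  have gz: "g $$ (y, b) = 0" if "b < y" "y < n" for y b
    using upper_triangularD[OF g(2) that(1)] that(2) g(1) by simp
  have pickI: "pick I a \<in> I" "pick I a < m" if "a < ?r" for a
    using pick_in_set_le[OF that] Im(1) by auto
  have Gz: "?G $$ (x, i) = 0" if "i \<in> I" "x \<notin> I" "x < m" for x i
  proof -
    have "i < m" using that(1) Im(1) by auto
    have "x \<noteq> i" using that by auto
    moreover have "i < x" if "i < n"
      using column_sets_initial[OF I(1) \<open>i \<in> I\<close> that, of x] \<open>x \<notin> I\<close> \<open>x \<noteq> i\<close>
      by (cases "x < i") auto
    ultimately show ?thesis
      unfolding Gi[OF \<open>x < m\<close> \<open>i < m\<close>] using gz by auto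
  qed
  have prod: "transpose_mat ?G * Q * h \<in> carrier_mat m k" using G Q h by auto
  have entry: "(transpose_mat ?G * Q * h) $$ (i, b) =
      (\<Sum>y<k. (\<Sum>x<m. ?G $$ (x, i) * Q $$ (x, y)) * h $$ (y, b))" if "i < m" "b < k" for i b
  proof -
    have "Q = mat m k (\<lambda>(r, j). Q $$ (r, j))" using Q by (intro eq_matI) auto
    then have "transpose_mat ?G * Q * h = transpose_mat ?G * mat m k (\<lambda>(r, j). Q $$ (r, j)) * h"
      by simp
    then show ?thesis unfolding act_mat[OF G h(1), of "\<lambda>r j. Q $$ (r, j)"] using that by simp
  qed
  have "mat ?r ?r (\<lambda>(a, b). (transpose_mat ?G * Q * h) $$ (pick I a, b)) = ?GI * ?QI * ?HI"
  proof (rule eq_matI)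
    fix a b assume "a < dim_row (?GI * ?QI * ?HI)" "b < dim_col (?GI * ?QI * ?HI)"
    then have ab: "a < ?r" "b < ?r" by simp_all
    have "(transpose_mat ?G * Q * h) $$ (pick I a, b) =
        (\<Sum>y<k. (\<Sum>x<m. ?G $$ (x, pick I a) * Q $$ (x, y)) * h $$ (y, b))"
      by (rule entry) (use pickI[OF ab(1)] ab I in auto)
    also have "\<dots> = (\<Sum>y<?r. (\<Sum>x<m. ?G $$ (x, pick I a) * Q $$ (x, y)) * h $$ (y, b))"
      by (rule sum.mono_neutral_right) (use I hz ab in auto)
    also have "\<dots> = (\<Sum>y<?r. (\<Sum>c<?r. ?G $$ (pick I c, pick I a) * Q $$ (pick I c, y)) * h $$ (y, b))"
    proof (rule sum.cong[OF refl])
      fix y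
      have "(\<Sum>x<m. ?G $$ (x, pick I a) * Q $$ (x, y)) = (\<Sum>x\<in>I. ?G $$ (x, pick I a) * Q $$ (x, y))"
        by (rule sum.mono_neutral_right) (use Im Gz pickI[OF ab(1)] in auto)
      also have "\<dots> = (\<Sum>c<?r. ?G $$ (pick I c, pick I a) * Q $$ (pick I c, y))"
        by (rule sum.reindex_bij_betw[OF bij_betw_pick[OF Im(2)], symmetric])
      finally show "(\<Sum>x<m. ?G $$ (x, pick I a) * Q $$ (x, y)) * h $$ (y, b) =
        (\<Sum>c<?r. ?G $$ (pick I c, pick I a) * Q $$ (pick I c, y)) * h $$ (y, b)" by simp
    qed
    also have "\<dots> = (?GI * ?QI * ?HI) $$ (a, b)"
      using ab by (simp add: scalar_prod_def atLeast0LessThan)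
    finally show "mat ?r ?r (\<lambda>(a, b). (transpose_mat ?G * Q * h) $$ (pick I a, b)) $$ (a, b) =
      (?GI * ?QI * ?HI) $$ (a, b)" using ab by simp
  qed auto
  then have "minor I (transpose_mat ?G * Q * h) = det (?GI * ?QI * ?HI)"
    using minor_conv[OF prod Im(1) I(2)] by simp
  also have "\<dots> = det ?GI * det ?QI * det ?HI"
  proof -
    have "det (?GI * ?QI * ?HI) = det (?GI * ?QI) * det ?HI"
      by (rule det_mult) (auto intro!: mult_carrier_mat)
    moreover have "det (?GI * ?QI) = det ?GI * det ?QI" by (rule det_mult) auto
    ultimately show ?thesis by (simp only:)
  qed
  also have "det ?QI = minor I Q" using minor_conv[OF Q Im(1) I(2)] by simp
  also have "det ?HI = (\<Prod>j<k. if j < ?r then h $$ (j, j) else 1)"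
  proof -
    have "upper_triangular ?HI" using hz I(2) by (auto simp: upper_triangular_def)
    then have "det ?HI = (\<Prod>j<?r. h $$ (j, j))" by (subst det_upper_triangular_prod[of _ ?r]) auto
    also have "\<dots> = (\<Prod>j<?r. if j < ?r then h $$ (j, j) else 1)" by (rule prod.cong) auto
    also have "\<dots> = (\<Prod>j<k. if j < ?r then h $$ (j, j) else 1)"
      by (rule prod.mono_neutral_left) (use I(2) in auto)
    finally show ?thesis .
  qed
  also have "det ?GI = (\<Prod>i<n. if i \<in> I then g $$ (i, i) else 1)"
  proof -
    have "?GI $$ (a, c) = 0" if "a < c" "c < ?r" for a c
    proof -
      have "pick I a < pick I c" using pick_mono_le[OF that(2,1)] .
      then show ?thesis using that gz[of "pick I a" "pick I c"] pickI(2)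
        by (simp add: Gi)
    qed
    then have "det ?GI = (\<Prod>a<?r. ?GI $$ (a, a))" by (intro det_lower_triangular_prod) auto
    also have "\<dots> = (\<Prod>a<?r. ?G $$ (pick I a, pick I a))" by (rule prod.cong) auto
    also have "\<dots> = (\<Prod>i\<in>I. ?G $$ (i, i))"
      by (rule prod.reindex_bij_betw[OF bij_betw_pick[OF Im(2)]])
    also have "\<dots> = (\<Prod>i\<in>I. if i < n then g $$ (i, i) else 1)"
      by (rule prod.cong) (use Im(1) in \<open>auto simp: Gi\<close>)
    also have "\<dots> = (\<Prod>i\<in>I \<inter> {..<n}. g $$ (i, i))"
      using Im(2) by (simp add: prod.inter_restrict)
    also have "\<dots> = (\<Prod>i<n. if i \<in> I then g $$ (i, i) else 1)"
      by (subst Int_commute) (simp add: prod.inter_restrict)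
    finally show ?thesis .
  qed
  finally show ?thesis by (simp add: mult_ac)
qed

lemma standard_monomial_semi_invariant:
  assumes "n \<le> m"
    and g: "g \<in> carrier_mat n n" "upper_triangular g"
    and h: "h \<in> carrier_mat k k" "upper_triangular h"
    and Q: "Q \<in> carrier_mat m k"
    and t: "set t \<subseteq> column_sets m n" "\<forall>I\<in>set t. card I \<le> k"
  shows "standard_monomial m k t (transpose_mat (GL_embed m n g) * Q * h) =
    weight n (inner_shape n t) g * weight k (outer_shape t) h * standard_monomial m k t Q"
proof -
  let ?Q = "transpose_mat (GL_embed m n g) * Q * h"
  have Q': "?Q \<in> carrier_mat m k" using GL_embed_carrier[OF \<open>n \<le> m\<close> g(1)] Q h by auto
  show ?thesis using t
  proof (induction t)
    case Nil
    have "weight n (inner_shape n []) g = 1" "weight k (outer_shape []) h = 1"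
      by (simp_all add: weight_def inner_shape_conv outer_shape_conv)
    then show ?case using Q Q' by (simp add: standard_monomial_simps mat_one_def on_mats_def)
  next
    case (Cons I t)
    have I: "I \<in> column_sets m n" "card I \<le> k" using Cons.prems by auto
    have wn: "weight n (inner_shape n (I # t)) g =
        (\<Prod>i<n. if i \<in> I then g $$ (i, i) else 1) * weight n (inner_shape n t) g"
      unfolding weight_def prod.distrib[symmetric]
      by (rule prod.cong) (auto simp: inner_shape_conv)
    have wk: "weight k (outer_shape (I # t)) h =
        (\<Prod>j<k. if j < card I then h $$ (j, j) else 1) * weight k (outer_shape t) h"
      unfolding weight_def prod.distrib[symmetric]
      by (rule prod.cong) (auto simp: outer_shape_conv)
    have simps: "standard_monomial m k (I # t) P = minor I P * standard_monomial m k t P"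
      if "P \<in> carrier_mat m k" for P
      using that by (simp add: standard_monomial_simps on_mats_def)
    show ?case
      unfolding simps[OF Q'] simps[OF Q] wn wk minor_semi_invariant[OF \<open>n \<le> m\<close> I g h Q]
      using Cons by simp
  qed
qed

lemma young_diagram_zero:
  assumes "young_diagram F" "diagram_length F \<le> a" "a \<le> r"
  shows "F r = 0"
proof -
  have "{r. F r \<noteq> 0} = {..<card {r. F r \<noteq> 0}}"
  proof (rule down_closed_nat_set)
    show "finite {r. F r \<noteq> 0}" using assms(1) by (simp add: young_diagram_def)
    fix c c' assume "c \<in> {r. F r \<noteq> 0}" "c' < c"
    moreover have "F c \<le> F c'"
      using assms(1) \<open>c' < c\<close> unfolding young_diagram_def by (simp add: antimonoD)
    ultimately show "c' \<in> {r. F r \<noteq> 0}" by auto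
  qed
  moreover have "r \<notin> {..<card {r. F r \<noteq> 0}}" using assms(2,3) by (simp add: diagram_length_def)
  ultimately show ?thesis by blast
qed

lemma diagram_pairs_eq:
  "diagram_pairs k n = {(F, D). antimono F \<and> antimono D \<and> (\<forall>r\<ge>k. F r = 0) \<and> (\<forall>r\<ge>n. D r = 0) \<and>
     (\<forall>r. D r \<le> F r)}"
proof -
  have conv: "young_diagram F \<and> diagram_length F \<le> a \<longleftrightarrow> antimono F \<and> (\<forall>r\<ge>a. F r = 0)" for F :: "nat \<Rightarrow> nat" and a
  proof
    assume F: "antimono F \<and> (\<forall>r\<ge>a. F r = 0)"
    have sub: "{r. F r \<noteq> 0} \<subseteq> {..<a}"
    proof
      fix r assume "r \<in> {r. F r \<noteq> 0}"
      then show "r \<in> {..<a}" using F by (cases "r < a") auto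
    qed
    then show "young_diagram F \<and> diagram_length F \<le> a"
      using F finite_subset[OF sub] card_mono[OF _ sub]
      by (simp add: young_diagram_def diagram_length_def)
  next
    assume F: "young_diagram F \<and> diagram_length F \<le> a"
    then have "F r = 0" if "a \<le> r" for r using young_diagram_zero[of F a r] that by simp
    then show "antimono F \<and> (\<forall>r\<ge>a. F r = 0)" using F by (simp add: young_diagram_def)
  qed
  have "diagram_pairs k n = {(F, D). (young_diagram F \<and> diagram_length F \<le> k) \<and>
      (young_diagram D \<and> diagram_length D \<le> n) \<and> (\<forall>r. D r \<le> F r)}"
    unfolding diagram_pairs_def by meson
  then show ?thesis unfolding conv by (simp only: conj_ac)
qed

lemma diagram_pairs_zero:
  assumes "(F, D) \<in> diagram_pairs k n"
  shows "k \<le> r \<Longrightarrow> F r = 0" "n \<le> r \<Longrightarrow> D r = 0"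
  using assms unfolding diagram_pairs_eq by auto

lemma card_column_le:
  assumes "outer_shape t = F" "\<And>r. k \<le> r \<Longrightarrow> F r = 0" "I \<in> set t"
  shows "card I \<le> k"
proof -
  have "length (filter (\<lambda>I. k < card I) t) = 0"
    using assms(1,2) outer_shape_conv[of t k] by simp
  then show ?thesis using assms(3) by (simp add: filter_empty_conv not_less)
qed

text \<open>
  Initial segments account for both conditions on the inner shape: with \<open>r\<close> a column contains everything
  below \<open>r\<close>, and so it has more than \<open>r\<close> entries.
\<close>

lemma shape_in_diagram_pairs:
  assumes t: "set t \<subseteq> column_sets m n" "\<forall>I\<in>set t. card I \<le> k" and "n \<le> m"
  shows "(outer_shape t, inner_shape n t) \<in> diagram_pairs k n"
proof -
  have filter_mono: "length (filter P xs) \<le> length (filter R xs)"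
    if "\<And>x. x \<in> set xs \<Longrightarrow> P x \<Longrightarrow> R x" for P R and xs :: "nat set list"
    using that by (induction xs) (auto simp: le_SucI)
  have outer0: "outer_shape t r = 0" if "k \<le> r" for r
    unfolding outer_shape_conv using t(2) that by (auto simp: filter_empty_conv not_less)
  have inner0: "inner_shape n t r = 0" if "n \<le> r" for r
    using that by (simp add: inner_shape_def)
  have outer: "antimono (outer_shape t)"
    by (rule antimonoI) (unfold outer_shape_conv, rule filter_mono, simp)
  have init: "r' \<in> I" if "I \<in> set t" "r \<in> I" "r < n" "r' \<le> r" for I r r'
    using column_sets_initial[of I m n r r'] t(1) that by (cases "r' = r") auto
  have inner: "antimono (inner_shape n t)"
  proof (rule antimonoI)
    fix r' r :: nat assume "r' \<le> r"
    show "inner_shape n t r \<le> inner_shape n t r'"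
    proof (cases "r < n")
      case True
      then have "r' < n" using \<open>r' \<le> r\<close> by simp
      show ?thesis unfolding inner_shape_conv[OF True] inner_shape_conv[OF \<open>r' < n\<close>]
        by (rule filter_mono) (use init True \<open>r' \<le> r\<close> in blast)
    qed (simp add: inner0)
  qed
  have le: "inner_shape n t r \<le> outer_shape t r" for r
  proof (cases "r < n")
    case True
    have "r < card I" if "I \<in> set t" "r \<in> I" for I
    proof -
      have "{..r} \<subseteq> I" using init[OF that True] by auto
      moreover have "finite I" using column_setsD(2)[OF subsetD[OF t(1) that(1)] \<open>n \<le> m\<close>] .
      ultimately have "card {..r} \<le> card I" by (rule card_mono[rotated])
      then show ?thesis by simp
    qed
    then show ?thesis unfolding inner_shape_conv[OF True] outer_shape_conv
      by (intro filter_mono) auto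
  qed (simp add: inner0)
  show ?thesis using outer0 inner0 outer inner le by (simp add: diagram_pairs_eq)
qed

lemma has_leading_polynomial: "has_leading m k f A \<Longrightarrow> f \<in> polynomial_functions m k"
  using poly_fun_polynomial by (auto simp: has_leading_def)

lemma unipotent_D:
  assumes "g \<in> unipotent r"
  shows "g \<in> GL r" "g \<in> carrier_mat r r" "upper_triangular g" "weight r F g = 1"
  using assms by (auto simp: unipotent_def GL_def weight_def)

lemma torus_D:
  assumes "g \<in> torus r"
  shows "g \<in> GL r" "g \<in> carrier_mat r r" "upper_triangular g"
  using assms by (auto simp: torus_def GL_def diagonal_mat_def upper_triangular_def)

lemma one_unipotent: "1\<^sub>m r \<in> unipotent r"
  using GL_one by (auto simp: unipotent_def upper_triangular_def)

lemma standard_monomial_in_component: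
  assumes "n \<le> m" and FD: "(F, D) \<in> diagram_pairs k n" and t: "t \<in> standard_tableaux m n (F, D)"
  shows "standard_monomial m k t \<in> branching_component m k n (F, D)"
proof -
  have st: "set t \<subseteq> column_sets m n" and F: "outer_shape t = F" and D: "inner_shape n t = D"
    using t by (auto simp: standard_tableaux_def standard_tableau_def)
  have card: "\<forall>I\<in>set t. card I \<le> k" using card_column_le[OF F] diagram_pairs_zero[OF FD] by blast
  let ?f = "standard_monomial m k t"
  have act: "fun_act m k (GL_embed m n g) h ?f = fun_scale (weight n D g * weight k F h) ?f"
    if g: "g \<in> GL n" "g \<in> carrier_mat n n" "upper_triangular g"
      and h: "h \<in> GL k" "h \<in> carrier_mat k k" "upper_triangular h" for g h
  proof
    fix Q
    show "fun_act m k (GL_embed m n g) h ?f Q = fun_scale (weight n D g * weight k F h) ?f Q"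
    proof (cases "Q \<in> carrier_mat m k")
      case True
      then show ?thesis
        using standard_monomial_semi_invariant[OF \<open>n \<le> m\<close> g(2,3) h(2,3) True st card]
        by (simp add: fun_act_eq[OF GL_embed_GL[OF \<open>n \<le> m\<close> g(1)] h(1)] on_mats_def fun_scale_def F D)
    next
      case False
      then show ?thesis by (simp add: fun_act_def on_mats_def fun_scale_def standard_monomial_def)
    qed
  qed
  note one = one_unipotent
  have scale1: "fun_scale 1 f = f" for f by (simp add: fun_scale_def)
  have polyn: "?f \<in> polynomial_functions m k"
    using has_leading_polynomial[OF has_leading_standard_monomial[of t m k]]
      column_setsD(1)[OF _ \<open>n \<le> m\<close>] st card by blast
  have "fun_act m k (1\<^sub>m m) v ?f = ?f" if "v \<in> unipotent k" for v
    using act[OF unipotent_D(1-3)[OF one] unipotent_D(1-3)[OF that]] unipotent_D(4)[OF one]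
      unipotent_D(4)[OF that] by (simp add: GL_embed_one[OF \<open>n \<le> m\<close>] scale1)
  moreover have "fun_act m k (1\<^sub>m m) a ?f = fun_scale (weight k F a) ?f" if "a \<in> torus k" for a
    using act[OF unipotent_D(1-3)[OF one] torus_D[OF that]] unipotent_D(4)[OF one]
    by (simp add: GL_embed_one[OF \<open>n \<le> m\<close>])
  moreover have "fun_act m k (GL_embed m n u) (1\<^sub>m k) ?f = ?f" if "u \<in> unipotent n" for u
    using act[OF unipotent_D(1-3)[OF that] unipotent_D(1-3)[OF one]] unipotent_D(4)[OF one]
      unipotent_D(4)[OF that] by (simp add: scale1)
  moreover have "fun_act m k (GL_embed m n a) (1\<^sub>m k) ?f = fun_scale (weight n D a) ?f"
    if "a \<in> torus n" for a
    using act[OF torus_D[OF that] unipotent_D(1-3)[OF one]] unipotent_D(4)[OF one] by simp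
  ultimately show ?thesis using polyn by (simp add: branching_component_def GL_rep_def)
qed

section \<open>Shear invariance and weights\<close>

text \<open>
  The part of the invariance that the proof exploits, stated on arrays.
\<close>

definition shear_invariant :: "nat \<Rightarrow> nat \<Rightarrow> nat \<Rightarrow> (complex mat \<Rightarrow> complex) \<Rightarrow> bool" where
  "shear_invariant m k n f \<longleftrightarrow>
     (\<forall>j t q. Suc j < k \<longrightarrow> f (of_array m k (col_shear j t q)) = f (of_array m k q)) \<and>
     (\<forall>i t q. Suc i < n \<longrightarrow> f (of_array m k (row_shear i t q)) = f (of_array m k q))"

definition torus_homogeneous ::
  "nat \<Rightarrow> nat \<Rightarrow> nat \<Rightarrow> (nat \<Rightarrow> nat) \<times> (nat \<Rightarrow> nat) \<Rightarrow> (complex mat \<Rightarrow> complex) \<Rightarrow> bool" where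
  "torus_homogeneous m k n FD f \<longleftrightarrow>
     (\<forall>w z q. (\<forall>i<n. w i \<noteq> 0) \<longrightarrow> (\<forall>j<k. z j \<noteq> 0) \<longrightarrow>
        f (of_array m k (scale_array n w z q)) =
          (\<Prod>i<n. w i ^ snd FD i) * (\<Prod>j<k. z j ^ fst FD j) * f (of_array m k q))"

definition exponent_weight ::
  "nat \<Rightarrow> nat \<Rightarrow> nat \<Rightarrow> (nat \<Rightarrow> nat \<Rightarrow> nat) \<Rightarrow> (nat \<Rightarrow> nat) \<times> (nat \<Rightarrow> nat)" where
  "exponent_weight m k n A =
     (\<lambda>j. if j < k then \<Sum>r<m. A r j else 0, \<lambda>r. if r < n then \<Sum>j<k. A r j else 0)"

lemma poly_fun_of_array: "poly_fun m k c (of_array m k q) = poly_at m k c q"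
  unfolding of_array_def by (rule poly_fun_mat)

lemma fun_act_split:
  assumes "n \<le> m" and g: "g \<in> GL n" and h: "h \<in> GL k"
  shows "fun_act m k (GL_embed m n g) h f =
    fun_act m k (GL_embed m n g) (1\<^sub>m k) (fun_act m k (1\<^sub>m m) h f)"
proof -
  have G: "GL_embed m n g \<in> GL m" by (rule GL_embed_GL[OF assms(1,2)])
  then have Gc: "GL_embed m n g \<in> carrier_mat m m" and hc: "h \<in> carrier_mat k k"
    using h by (auto simp: GL_def)
  have GQ: "transpose_mat (GL_embed m n g) * Q \<in> carrier_mat m k" if "Q \<in> carrier_mat m k" for Q
    using Gc that by auto
  show ?thesis
    unfolding fun_act_eq[OF G h] fun_act_eq[OF G GL_one] fun_act_eq[OF GL_one h]
    by (intro on_mats_cong)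
      (simp add: on_mats_def GQ right_mult_one_mat[OF GQ] left_mult_one_mat[OF GQ])
qed

lemma fun_act_linear:
  "fun_act m k g h (f + f') = fun_act m k g h f + fun_act m k g h f'"
  "fun_act m k g h (fun_scale a f) = fun_scale a (fun_act m k g h f)"
  "fun_act m k g h 0 = 0"
  "fun_act m k g h (f * f') = fun_act m k g h f * fun_act m k g h f'"
  by (auto simp: fun_act_def on_mats_def fun_scale_def fun_eq_iff)

lemma fun_scale_simps:
  "fun_scale a (f + g) = fun_scale a f + fun_scale a g"
  "fun_scale a (fun_scale b f) = fun_scale (a * b) f"
  "fun_scale 1 f = f"
  "fun_scale a 0 = 0"
  "fun_scale a f * fun_scale b g = fun_scale (a * b) (f * g)"
  by (auto simp: fun_scale_def fun_eq_iff algebra_simps)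

lemma branching_componentD:
  assumes "n \<le> m" and f: "f \<in> branching_component m k n FD"
  shows "f \<in> polynomial_functions m k"
    and "\<And>u v. u \<in> unipotent n \<Longrightarrow> v \<in> unipotent k \<Longrightarrow> fun_act m k (GL_embed m n u) v f = f"
    and "\<And>g h. g \<in> torus n \<Longrightarrow> h \<in> torus k \<Longrightarrow> fun_act m k (GL_embed m n g) h f =
      fun_scale (weight n (snd FD) g * weight k (fst FD) h) f"
proof -
  obtain F D where FD: "FD = (F, D)" by (cases FD)
  have f': "f \<in> polynomial_functions m k"
    "\<And>v. v \<in> unipotent k \<Longrightarrow> fun_act m k (1\<^sub>m m) v f = f"
    "\<And>a. a \<in> torus k \<Longrightarrow> fun_act m k (1\<^sub>m m) a f = fun_scale (weight k F a) f"
    "\<And>u. u \<in> unipotent n \<Longrightarrow> fun_act m k (GL_embed m n u) (1\<^sub>m k) f = f"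
    "\<And>a. a \<in> torus n \<Longrightarrow> fun_act m k (GL_embed m n a) (1\<^sub>m k) f = fun_scale (weight n D a) f"
    using f by (auto simp: FD branching_component_def GL_rep_def)
  show "f \<in> polynomial_functions m k" by (rule f'(1))
  show "fun_act m k (GL_embed m n u) v f = f" if "u \<in> unipotent n" "v \<in> unipotent k" for u v
    using fun_act_split[OF assms(1) unipotent_D(1)[OF that(1)] unipotent_D(1)[OF that(2)]]
    by (simp add: f'(2)[OF that(2)] f'(4)[OF that(1)])
  show "fun_act m k (GL_embed m n g) h f = fun_scale (weight n (snd FD) g * weight k (fst FD) h) f"
    if "g \<in> torus n" "h \<in> torus k" for g h
    using fun_act_split[OF assms(1) torus_D(1)[OF that(1)] torus_D(1)[OF that(2)]]
    by (simp add: f'(3)[OF that(2)] f'(5)[OF that(1)] fun_act_linear fun_scale_simps FD mult.commute)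
qed

lemma branching_component_subset:
  "n \<le> m \<Longrightarrow> branching_component m k n FD \<subseteq> branching_algebra m k n"
  using branching_componentD(1,2) unfolding branching_algebra_def by blast

lemma branching_algebra_shear_invariant:
  assumes "n \<le> m" and f: "f \<in> branching_algebra m k n"
  shows "shear_invariant m k n f"
proof -
  have inv: "fun_act m k (GL_embed m n u) v f = f" if "u \<in> unipotent n" "v \<in> unipotent k" for u v
    using f that by (simp add: branching_algebra_def)
  show ?thesis unfolding shear_invariant_def
  proof (intro conjI allI impI)
    fix j t q assume j: "Suc j < k"
    show "f (of_array m k (col_shear j t q)) = f (of_array m k q)"
      using fun_act_col_shear[OF j, of m t f q] inv[OF one_unipotent elementary_unipotent, of j t]
      by (simp add: GL_embed_one[OF assms(1)])
  next
    fix i t q assume i: "Suc i < n"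
    show "f (of_array m k (row_shear i t q)) = f (of_array m k q)"
      using fun_act_row_shear[OF i assms(1), of k t f q] inv[OF elementary_unipotent one_unipotent, of i t]
      by simp
  qed
qed

lemma branching_component_homogeneous:
  assumes "n \<le> m" and f: "f \<in> branching_component m k n FD"
  shows "torus_homogeneous m k n FD f"
  unfolding torus_homogeneous_def
proof (intro allI impI)
  fix w z :: "nat \<Rightarrow> complex" and q
  assume w: "\<forall>i<n. w i \<noteq> 0" and z: "\<forall>j<k. z j \<noteq> 0"
  have "diagonal n w \<in> torus n" "diagonal k z \<in> torus k"
    using diagonal_torus[of n w] diagonal_torus[of k z] w z by auto
  from branching_componentD(3)[OF assms this]
  show "f (of_array m k (scale_array n w z q)) =
      (\<Prod>i<n. w i ^ snd FD i) * (\<Prod>j<k. z j ^ fst FD j) * f (of_array m k q)"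
    using fun_act_scale[of n w k z m f q] w z assms(1) by (simp add: weight_diagonal fun_scale_def)
qed

lemma monom_at_scale:
  assumes "n \<le> m"
  shows "monom_at m k A (scale_array n w z q) =
    (\<Prod>i<n. w i ^ (\<Sum>j<k. A i j)) * (\<Prod>j<k. z j ^ (\<Sum>r<m. A r j)) * monom_at m k A q"
proof -
  let ?w = "\<lambda>r. if r < n then w r else 1"
  have "monom_at m k A (scale_array n w z q) =
      (\<Prod>r<m. \<Prod>j<k. ?w r ^ A r j) * (\<Prod>r<m. \<Prod>j<k. z j ^ A r j) * monom_at m k A q"
    unfolding monom_at_def scale_array_def by (simp add: power_mult_distrib prod.distrib mult_ac)
  also have "(\<Prod>r<m. \<Prod>j<k. z j ^ A r j) = (\<Prod>j<k. z j ^ (\<Sum>r<m. A r j))"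
    by (subst prod.swap) (simp add: power_sum)
  also have "(\<Prod>r<m. \<Prod>j<k. ?w r ^ A r j) = (\<Prod>r<m. ?w r ^ (\<Sum>j<k. A r j))"
    by (simp only: power_sum)
  also have "\<dots> = (\<Prod>r<n. ?w r ^ (\<Sum>j<k. A r j))"
    by (rule prod.mono_neutral_right) (use assms in auto)
  also have "\<dots> = (\<Prod>r<n. w r ^ (\<Sum>j<k. A r j))" by (rule prod.cong) auto
  finally show ?thesis .
qed

text \<open>
  Scaling a single column or row by 2 multiplies each monomial by a power of 2 that reveals its degree
  there.
\<close>

lemma homogeneous_coeffs:
  assumes "n \<le> m" and c: "c \<in> poly_coeffs m k" and hom: "torus_homogeneous m k n FD (poly_fun m k c)"
    and A: "c A \<noteq> 0"
  shows "j < k \<Longrightarrow> (\<Sum>r<m. A r j) = fst FD j" and "i < n \<Longrightarrow> (\<Sum>j<k. A i j) = snd FD i"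
proof -
  have fin: "finite {A. c A \<noteq> 0}" using c by (simp add: poly_coeffs_def)
  have pow2: "a = b" if "(2::complex) ^ a = 2 ^ b" for a b :: nat
  proof -
    have "(of_nat (2 ^ a) :: complex) = of_nat (2 ^ b)" using that by simp
    then have "(2::nat) ^ a = 2 ^ b" by (simp only: of_nat_eq_iff)
    then show ?thesis by simp
  qed
  have main: "x A = y" if eq: "\<And>A q. monom_at m k A (S q) = 2 ^ x A * monom_at m k A q"
      "\<And>q. poly_at m k c (S q) = 2 ^ y * poly_at m k c q" for x y S
  proof (rule ccontr)
    assume "x A \<noteq> y"
    define c' where "c' = (\<lambda>A. c A * (2 ^ x A - 2 ^ y))"
    have sub: "{A. c' A \<noteq> 0} \<subseteq> {A. c A \<noteq> 0}" by (auto simp: c'_def)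
    have c': "c' \<in> poly_coeffs m k" by (rule coeffs_subset[OF c sub])
    have nz: "c' A \<noteq> 0" using A \<open>x A \<noteq> y\<close> pow2 by (auto simp: c'_def)
    have "poly_at m k c' q = 0" for q
    proof -
      have "poly_at m k c' q = (\<Sum>A | c A \<noteq> 0. c A * (2 ^ x A * monom_at m k A q) - 2 ^ y * (c A * monom_at m k A q))"
        unfolding poly_at_superset[OF fin sub] by (rule sum.cong) (auto simp: c'_def algebra_simps)
      also have "\<dots> = poly_at m k c (S q) - 2 ^ y * poly_at m k c q"
        by (simp add: poly_at_def eq(1) sum_subtractf sum_distrib_left)
      finally show ?thesis using eq(2)[of q] by simp
    qed
    moreover obtain q where "poly_at m k c' q \<noteq> 0" using poly_at_nonzero[of c' m k A, OF c' nz] ..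
    ultimately show False by blast
  qed
  note hom' = hom[unfolded torus_homogeneous_def poly_fun_of_array, rule_format]
  have single: "(\<Prod>i<N. (if i = l then 2 else (1::complex)) ^ e i) = 2 ^ e l" if "l < N" for l N and e :: "nat \<Rightarrow> nat"
  proof -
    have "(\<Prod>i<N. (if i = l then 2 else (1::complex)) ^ e i) = (\<Prod>i<N. if i = l then 2 ^ e l else 1)"
      by (rule prod.cong) auto
    then show ?thesis using that by (simp add: prod.delta)
  qed
  show "(\<Sum>r<m. A r j) = fst FD j" if "j < k"
  proof (rule main[where S = "scale_array n (\<lambda>_. 1) (\<lambda>i. if i = j then 2 else 1)" and x = "\<lambda>A. \<Sum>r<m. A r j"])
    show "monom_at m k A (scale_array n (\<lambda>_. 1) (\<lambda>i. if i = j then 2 else 1) q) =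
        2 ^ (\<Sum>r<m. A r j) * monom_at m k A q" for A q
      unfolding monom_at_scale[OF assms(1)] single[OF that] by simp
    show "poly_at m k c (scale_array n (\<lambda>_. 1) (\<lambda>i. if i = j then 2 else 1) q) =
        2 ^ fst FD j * poly_at m k c q" for q
      by (subst hom') (simp_all add: single[OF that])
  qed
  show "(\<Sum>j<k. A i j) = snd FD i" if "i < n"
  proof (rule main[where S = "scale_array n (\<lambda>r. if r = i then 2 else 1) (\<lambda>_. 1)" and x = "\<lambda>A. \<Sum>j<k. A i j"])
    show "monom_at m k A (scale_array n (\<lambda>r. if r = i then 2 else 1) (\<lambda>_. 1) q) =
        2 ^ (\<Sum>j<k. A i j) * monom_at m k A q" for A q
      unfolding monom_at_scale[OF assms(1)] single[OF that] by simp
    show "poly_at m k c (scale_array n (\<lambda>r. if r = i then 2 else 1) (\<lambda>_. 1) q) =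
        2 ^ snd FD i * poly_at m k c q" for q
      by (subst hom') (simp_all add: single[OF that])
  qed
qed

definition weight_part ::
  "nat \<Rightarrow> nat \<Rightarrow> nat \<Rightarrow> (nat \<Rightarrow> nat) \<times> (nat \<Rightarrow> nat) \<Rightarrow> ((nat \<Rightarrow> nat \<Rightarrow> nat) \<Rightarrow> complex) \<Rightarrow>
   (nat \<Rightarrow> nat \<Rightarrow> nat) \<Rightarrow> complex" where
  "weight_part m k n FD c = (\<lambda>A. if exponent_weight m k n A = FD then c A else 0)"

lemma prod_lessThan_add: "(\<Prod>v<k + n. f v) = (\<Prod>j<k. f j) * (\<Prod>i<n. f (k + i))"
  for f :: "nat \<Rightarrow> complex"
  by (induction n) (simp_all add: mult_ac)

text \<open>
  Evaluate at an array scaled by a torus element.  An operation \<open>T\<close> that the torus normalises acts on the scaled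
  array by another operation of the same kind, hence without effect.  Both sides are therefore equal as
  combinations of characters of the torus, and the components of weight \<open>FD\<close> can be
  compared.
\<close>

lemma weight_part_invariant:
  assumes "n \<le> m" and c: "c \<in> poly_coeffs m k"
    and inv: "\<And>w z q. \<forall>i<n. w i \<noteq> 0 \<Longrightarrow> \<forall>j<k. z j \<noteq> 0 \<Longrightarrow>
      poly_at m k c (scale_array n w z (T q)) = poly_at m k c (scale_array n w z q)"
  shows "poly_at m k (weight_part m k n FD c) (T q) = poly_at m k (weight_part m k n FD c) q"
proof -
  \<comment> \<open>The two torus weights joined into one exponent in \<open>k + n\<close> variables.\<close>
  define E where "E = (\<lambda>A v. if v < k then \<Sum>r<m. A r v else \<Sum>j<k. A (v - k) j :: nat)"
  define e where "e = (\<lambda>v. if v < k then fst FD v else snd FD (v - k))"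
  let ?S = "{A. c A \<noteq> 0}"
  let ?b = "\<lambda>A. c A * (monom_at m k A (T q) - monom_at m k A q)"
  have fin: "finite ?S" using c by (simp add: poly_coeffs_def)
  have sub: "{A. weight_part m k n FD c A \<noteq> 0} \<subseteq> ?S" by (auto simp: weight_part_def)
  have "(\<Sum>A\<in>?S. ?b A * (\<Prod>v<k + n. \<zeta> v ^ E A v)) = 0" if \<zeta>: "\<forall>v<k + n. \<zeta> v \<noteq> 0" for \<zeta>
  proof -
    let ?w = "\<lambda>i. \<zeta> (k + i)"
    have "monom_at m k A (scale_array n ?w \<zeta> q) = monom_at m k A q * (\<Prod>v<k + n. \<zeta> v ^ E A v)" for A q
      unfolding monom_at_scale[OF assms(1)] prod_lessThan_add by (simp add: E_def)
    then have "poly_at m k c (scale_array n ?w \<zeta> q) =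
        (\<Sum>A\<in>?S. c A * monom_at m k A q * (\<Prod>v<k + n. \<zeta> v ^ E A v))" for q
      by (simp add: poly_at_def mult_ac)
    then show ?thesis using inv[of ?w \<zeta> q] \<zeta>
      by (simp add: algebra_simps sum_subtractf)
  qed
  from monomials_independent[OF fin this, of e]
  have 0: "(\<Sum>A\<in>{A\<in>?S. \<forall>v<k + n. E A v = e v}. ?b A) = 0" .
  have "(\<Sum>A\<in>{A\<in>?S. exponent_weight m k n A = FD}. ?b A) = 0"
  proof (cases "\<exists>A0. exponent_weight m k n A0 = FD")
    case True
    then obtain A0 where A0: "FD = exponent_weight m k n A0" by auto
    have "exponent_weight m k n A = FD \<longleftrightarrow> (\<forall>v<k + n. E A v = e v)" for A
    proof
      assume "exponent_weight m k n A = FD"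
      then show "\<forall>v<k + n. E A v = e v" by (auto simp: E_def e_def exponent_weight_def)
    next
      assume *: "\<forall>v<k + n. E A v = e v"
      have "(\<Sum>r<m. A r j) = (\<Sum>r<m. A0 r j)" if "j < k" for j
        using *[rule_format, of j] that by (simp add: E_def e_def A0 exponent_weight_def)
      moreover have "(\<Sum>j<k. A i j) = (\<Sum>j<k. A0 i j)" if "i < n" for i
        using *[rule_format, of "k + i"] that by (simp add: E_def e_def A0 exponent_weight_def)
      ultimately show "exponent_weight m k n A = FD"
        unfolding A0 by (simp add: exponent_weight_def fun_eq_iff)
    qed
    then show ?thesis using 0 by simp
  qed simp
  then have "(\<Sum>A\<in>?S. if exponent_weight m k n A = FD then ?b A else 0) = 0"
    unfolding sum.inter_filter[OF fin] .
  moreover have "(\<Sum>A\<in>?S. if exponent_weight m k n A = FD then ?b A else 0) =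
      poly_at m k (weight_part m k n FD c) (T q) - poly_at m k (weight_part m k n FD c) q"
    unfolding poly_at_superset[OF fin sub] sum_subtractf[symmetric]
    by (rule sum.cong) (auto simp: weight_part_def algebra_simps)
  ultimately show ?thesis by simp
qed

lemma weight_part_shear_invariant:
  assumes "n \<le> m" and c: "c \<in> poly_coeffs m k" and inv: "shear_invariant m k n (poly_fun m k c)"
  shows "shear_invariant m k n (poly_fun m k (weight_part m k n FD c))"
  unfolding shear_invariant_def poly_fun_of_array
proof (intro conjI allI impI)
  note inv' = inv[unfolded shear_invariant_def poly_fun_of_array]
  fix j t q assume j: "Suc j < k"
  show "poly_at m k (weight_part m k n FD c) (col_shear j t q) = poly_at m k (weight_part m k n FD c) q"
  proof (rule weight_part_invariant[OF assms(1) c])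
    fix w z :: "nat \<Rightarrow> complex" and q
    assume "\<forall>j<k. z j \<noteq> 0"
    then have "scale_array n w z (col_shear j t q) =
        col_shear j (t * z (Suc j) / z j) (scale_array n w z q)"
      using j by (auto simp: scale_array_def col_shear_def fun_eq_iff field_simps)
    then show "poly_at m k c (scale_array n w z (col_shear j t q)) = poly_at m k c (scale_array n w z q)"
      using inv' j by simp
  qed
next
  note inv' = inv[unfolded shear_invariant_def poly_fun_of_array]
  fix i t q assume i: "Suc i < n"
  show "poly_at m k (weight_part m k n FD c) (row_shear i t q) = poly_at m k (weight_part m k n FD c) q"
  proof (rule weight_part_invariant[OF assms(1) c])
    fix w z :: "nat \<Rightarrow> complex" and q
    assume "\<forall>i<n. w i \<noteq> 0"
    then have "scale_array n w z (row_shear i t q) =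
        row_shear i (t * w (Suc i) / w i) (scale_array n w z q)"
      using i by (auto simp: scale_array_def row_shear_def fun_eq_iff field_simps)
    then show "poly_at m k c (scale_array n w z (row_shear i t q)) = poly_at m k c (scale_array n w z q)"
      using inv' i by simp
  qed
qed

section \<open>Standard monomials form a basis\<close>

text \<open>
  This is where the two constraints on leading exponents meet the combinatorics; the weight of \<open>A\<close>
  is the shape of the tableau.
\<close>

lemma leading_exponent_of_tableau:
  assumes "n \<le> m" and c: "c \<in> poly_coeffs m k" and lead: "leading c A"
    and inv: "shear_invariant m k n (poly_fun m k c)"
    and hom: "\<And>A. c A \<noteq> 0 \<Longrightarrow> exponent_weight m k n A = FD"
  obtains t where "t \<in> standard_tableaux m n FD" "tableau_exponent t = A"
    "\<forall>I\<in>set t. card I \<le> k" "FD \<in> diagram_pairs k n"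
proof -
  obtain F D where FD: "FD = (F, D)" by (cases FD)
  note inv' = inv[unfolded shear_invariant_def poly_fun_of_array]
  have cA: "c A \<noteq> 0" using lead by (simp add: leading_def)
  have A: "A \<in> exponents m k" using c cA unfolding poly_coeffs_def by blast
  have cols: "(\<Sum>r<m. A' r v) = F v" if "c A' \<noteq> 0" "v < k" for A' v
    using hom[OF that(1)] that(2) unfolding FD exponent_weight_def by auto
  have rows: "(\<Sum>v<k. A' r v) = D r" if "c A' \<noteq> 0" "r < n" for A' r
    using hom[OF that(1)] that(2) unfolding FD exponent_weight_def by auto
  have ss: "(\<Sum>r\<le>i. A r (Suc j)) \<le> (\<Sum>r<i. A r j)" if "i < m" "Suc j < k" for i j
  proof (rule leading_semistandard[OF c lead that(2,1)])
    show "(\<Sum>r<m. A' r v) = F v" if "c A' \<noteq> 0" "v < k" for A' v by (rule cols[OF that])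
    show "poly_at m k c (col_shear j t q) = poly_at m k c q" for t q using inv' that(2) by blast
  qed
  have diag: "A r j = 0" if "r < n" "j < k" "r \<noteq> j" for r j
  proof (rule leading_diagonal[OF c lead \<open>n \<le> m\<close> _ _ _ _ that])
    show "(\<Sum>r<m. A' r v) = F v" if "c A' \<noteq> 0" "v < k" for A' v by (rule cols[OF that])
    show "(\<Sum>v<k. A' r v) = D r" if "c A' \<noteq> 0" "r < n" for A' r by (rule rows[OF that])
    show "poly_at m k c (col_shear j t q) = poly_at m k c q" if "Suc j < k" for j t q
      using inv' that by blast
    show "poly_at m k c (row_shear r t q) = poly_at m k c q" if "Suc r < n" for r t q
      using inv' that by blast
  qed
  obtain t where t: "standard_tableau m n t" "tableau_exponent t = A" "\<forall>I\<in>set t. card I \<le> k"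
    using tableau_exponent_surj[of A m k n, OF A ss diag \<open>n \<le> m\<close>] by blast
  have st: "set t \<subseteq> column_sets m n" using t(1) by (simp add: standard_tableau_def)
  have wA: "exponent_weight m k n A = (F, D)" using hom[OF cA] FD by simp
  have "outer_shape t j = F j" for j
  proof -
    have "outer_shape t j = (\<Sum>r<m. A r j)"
      using tableau_exponent_col_sum[OF st \<open>n \<le> m\<close>, of j] t(2) by simp
    also have "\<dots> = fst (exponent_weight m k n A) j"
      using A by (auto simp: exponent_weight_def exponents_def)
    finally show ?thesis using wA by simp
  qed
  moreover have "inner_shape n t r = D r" for r
  proof -
    have "inner_shape n t r = snd (exponent_weight m k n A) r"
      using tableau_exponent_row_sum[OF st \<open>n \<le> m\<close> t(3), of r] t(2)
      by (cases "r < n") (auto simp: exponent_weight_def inner_shape_def)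
    then show ?thesis using wA by simp
  qed
  ultimately have shape: "outer_shape t = F" "inner_shape n t = D" by (simp_all add: fun_eq_iff)
  show ?thesis
  proof (rule that)
    show "t \<in> standard_tableaux m n FD" using t(1) shape by (simp add: standard_tableaux_def FD)
    show "FD \<in> diagram_pairs k n"
      using shape_in_diagram_pairs[OF st t(3) \<open>n \<le> m\<close>] shape FD by simp
  qed (use t in auto)
qed

lemma poly_fun_scale:
  assumes "c \<in> poly_coeffs m k"
  shows "(\<lambda>A. a * c A) \<in> poly_coeffs m k" "poly_fun m k (\<lambda>A. a * c A) = fun_scale a (poly_fun m k c)"
proof -
  have fin: "finite {A. c A \<noteq> 0}" and sub: "{A. a * c A \<noteq> 0} \<subseteq> {A. c A \<noteq> 0}"
    using assms by (auto simp: poly_coeffs_def)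
  show "(\<lambda>A. a * c A) \<in> poly_coeffs m k" by (rule coeffs_subset[OF assms sub])
  have "poly_at m k (\<lambda>A. a * c A) q = a * poly_at m k c q" for q
    unfolding poly_at_superset[OF fin sub] by (simp add: poly_at_def sum_distrib_left mult_ac)
  then show "poly_fun m k (\<lambda>A. a * c A) = fun_scale a (poly_fun m k c)"
    by (simp add: poly_fun_def on_mats_def fun_scale_def fun_eq_iff)
qed

lemma poly_fun_zero: "poly_fun m k (\<lambda>A. 0) = 0"
  by (simp add: poly_fun_def poly_at_def on_mats_def fun_eq_iff)

lemma poly_fun_sum:
  assumes "finite S" "\<And>x. x \<in> S \<Longrightarrow> d x \<in> poly_coeffs m k"
  shows "(\<lambda>A. \<Sum>x\<in>S. d x A) \<in> poly_coeffs m k \<and>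
    poly_fun m k (\<lambda>A. \<Sum>x\<in>S. d x A) = (\<Sum>x\<in>S. poly_fun m k (d x))"
  using assms
proof (induction S rule: finite_induct)
  case empty
  then show ?case by (simp add: poly_fun_zero poly_coeffs_def)
next
  case (insert x S)
  then have "(\<lambda>A. \<Sum>x\<in>S. d x A) \<in> poly_coeffs m k"
    "poly_fun m k (\<lambda>A. \<Sum>x\<in>S. d x A) = (\<Sum>x\<in>S. poly_fun m k (d x))" "d x \<in> poly_coeffs m k" by auto
  moreover have "(\<lambda>A. \<Sum>x\<in>insert x S. d x A) = d x + (\<lambda>A. \<Sum>x\<in>S. d x A)"
    using insert.hyps by (simp add: fun_eq_iff)
  ultimately show ?case using poly_fun_add[of "d x" m k "\<lambda>A. \<Sum>x\<in>S. d x A"] insert.hyps by simp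
qed

lemma finite_exponents_of_weight: "finite {A \<in> exponents m k. exponent_weight m k n A = FD}"
proof -
  define N where "N = (\<Sum>j<k. fst FD j)"
  define R where "R = {g :: nat \<Rightarrow> nat. \<forall>j. (j \<in> {..<k} \<longrightarrow> g j \<in> {..N}) \<and> (j \<notin> {..<k} \<longrightarrow> g j = 0)}"
  have "finite R" unfolding R_def by (rule finite_set_of_finite_funs) auto
  then have fin: "finite {A. \<forall>r. (r \<in> {..<m} \<longrightarrow> A r \<in> R) \<and> (r \<notin> {..<m} \<longrightarrow> A r = (\<lambda>_. 0))}"
    by (rule finite_set_of_finite_funs[rotated]) auto
  show ?thesis
  proof (rule finite_subset[OF subsetI fin])
    fix A assume A: "A \<in> {A \<in> exponents m k. exponent_weight m k n A = FD}"
    have "A r j \<le> N" if "r < m" "j < k" for r j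
    proof -
      have "A r j \<le> (\<Sum>r<m. A r j)" using that by (intro member_le_sum) auto
      also have "\<dots> = fst FD j" using A that by (auto simp: exponent_weight_def)
      also have "\<dots> \<le> N" unfolding N_def using that by (intro member_le_sum) auto
      finally show ?thesis .
    qed
    moreover have "A r j = 0" if "\<not> (r < m \<and> j < k)" for r j using A that by (simp add: exponents_def)
    ultimately show "A \<in> {A. \<forall>r. (r \<in> {..<m} \<longrightarrow> A r \<in> R) \<and> (r \<notin> {..<m} \<longrightarrow> A r = (\<lambda>_. 0))}"
      by (simp add: R_def fun_eq_iff)
  qed
qed

lemma homogeneous_exponent_weight:
  assumes "n \<le> m" "c \<in> poly_coeffs m k" "torus_homogeneous m k n FD (poly_fun m k c)" "c A \<noteq> 0"
    and "FD \<in> diagram_pairs k n"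
  shows "exponent_weight m k n A = FD"
proof -
  obtain F D where FD: "FD = (F, D)" by (cases FD)
  have "F r = 0" if "k \<le> r" for r using diagram_pairs_zero(1)[of F D k n r] assms(5) that FD by simp
  moreover have "D r = 0" if "n \<le> r" for r
    using diagram_pairs_zero(2)[of F D k n r] assms(5) that FD by simp
  ultimately show ?thesis
    using homogeneous_coeffs[of n m c k FD A, OF assms(1-4)] by (simp add: exponent_weight_def FD fun_eq_iff not_less)
qed

text \<open>
  Induction on the number of exponents of the given weight that lie weakly below the support:
  removing the leading term with a standard monomial makes this set strictly smaller.
\<close>

lemma shear_invariant_in_span:
  assumes "n \<le> m" "c \<in> poly_coeffs m k" "shear_invariant m k n (poly_fun m k c)"
    and "\<And>A. c A \<noteq> 0 \<Longrightarrow> exponent_weight m k n A = FD"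
  shows "poly_fun m k c \<in> mat_fun.span (standard_monomial m k ` standard_tableaux m n FD)"
  using assms(2-4)
proof (induction "card {B \<in> exponents m k. exponent_weight m k n B = FD \<and>
      (\<exists>A. c A \<noteq> 0 \<and> (B = A \<or> lex_less B A))}" arbitrary: c rule: less_induct)
  case less
  let ?down = "\<lambda>c. {B \<in> exponents m k. exponent_weight m k n B = FD \<and>
      (\<exists>A. c A \<noteq> 0 \<and> (B = A \<or> lex_less B A))}"
  let ?V = "mat_fun.span (standard_monomial m k ` standard_tableaux m n FD)"
  note c = less.prems(1) and inv = less.prems(2) and wt = less.prems(3)
  show ?case
  proof (cases "\<exists>A. c A \<noteq> 0")
    case False
    then have "c = (\<lambda>A. 0)" by auto
    then show ?thesis using mat_fun.span_zero by (simp add: poly_fun_zero)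
  next
    case True
    then obtain A0 where "c A0 \<noteq> 0" by blast
    with leading_exists[of c m k A0] c obtain A where lead: "leading c A" by blast
    have cA: "c A \<noteq> 0" using lead by (simp add: leading_def)
    have wA: "exponent_weight m k n A = FD" by (rule wt[OF cA])
    have expA: "A \<in> exponents m k" using c cA unfolding poly_coeffs_def by blast
    obtain t where t: "t \<in> standard_tableaux m n FD" "tableau_exponent t = A"
      "\<forall>I\<in>set t. card I \<le> k" and FD: "FD \<in> diagram_pairs k n"
      using leading_exponent_of_tableau[of n m c k A FD, OF assms(1) c lead inv wt] by blast
    let ?f = "standard_monomial m k t"
    have st: "set t \<subseteq> column_sets m n"
      using t(1) by (auto simp: standard_tableaux_def standard_tableau_def split: prod.splits)
    have comp: "?f \<in> branching_component m k n FD"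
      using standard_monomial_in_component[OF assms(1), of "fst FD" "snd FD" k t] FD t(1) by simp
    have "\<forall>I\<in>set t. I \<subseteq> {..<m} \<and> card I \<le> k" using column_setsD(1)[OF _ assms(1)] st t(3) by blast
    from has_leading_standard_monomial[OF this]
    obtain d where d: "d \<in> poly_coeffs m k" "?f = poly_fun m k d" "leading d A" "d A = 1"
      unfolding has_leading_def t(2) by blast
    define c' where "c' = c + (\<lambda>B. - c A * d B)"
    have md: "(\<lambda>B. - c A * d B) \<in> poly_coeffs m k"
      "poly_fun m k (\<lambda>B. - c A * d B) = fun_scale (- c A) ?f"
      using poly_fun_scale[OF d(1), of "- c A"] d(2) by simp_all
    have c': "c' \<in> poly_coeffs m k" "poly_fun m k c' = poly_fun m k c + fun_scale (- c A) ?f"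
      using poly_fun_add[OF c md(1)] md(2) by (simp_all add: c'_def)
    have inv_f: "shear_invariant m k n ?f"
      using branching_algebra_shear_invariant[OF assms(1)] branching_component_subset[OF assms(1)] comp
      by blast
    have inv': "shear_invariant m k n (poly_fun m k c')"
      using inv inv_f unfolding c'(2) shear_invariant_def by (simp add: fun_scale_def)
    have c'_c: "c B \<noteq> 0 \<or> d B \<noteq> 0" if "c' B \<noteq> 0" for B using that by (auto simp: c'_def)
    have hom_f: "torus_homogeneous m k n FD (poly_fun m k d)"
      using branching_component_homogeneous[OF assms(1) comp] d(2) by simp
    have wt': "exponent_weight m k n B = FD" if "c' B \<noteq> 0" for B
      using c'_c[OF that] wt[of B] homogeneous_exponent_weight[OF assms(1) d(1) hom_f _ FD] by blast
    have "c' A = 0" by (simp add: c'_def d(4))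
    then have below: "lex_less B A" if "c' B \<noteq> 0" for B
      using c'_c[OF that] lead d(3) that unfolding leading_def by metis
    have "?down c' \<subset> ?down c"
    proof (rule psubsetI)
      show "?down c' \<subseteq> ?down c"
        using below lex_less_trans cA by blast
      have "A \<in> ?down c" using expA wA cA by blast
      moreover have "A \<notin> ?down c'"
        using below lex_less_trans[of A _ A] lex_less_irrefl by blast
      ultimately show "?down c' \<noteq> ?down c" by blast
    qed
    moreover have "finite (?down c)"
      by (rule finite_subset[OF _ finite_exponents_of_weight[of m k n FD]]) blast
    ultimately have "card (?down c') < card (?down c)" by (rule psubset_card_mono[rotated])
    from less.hyps[OF this c'(1) inv' wt'] have "poly_fun m k c' \<in> ?V" .
    moreover have "fun_scale (c A) ?f \<in> ?V"
      using t(1) by (intro mat_fun.span_scale mat_fun.span_base) blast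
    ultimately have "poly_fun m k c' + fun_scale (c A) ?f \<in> ?V" by (rule mat_fun.span_add)
    moreover have "poly_fun m k c' + fun_scale (c A) ?f = poly_fun m k c"
      unfolding c'(2) by (simp add: fun_eq_iff fun_scale_def)
    ultimately show ?thesis by simp
  qed
qed

text \<open>
  In a vanishing combination the largest leading exponent would occur with a nonzero
  coefficient, as distinct tableaux have distinct exponents.
\<close>

lemma standard_monomials_independent:
  assumes "n \<le> m" and FD: "FD \<in> diagram_pairs k n"
    and T: "finite T" "T \<subseteq> standard_tableaux m n FD"
    and sum: "(\<Sum>t\<in>T. fun_scale (b t) (standard_monomial m k t)) = 0"
    and t: "t \<in> T"
  shows "b t = 0"
proof (rule ccontr)
  assume "b t \<noteq> 0"
  obtain F D where FD': "FD = (F, D)" by (cases FD)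
  have std: "standard_tableau m n t" if "t \<in> T" for t
    using T(2) that by (auto simp: standard_tableaux_def FD')
  have card: "card I \<le> k" if "t \<in> T" "I \<in> set t" for t I
  proof (rule card_column_le[OF _ _ that(2)])
    show "outer_shape t = F" using T(2) that by (auto simp: standard_tableaux_def FD')
    show "F r = 0" if "k \<le> r" for r using diagram_pairs_zero(1)[of F D k n r] FD FD' that by simp
  qed
  have sub: "set t \<subseteq> column_sets m n" if "t \<in> T" for t
    using std[OF that] by (simp add: standard_tableau_def)
  have "has_leading m k (standard_monomial m k t) (tableau_exponent t)" if "t \<in> T" for t
    by (rule has_leading_standard_monomial)
      (use card[OF that] column_setsD(1)[OF _ assms(1)] sub[OF that] in blast)
  then have "\<forall>t\<in>T. \<exists>c. c \<in> poly_coeffs m k \<and> standard_monomial m k t = poly_fun m k c \<and>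
      leading c (tableau_exponent t) \<and> c (tableau_exponent t) = 1"
    unfolding has_leading_def by blast
  then obtain d where d: "\<And>t. t \<in> T \<Longrightarrow> d t \<in> poly_coeffs m k"
      "\<And>t. t \<in> T \<Longrightarrow> standard_monomial m k t = poly_fun m k (d t)"
      "\<And>t. t \<in> T \<Longrightarrow> leading (d t) (tableau_exponent t)"
      "\<And>t. t \<in> T \<Longrightarrow> d t (tableau_exponent t) = 1"
    unfolding bchoice_iff by blast
  define S where "S = {t \<in> T. b t \<noteq> 0}"
  have S: "finite S" "S \<noteq> {}" "S \<subseteq> T" using T(1) t \<open>b t \<noteq> 0\<close> by (auto simp: S_def)
  have "tableau_exponent ` S \<subseteq> exponents m k"
    using tableau_exponent_in_exponents[OF sub assms(1)] card S(3) by blast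
  then obtain t0 where t0: "t0 \<in> S"
    and max: "\<And>s. s \<in> S \<Longrightarrow> tableau_exponent s = tableau_exponent t0 \<or>
        lex_less (tableau_exponent s) (tableau_exponent t0)"
    using exists_lex_max[of "tableau_exponent ` S" m k] S by auto
  let ?A = "tableau_exponent t0"
  let ?c = "\<lambda>A. \<Sum>t\<in>T. b t * d t A"
  have other: "b s * d s ?A = 0" if "s \<in> T" "s \<noteq> t0" for s
  proof (rule ccontr)
    assume nz: "b s * d s ?A \<noteq> 0"
    then have "s \<in> S" using that by (simp add: S_def)
    have ne: "tableau_exponent s \<noteq> ?A"
      using tableau_exponent_inj[OF std std assms(1)] that t0 S(3) by blast
    then have "lex_less (tableau_exponent s) ?A" using max[OF \<open>s \<in> S\<close>] by blast
    moreover have "lex_less ?A (tableau_exponent s)"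
      using d(3)[OF that(1)] nz ne unfolding leading_def by auto
    ultimately show False using lex_less_trans lex_less_irrefl by blast
  qed
  have "?c ?A = (\<Sum>t\<in>{t0}. b t * d t ?A)"
    by (rule sum.mono_neutral_right) (use T(1) t0 S(3) other in auto)
  then have "?c ?A \<noteq> 0" using t0 S(3) d(4) by (auto simp: S_def)
  have "?c \<in> poly_coeffs m k \<and> poly_fun m k ?c = (\<Sum>t\<in>T. poly_fun m k (\<lambda>A. b t * d t A))"
    by (rule poly_fun_sum[OF T(1)]) (rule poly_fun_scale(1)[OF d(1)])
  moreover have "(\<Sum>t\<in>T. poly_fun m k (\<lambda>A. b t * d t A)) = 0"
  proof -
    have "(\<Sum>t\<in>T. poly_fun m k (\<lambda>A. b t * d t A)) = (\<Sum>t\<in>T. fun_scale (b t) (standard_monomial m k t))"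
      by (rule sum.cong) (simp_all add: poly_fun_scale(2)[OF d(1)] d(2))
    then show ?thesis using sum by simp
  qed
  ultimately show False using poly_fun_nonzero[of ?c m k ?A] \<open>?c ?A \<noteq> 0\<close> by simp
qed

lemma polynomial_functions_zero: "0 \<in> polynomial_functions m k"
proof -
  have "on_mats m k (\<lambda>Q. 0) = 0" by (simp add: on_mats_def fun_eq_iff)
  then show ?thesis using polynomial_functions.const[of m k 0] by simp
qed

lemma polynomial_functions_scale:
  assumes "f \<in> polynomial_functions m k"
  shows "fun_scale a f \<in> polynomial_functions m k"
proof -
  obtain c where "c \<in> poly_coeffs m k" "f = poly_fun m k c"
    using polynomial_functions_poly_fun[OF assms] by blast
  then show ?thesis using poly_fun_scale(2)[of c m k a] poly_fun_polynomial by metis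
qed

lemma branching_component_subspace: "mat_fun.subspace (branching_component m k n FD)"
proof -
  obtain F D where FD: "FD = (F, D)" by (cases FD)
  show ?thesis unfolding FD
  proof (rule mat_fun.subspaceI)
    show "0 \<in> branching_component m k n (F, D)"
      by (simp add: branching_component_def GL_rep_def fun_act_linear fun_scale_simps
          polynomial_functions_zero)
    show "f + g \<in> branching_component m k n (F, D)"
      if "f \<in> branching_component m k n (F, D)" "g \<in> branching_component m k n (F, D)" for f g
      using that by (simp add: branching_component_def GL_rep_def fun_act_linear fun_scale_simps
          polynomial_functions.add)
    show "fun_scale a f \<in> branching_component m k n (F, D)"
      if "f \<in> branching_component m k n (F, D)" for a f
      using that by (simp add: branching_component_def GL_rep_def fun_act_linear fun_scale_simps
          polynomial_functions_scale mult.commute)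
  qed
qed

lemma branching_algebra_subspace: "mat_fun.subspace (branching_algebra m k n)"
  by (rule mat_fun.subspaceI)
    (simp_all add: branching_algebra_def fun_act_linear polynomial_functions_zero
      polynomial_functions.add polynomial_functions_scale)

lemma branching_component_eq_span:
  assumes "n \<le> m" and FD: "FD \<in> diagram_pairs k n"
  shows "mat_fun.span (standard_monomial m k ` standard_tableaux m n FD) = branching_component m k n FD"
proof
  have "standard_monomial m k t \<in> branching_component m k n FD" if "t \<in> standard_tableaux m n FD" for t
    using standard_monomial_in_component[OF assms(1), of "fst FD" "snd FD" k t] FD that by simp
  then show "mat_fun.span (standard_monomial m k ` standard_tableaux m n FD)
      \<subseteq> branching_component m k n FD"
    by (intro mat_fun.span_minimal branching_component_subspace) blast
  show "branching_component m k n FD \<subseteq>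
      mat_fun.span (standard_monomial m k ` standard_tableaux m n FD)"
  proof
    fix f assume f: "f \<in> branching_component m k n FD"
    obtain c where c: "c \<in> poly_coeffs m k" "f = poly_fun m k c"
      using polynomial_functions_poly_fun[OF branching_componentD(1)[OF assms(1) f]] by blast
    have "shear_invariant m k n f"
      using branching_algebra_shear_invariant[OF assms(1)] branching_component_subset[OF assms(1)] f
      by blast
    moreover have hom: "torus_homogeneous m k n FD (poly_fun m k c)"
      using branching_component_homogeneous[OF assms(1) f] c(2) by simp
    ultimately show "f \<in> mat_fun.span (standard_monomial m k ` standard_tableaux m n FD)"
      unfolding c(2)
      by (intro shear_invariant_in_span[OF assms(1) c(1)])
        (auto intro: homogeneous_exponent_weight[OF assms(1) c(1) hom _ FD])
  qed
qed

lemma standard_monomials_basis: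
  assumes "n \<le> m" and FD: "FD \<in> diagram_pairs k n"
  shows "is_indexed_basis (standard_monomial m k) (standard_tableaux m n FD) (branching_component m k n FD)"
proof -
  let ?v = "standard_monomial m k" and ?T = "standard_tableaux m n FD"
  have inj: "inj_on ?v ?T"
  proof (rule inj_onI, rule ccontr)
    fix s t assume st: "s \<in> ?T" "t \<in> ?T" "?v s = ?v t" "s \<noteq> t"
    have "(\<Sum>x\<in>{s, t}. fun_scale (if x = s then 1 else - 1) (?v x)) = 0"
      using st by (simp add: fun_scale_def fun_eq_iff)
    from standard_monomials_independent[OF assms _ _ this, of s] st show False by simp
  qed
  have "mat_fun.independent (?v ` ?T)"
    unfolding mat_fun.dependent_explicit
  proof clarify
    fix S u f assume S: "finite S" "S \<subseteq> ?v ` ?T" "(\<Sum>v\<in>S. fun_scale (u v) v) = 0" "f \<in> S" "u f \<noteq> 0"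
    obtain T where T: "T \<subseteq> ?T" "finite T" "S = ?v ` T" using finite_subset_image[OF S(1,2)] by blast
    have "inj_on ?v T" using inj T(1) inj_on_subset by blast
    then have "(\<Sum>t\<in>T. fun_scale (u (?v t)) (?v t)) = 0" using S(3) T(3) by (simp add: sum.reindex)
    moreover obtain t where "t \<in> T" "f = ?v t" using S(4) T(3) by blast
    ultimately show False
      using standard_monomials_independent[OF assms T(2,1), of "\<lambda>t. u (?v t)" t] S(5) by simp
  qed
  then show ?thesis
    unfolding is_indexed_basis_def using inj branching_component_eq_span[OF assms] by blast
qed

section \<open>The grading\<close>

lemma diagram_pairs_add:
  assumes "i \<in> diagram_pairs k n" "j \<in> diagram_pairs k n"
  shows "i + j \<in> diagram_pairs k n"
proof -
  have "antimono (F + F')" if "antimono F" "antimono F'" for F F' :: "nat \<Rightarrow> nat"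
    by (rule antimonoI) (use that in \<open>auto intro!: add_mono dest: antimonoD\<close>)
  then show ?thesis using assms unfolding diagram_pairs_eq by (auto simp: add_mono)
qed

lemma diagram_pairs_zero_mem: "0 \<in> diagram_pairs k n"
proof -
  have "antimono (0 :: nat \<Rightarrow> nat)" by (rule antimonoI) simp
  then show ?thesis unfolding diagram_pairs_eq by (simp add: zero_prod_def)
qed

lemma branching_component_mult:
  assumes f: "f \<in> branching_component m k n i" and g: "g \<in> branching_component m k n j"
  shows "f * g \<in> branching_component m k n (i + j)"
proof -
  obtain F D F' D' where ij: "i = (F, D)" "j = (F', D')" by (cases i, cases j)
  have "weight r (E + E') a = weight r E a * weight r E' a" for r E E' a
    by (simp add: weight_def power_add prod.distrib)
  then show ?thesis
    using f g by (simp add: ij branching_component_def GL_rep_def fun_act_linear fun_scale_simps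
        polynomial_functions.mult)
qed

lemma mat_one_in_component:
  assumes "n \<le> m"
  shows "mat_one m k \<in> branching_component m k n 0"
proof -
  have "outer_shape [] = 0" "inner_shape n [] = 0"
    by (auto simp: outer_shape_conv inner_shape_def fun_eq_iff)
  then have "[] \<in> standard_tableaux m n (0, 0)"
    by (simp add: standard_tableaux_def standard_tableau_def)
  moreover have "(0, 0) \<in> diagram_pairs k n"
    using diagram_pairs_zero_mem by (simp add: zero_prod_def)
  ultimately have "standard_monomial m k [] \<in> branching_component m k n (0, 0)"
    by (rule standard_monomial_in_component[OF assms, rotated])
  then show ?thesis by (simp add: standard_monomial_simps zero_prod_def)
qed

lemma branching_algebra_subalgebra:
  assumes "n \<le> m"
  shows "is_subalgebra m k (branching_algebra m k n)"
  unfolding is_subalgebra_def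
proof (intro conjI ballI branching_algebra_subspace)
  show "branching_algebra m k n \<subseteq> polynomial_functions m k" by (auto simp: branching_algebra_def)
  show "mat_one m k \<in> branching_algebra m k n"
    using mat_one_in_component[OF assms] branching_component_subset[OF assms] by blast
  show "f * g \<in> branching_algebra m k n"
    if "f \<in> branching_algebra m k n" "g \<in> branching_algebra m k n" for f g
    using that by (simp add: branching_algebra_def fun_act_linear polynomial_functions.mult)
qed

lemma polynomial_function_eqI:
  assumes "f \<in> polynomial_functions m k" "\<And>q. f (of_array m k q) = 0"
  shows "f = 0"
proof
  fix Q
  obtain c where "f = poly_fun m k c" using polynomial_functions_poly_fun[OF assms(1)] by blast
  then show "f Q = (0 :: complex mat \<Rightarrow> complex) Q"
    using assms(2)[of "\<lambda>r j. Q $$ (r, j)"]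
    by (cases "Q \<in> carrier_mat m k") (simp_all add: of_array_entries poly_fun_def on_mats_def)
qed

text \<open>
  Distinct diagram pairs are distinct characters of the product of the two tori.
\<close>

lemma homogeneous_sum_zero:
  assumes fin: "finite K" and K: "K \<subseteq> diagram_pairs k n"
    and d: "\<And>i. i \<in> K \<Longrightarrow> d i \<in> polynomial_functions m k" "\<And>i. i \<in> K \<Longrightarrow> torus_homogeneous m k n i (d i)"
    and sum: "(\<Sum>i\<in>K. d i) = 0" and i: "i \<in> K"
  shows "d i = 0"
proof (rule polynomial_function_eqI[OF d(1)[OF i]])
  fix q
  define E where "E = (\<lambda>i v. if v < k then fst i v else snd i (v - k) :: nat)"
  have "(\<Sum>i\<in>K. d i (of_array m k q) * (\<Prod>v<k + n. \<zeta> v ^ E i v)) = 0"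
    if \<zeta>: "\<forall>v<k + n. \<zeta> v \<noteq> 0" for \<zeta>
  proof -
    let ?w = "\<lambda>i. \<zeta> (k + i)"
    have "d i (of_array m k q) * (\<Prod>v<k + n. \<zeta> v ^ E i v) = d i (of_array m k (scale_array n ?w \<zeta> q))"
      if "i \<in> K" for i
      using d(2)[OF that, unfolded torus_homogeneous_def, rule_format, of ?w \<zeta> q] \<zeta>
      unfolding prod_lessThan_add by (simp add: E_def)
    then have "(\<Sum>i\<in>K. d i (of_array m k q) * (\<Prod>v<k + n. \<zeta> v ^ E i v)) =
        (\<Sum>i\<in>K. d i (of_array m k (scale_array n ?w \<zeta> q)))" by (rule sum.cong[OF refl])
    also have "\<dots> = (\<Sum>i\<in>K. d i) (of_array m k (scale_array n ?w \<zeta> q))"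
      using fin by (induction K rule: finite_induct) auto
    finally show ?thesis using sum by simp
  qed
  from monomials_independent[OF fin this, of "E i"]
  have "(\<Sum>l\<in>{l\<in>K. \<forall>v<k + n. E l v = E i v}. d l (of_array m k q)) = 0" .
  moreover have "{l\<in>K. \<forall>v<k + n. E l v = E i v} = {i}"
  proof -
    have "l = i" if l: "l \<in> K" and eq: "\<forall>v<k + n. E l v = E i v" for l
    proof -
      obtain F D F' D' where li: "l = (F, D)" "i = (F', D')" by (cases l, cases i)
      have z: "(F, D) \<in> diagram_pairs k n" "(F', D') \<in> diagram_pairs k n" using l i K li by auto
      have "F r = F' r" for r
        using diagram_pairs_zero(1)[OF z(1), of r] diagram_pairs_zero(1)[OF z(2), of r]
          eq[rule_format, of r] by (cases "r < k") (auto simp: E_def li)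
      moreover have "D r = D' r" for r
        using diagram_pairs_zero(2)[OF z(1), of r] diagram_pairs_zero(2)[OF z(2), of r]
          eq[rule_format, of "k + r"] by (cases "r < n") (auto simp: E_def li)
      ultimately show ?thesis by (simp add: li fun_eq_iff)
    qed
    then show ?thesis using i by blast
  qed
  ultimately show "d i (of_array m k q) = 0" by simp
qed

text \<open>
  The components are cut out on coefficients.  Each is only known to be shear invariant, yet
  this suffices to place it in the span of standard monomials, hence in the component of its
  weight, and to show that its weight is a shape.
\<close>

lemma weight_decomposition:
  assumes "n \<le> m" and f: "f \<in> branching_algebra m k n"
  obtains x where "\<And>i. i \<in> diagram_pairs k n \<Longrightarrow> x i \<in> branching_component m k n i"
    "\<And>i. i \<notin> diagram_pairs k n \<Longrightarrow> x i = 0" "finite {i. x i \<noteq> 0}" "f = (\<Sum>i\<in>{i. x i \<noteq> 0}. x i)"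
proof -
  have "f \<in> polynomial_functions m k" using f by (simp add: branching_algebra_def)
  then obtain c where c: "c \<in> poly_coeffs m k" "f = poly_fun m k c"
    using polynomial_functions_poly_fun by blast
  let ?c = "\<lambda>i. weight_part m k n i c"
  define x where "x = (\<lambda>i. poly_fun m k (?c i))"
  let ?W = "exponent_weight m k n ` {A. c A \<noteq> 0}"
  have sub: "{A. ?c i A \<noteq> 0} \<subseteq> {A. c A \<noteq> 0}" for i by (auto simp: weight_part_def)
  have ci: "?c i \<in> poly_coeffs m k" for i by (rule coeffs_subset[OF c(1) sub])
  have wt: "exponent_weight m k n A = i" if "?c i A \<noteq> 0" for i A
    using that by (auto simp: weight_part_def split: if_splits)
  have inv: "shear_invariant m k n (x i)" for i
    unfolding x_def using branching_algebra_shear_invariant[OF assms]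
    by (intro weight_part_shear_invariant[OF assms(1) c(1)]) (simp add: c(2))
  have span: "x i \<in> mat_fun.span (standard_monomial m k ` standard_tableaux m n i)" for i
    unfolding x_def using inv[of i] wt
    by (intro shear_invariant_in_span[OF assms(1) ci]) (auto simp: x_def)
  have zero: "x i = 0" if i: "i \<notin> diagram_pairs k n" for i
  proof -
    have "?c i A = 0" for A
    proof (rule ccontr)
      assume "?c i A \<noteq> 0"
      then obtain B where "leading (?c i) B" using leading_exists[of "?c i" m k A] ci by blast
      then show False
        using leading_exponent_of_tableau[of n m "?c i" k B i, OF assms(1) ci _ inv[unfolded x_def] wt] i
        by blast
    qed
    then have "?c i = (\<lambda>A. 0)" by (simp add: fun_eq_iff)
    then show ?thesis by (simp add: x_def poly_fun_zero)
  qed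
  have W: "x i = 0" if "i \<notin> ?W" for i
  proof -
    have "?c i = (\<lambda>A. 0)" using that by (auto simp: weight_part_def fun_eq_iff)
    then show ?thesis by (simp add: x_def poly_fun_zero)
  qed
  have finc: "finite {A. c A \<noteq> 0}" using c(1) by (simp add: poly_coeffs_def)
  have "{i. x i \<noteq> 0} \<subseteq> ?W" using W by blast
  then have fin: "finite {i. x i \<noteq> 0}" using finc finite_subset by blast
  have "f = (\<Sum>i\<in>?W. x i)"
  proof -
    have "(\<lambda>A. \<Sum>i\<in>?W. ?c i A) = c"
    proof
      fix A
      show "(\<Sum>i\<in>?W. ?c i A) = c A"
        using finc by (cases "c A = 0") (auto simp: weight_part_def sum.delta')
    qed
    then show ?thesis
      using poly_fun_sum[of ?W ?c m k] finc ci by (simp add: c(2) x_def)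
  qed
  also have "\<dots> = (\<Sum>i\<in>{i. x i \<noteq> 0}. x i)"
    by (rule sum.mono_neutral_right) (use finc W in auto)
  finally have sum: "f = (\<Sum>i\<in>{i. x i \<noteq> 0}. x i)" .
  show ?thesis
  proof (rule that[of x])
    show "x i \<in> branching_component m k n i" if "i \<in> diagram_pairs k n" for i
      using span[of i] unfolding branching_component_eq_span[OF assms(1) that] .
  qed (use zero fin sum in blast)+
qed

lemma branching_algebra_direct_sum:
  assumes "n \<le> m"
  shows "is_direct_sum (diagram_pairs k n) (branching_component m k n) (branching_algebra m k n)"
  unfolding is_direct_sum_def
proof (intro conjI ballI branching_algebra_subspace branching_component_subspace
    branching_component_subset[OF assms])
  fix f assume f: "f \<in> branching_algebra m k n"
  let ?P = "\<lambda>x. (\<forall>i\<in>diagram_pairs k n. x i \<in> branching_component m k n i) \<and>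
      (\<forall>i. i \<notin> diagram_pairs k n \<longrightarrow> x i = 0) \<and> finite {i. x i \<noteq> 0} \<and> f = (\<Sum>i\<in>{i. x i \<noteq> 0}. x i)"
  show "\<exists>!x. ?P x"
  proof (rule ex_ex1I)
    obtain x where x: "\<And>i. i \<in> diagram_pairs k n \<Longrightarrow> x i \<in> branching_component m k n i"
      "\<And>i. i \<notin> diagram_pairs k n \<Longrightarrow> x i = 0" "finite {i. x i \<noteq> 0}" "f = (\<Sum>i\<in>{i. x i \<noteq> 0}. x i)"
      using weight_decomposition[OF assms f] by blast
    then show "\<exists>x. ?P x" by (intro exI[of _ x]) simp
  next
    fix x y assume x: "?P x" and y: "?P y"
    define K where "K = {i. x i \<noteq> 0} \<union> {i. y i \<noteq> 0}"
    let ?d = "\<lambda>i. x i - y i"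
    have fin: "finite K" using x y by (simp add: K_def)
    have K: "K \<subseteq> diagram_pairs k n" using x y by (auto simp: K_def)
    have d: "?d i \<in> branching_component m k n i" if "i \<in> K" for i
      using that K x y by (intro mat_fun.subspace_diff[OF branching_component_subspace]) auto
    have ext: "f = (\<Sum>i\<in>K. z i)" if "?P z" "{i. z i \<noteq> 0} \<subseteq> K" for z
    proof -
      have "f = (\<Sum>i\<in>{i. z i \<noteq> 0}. z i)" using that(1) by simp
      also have "\<dots> = (\<Sum>i\<in>K. z i)" by (rule sum.mono_neutral_left) (use that(2) fin in auto)
      finally show ?thesis .
    qed
    have "(\<Sum>i\<in>K. x i) = (\<Sum>i\<in>K. y i)"
      using ext[OF x] ext[OF y] by (simp add: K_def)
    then have "(\<Sum>i\<in>K. ?d i) = 0" by (simp add: sum_subtractf)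
    then have "?d i = 0" if "i \<in> K" for i
      using homogeneous_sum_zero[OF fin K, of ?d m i] branching_componentD(1)[OF assms d]
        branching_component_homogeneous[OF assms d] that by blast
    moreover have "?d i = 0" if "i \<notin> K" for i using that by (simp add: K_def)
    ultimately have "?d i = 0" for i by blast
    then have "x i = y i" for i by simp
    then show "x = y" by (rule HOL.ext)
  qed
qed

theorem theorem3p7p1:
  fixes m n k :: nat
  assumes "n < m" and "1 \<le> n" and "1 \<le> k" and "k \<le> m"
  shows "is_graded_algebra m k (diagram_pairs k n) (branching_component m k n)
           (branching_algebra m k n) \<and>
         (\<forall>FD \<in> diagram_pairs k n.
            is_indexed_basis (standard_monomial m k) (standard_tableaux m n FD)
              (branching_component m k n FD))"
proof -
  have "n \<le> m" using assms(1) by simp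
  then have "is_graded_algebra m k (diagram_pairs k n) (branching_component m k n)
      (branching_algebra m k n)"
    unfolding is_graded_algebra_def
    by (intro conjI ballI branching_algebra_subalgebra diagram_pairs_zero_mem diagram_pairs_add
        branching_algebra_direct_sum mat_one_in_component branching_component_mult)
  then show ?thesis
    by (intro conjI ballI standard_monomials_basis[OF \<open>n \<le> m\<close>])
qed

end
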